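(* Let $n\ge 2$, $\alpha\in\,]0,1[$, $T>0$, and let $\Omega$ be a bounded open subset of $\mathbb{R}^n$ of class $C^{1,\alpha}$. Let $\mu\in C_0^0([0,T]\times\partial\Omega)$. If $\left(\pm\tfrac12 I+W^*_{\partial\Omega}\right)[\mu]\in C_0^{\frac{\alpha}{2};\alpha}([0,T]\times\partial\Omega)$ (for a choice of sign), then $\mu\in C_0^{\frac{\alpha}{2};\alpha}([0,T]\times\partial\Omega)$.
   Context: $C_0^0([0,T]\times\partial\Omega)$ denotes continuous functions on $[0,T]\times\partial\Omega$ vanishing at $t=0$; $C_0^{\frac{\alpha}{2};\alpha}([0,T]\times\partial\Omega)$ denotes those which moreover are $\frac{\alpha}{2}$-Hölder in $t$ uniformly in $x$ and $\alpha$-Hölder in $x$ uniformly in $t$. $S_n(t,x)=(4\pi t)^{-n/2}e^{-|x|^2/(4t)}$ for $t>0$, $S_n=0$ for $t\le0$, and $W^*_{\partial\Omega}[\mu](t,x)=\int_0^t\int_{\partial\Omega}\frac{\partial}{\partial\nu_\Omega(x)}S_n(t-\tau,x-y)\mu(\tau,y)\,d\sigma_y\,d\tau$ for $(t,x)\in[0,T]\times\partial\Omega$, where $\nu_\Omega$ is the outward unit normal to $\partial\Omega$. *)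

theory Defs
  imports "HOL-Analysis.Analysis"
begin

definition hausdorff_const :: "real \<Rightarrow> real" where
  "hausdorff_const s = pi powr (s / 2) / (Gamma (s / 2 + 1) * 2 powr s)"

definition hausdorff_pre :: "real \<Rightarrow> real \<Rightarrow> 'a::euclidean_space set \<Rightarrow> ennreal" where
  "hausdorff_pre s \<delta> A =
     (INF C \<in> {C :: nat \<Rightarrow> 'a set. A \<subseteq> (\<Union>i. C i) \<and>
                 (\<forall>i. bounded (C i) \<and> diameter (C i) \<le> \<delta>)}.
        (\<Sum>i. ennreal (hausdorff_const s * diameter (C i) powr s)))"

definition hausdorff_outer :: "real \<Rightarrow> 'a::euclidean_space set \<Rightarrow> ennreal" where
  "hausdorff_outer s A = (SUP \<delta> \<in> {0<..}. hausdorff_pre s \<delta> A)"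

definition hausdorff_measure :: "real \<Rightarrow> 'a::euclidean_space measure" where
  "hausdorff_measure s = measure_of UNIV (sets borel) (hausdorff_outer s)"

definition surface_measure :: "'a::euclidean_space set \<Rightarrow> 'a measure" where
  "surface_measure \<Omega> = restrict_space (hausdorff_measure (real DIM('a) - 1)) (frontier \<Omega>)"

text \<open>Locally, after choosing a unit direction e, Omega is the subgraph (in direction e)
  of a C^{1,alpha} function g defined on the hyperplane orthogonal to e.\<close>
definition C1alpha_domain :: "real \<Rightarrow> 'a::euclidean_space set \<Rightarrow> bool" where
  "C1alpha_domain \<alpha> \<Omega> \<longleftrightarrow>
    (\<forall>p\<in>frontier \<Omega>. \<exists>e r \<delta> M (g :: 'a \<Rightarrow> real) (G :: 'a \<Rightarrow> 'a).
       norm e = 1 \<and> r > 0 \<and> \<delta> > 0 \<and>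
       (let P = (\<lambda>x. x - (x \<bullet> e) *\<^sub>R e); B = {y. y \<bullet> e = 0 \<and> dist y (P p) < r} in
         (\<forall>y\<in>B. (g has_derivative (\<lambda>v. G y \<bullet> v)) (at y within {z. z \<bullet> e = 0}) \<and> G y \<bullet> e = 0) \<and>
         (\<forall>y\<in>B. \<forall>z\<in>B. norm (G y - G z) \<le> M * dist y z powr \<alpha>) \<and>
         \<Omega> \<inter> {x. dist (P x) (P p) < r \<and> \<bar>x \<bullet> e - p \<bullet> e\<bar> < \<delta>} =
           {x. dist (P x) (P p) < r \<and> \<bar>x \<bullet> e - p \<bullet> e\<bar> < \<delta> \<and> x \<bullet> e < g (P x)}))"

text \<open>Outward unit normal at a boundary point x: the unit vector orthogonal to the tangent
  hyperplane of the boundary at x and pointing out of Omega.\<close>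
definition outward_normal :: "'a::euclidean_space set \<Rightarrow> 'a \<Rightarrow> 'a" where
  "outward_normal \<Omega> x = (THE v. norm v = 1 \<and>
      ((\<lambda>y. ((y - x) \<bullet> v) / norm (y - x)) \<longlongrightarrow> 0) (at x within frontier \<Omega>) \<and>
      (\<forall>\<^sub>F t in at_right 0. x - t *\<^sub>R v \<in> \<Omega>))"

definition heat_kernel :: "real \<Rightarrow> 'a::euclidean_space \<Rightarrow> real" where
  "heat_kernel t x = (if t > 0 then (4 * pi * t) powr (- real DIM('a) / 2) * exp (- (norm x)\<^sup>2 / (4 * t))
                      else 0)"

definition W_star :: "'a::euclidean_space set \<Rightarrow> (real \<Rightarrow> 'a \<Rightarrow> real) \<Rightarrow> real \<Rightarrow> 'a \<Rightarrow> real" where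
  "W_star \<Omega> \<mu> t x =
     (\<integral>\<tau>\<in>{0..t}.
        (\<integral>y. frechet_derivative (\<lambda>z. heat_kernel (t - \<tau>) (z - y)) (at x) (outward_normal \<Omega> x) * \<mu> \<tau> y
           \<partial>surface_measure \<Omega>)
      \<partial>lborel)"

definition C00 :: "real \<Rightarrow> 'a::euclidean_space set \<Rightarrow> (real \<Rightarrow> 'a \<Rightarrow> real) \<Rightarrow> bool" where
  "C00 T \<Omega> \<mu> \<longleftrightarrow> continuous_on ({0..T} \<times> frontier \<Omega>) (\<lambda>(t, x). \<mu> t x) \<and>
                   (\<forall>x\<in>frontier \<Omega>. \<mu> 0 x = 0)"

definition C0_holder :: "real \<Rightarrow> real \<Rightarrow> 'a::euclidean_space set \<Rightarrow> (real \<Rightarrow> 'a \<Rightarrow> real) \<Rightarrow> bool" where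
  "C0_holder \<alpha> T \<Omega> \<mu> \<longleftrightarrow> C00 T \<Omega> \<mu> \<and>
     (\<exists>C. (\<forall>t\<in>{0..T}. \<forall>s\<in>{0..T}. \<forall>x\<in>frontier \<Omega>. \<bar>\<mu> t x - \<mu> s x\<bar> \<le> C * \<bar>t - s\<bar> powr (\<alpha> / 2)) \<and>
          (\<forall>t\<in>{0..T}. \<forall>x\<in>frontier \<Omega>. \<forall>y\<in>frontier \<Omega>. \<bar>\<mu> t x - \<mu> t y\<bar> \<le> C * norm (x - y) powr \<alpha>))"

end

theory Submission
  imports Defs
begin

text \<open>
  The kernel of \<open>W_star\<close> is bounded by \<open>\<bar>x - y\<bar> powr (1 + \<alpha>)\<close> times a Gaussian divided by \<open>u\<close>, where \<open>u = t - \<tau>\<close>,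
  because the normal is \<open>\<alpha>\<close>-Hoelder; its integral over the surface is therefore of order \<open>u powr (\<alpha> / 2 - 1)\<close>.
  Splitting the time integral at \<open>u = \<bar>t - s\<bar>\<close>, respectively at \<open>u = \<bar>x - x'\<bar>\<^sup>2\<close>, shows that \<open>W_star\<close> maps bounded
  densities to functions that are \<open>\<alpha>/2\<close>-Hoelder in time and that it raises the spatial Hoelder exponent by
  \<open>\<alpha>/2\<close>, up to the ceiling \<open>\<alpha>\<close>.  Since \<open>\<mu>\<close> is a multiple of \<open>W_star \<mu>\<close> plus a Hoelder function, two spatial steps suffice.

  At the ceiling the variation of the normal produces the first moment of a Gaussian over the surface, whose
  absolute value is too large by a logarithm.  It has to be cancelled by symmetry: in a graph chart the point
  reflection of the parameter domain is an almost isometric involution of the surface that almost maps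
  \<open>y - x\<close> to \<open>x - y\<close>, and Hausdorff measure is almost invariant under almost isometries.
\<close>

section \<open>Hausdorff measure\<close>

text \<open>The gain of \<open>\<alpha> / 2\<close> per step is dictated by the variation of the
  normal. With \<open>r = norm (x - x')\<close>, that part of the kernel carries the factor
  \<open>r powr \<alpha>\<close> and, against a density of spatial exponent \<beta>, the time weight
  \<open>v powr (\<beta> / 2 - 1)\<close>; for a merely bounded density its integral over
  \<open>v \<ge> r\<^sup>2\<close> diverges logarithmically as \<open>r\<close> tends to 0. Since
  \<open>r \<le> sqrt v\<close> there, the factor \<open>r powr (\<alpha> / 2 - \<beta>)\<close> can
  be given up to improve the weight to \<open>v powr (\<alpha> / 4 - 1)\<close>. At \<beta> =
  \<open>\<alpha> / 2\<close> nothing is left to give up, and the density is split as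
  \<open>\<mu> y = (\<mu> y - \<mu> x) + \<mu> x\<close>. Hoelder continuity serves the difference
  only. The constant part meets the first moment however regular \<mu> is, so iterating further
  cannot replace the cancellation. Any positive power of \<open>u\<close> gained there is enough,
  which is why an approximate reflection does the work of an exact change of variables.\<close>

lemma hausdorff_pre_Lipschitz_image:
  fixes f :: "'a::euclidean_space \<Rightarrow> 'b::euclidean_space"
  assumes L: "L > 0" and s: "s \<ge> 0"
    and lip: "\<And>x y. x \<in> A \<Longrightarrow> y \<in> A \<Longrightarrow> norm (f x - f y) \<le> L * norm (x - y)"
  shows "hausdorff_pre s (L * \<delta>) (f ` A) \<le> ennreal (L powr s) * hausdorff_pre s \<delta> A"
proof -
  have "hausdorff_pre s (L * \<delta>) (f ` A)
      \<le> ennreal (L powr s) * (\<Sum>i. ennreal (hausdorff_const s * diameter (C i) powr s))"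
    if C: "A \<subseteq> (\<Union>i. C i)" "\<And>i. bounded (C i)" "\<And>i. diameter (C i) \<le> \<delta>" for C :: "nat \<Rightarrow> 'a set"
  proof -
    \<comment> \<open>The pieces are cut down to \<open>A\<close> before \<open>f\<close> is
      applied, since \<open>f\<close> is controlled on \<open>A\<close> only.\<close>
    define E where "E i = f ` (C i \<inter> A)" for i
    have E_le: "norm (x - y) \<le> L * diameter (C i)" if "x \<in> E i" "y \<in> E i" for i x y
    proof -
      note xy = that
      obtain x' y' where *: "x' \<in> C i" "x' \<in> A" "x = f x'" "y' \<in> C i" "y' \<in> A" "y = f y'"
        using xy unfolding E_def by blast
      have "norm (x' - y') \<le> diameter (C i)"
        using diameter_bounded_bound[OF C(2) *(1) *(4)] by (simp add: dist_norm)
      then have "L * norm (x' - y') \<le> L * diameter (C i)" using L by simp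
      then show ?thesis using lip[OF *(2) *(5)] * by simp
    qed
    have dE: "diameter (E i) \<le> L * diameter (C i)" for i
      by (rule diameter_le) (use E_le L diameter_ge_0[OF C(2)] in auto)
    have bE: "bounded (E i)" for i
    proof (cases "E i = {}")
      case False
      then obtain z where "z \<in> E i" by auto
      then show ?thesis
        unfolding bounded_any_center[where a = z] using E_le by (auto simp: dist_norm)
    qed auto
    have "L * diameter (C i) \<le> L * \<delta>" for i
      using C(3)[of i] L by simp
    then have dE\<delta>: "diameter (E i) \<le> L * \<delta>" for i
      using dE[of i] order_trans by blast
    have cov: "f ` A \<subseteq> (\<Union>i. E i)" proof
      fix z assume "z \<in> f ` A"
      then obtain y where y: "y \<in> A" "z = f y" by auto
      then obtain i where "y \<in> C i" using C(1) by auto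
      with y have "z \<in> E i" by (simp add: E_def)
      then show "z \<in> (\<Union>i. E i)" by auto
    qed
    have "hausdorff_pre s (L * \<delta>) (f ` A) \<le> (\<Sum>i. ennreal (hausdorff_const s * diameter (E i) powr s))"
      unfolding hausdorff_pre_def by (rule INF_lower) (use cov bE dE\<delta> in auto)
    also have "\<dots> \<le> (\<Sum>i. ennreal (L powr s) * ennreal (hausdorff_const s * diameter (C i) powr s))"
    proof (rule suminf_le)
      fix i
      show "ennreal (hausdorff_const s * diameter (E i) powr s)
          \<le> ennreal (L powr s) * ennreal (hausdorff_const s * diameter (C i) powr s)"
      \<comment> \<open>A negative constant would be truncated by \<open>ennreal\<close> to 0 on
        both sides.\<close>
      proof (cases "hausdorff_const s \<ge> 0")
        case True
        have "diameter (E i) powr s \<le> (L * diameter (C i)) powr s"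
          using dE[of i] s diameter_ge_0[OF bE] by (intro powr_mono2) auto
        also have "\<dots> = L powr s * diameter (C i) powr s"
          using L diameter_ge_0[OF C(2)] by (simp add: powr_mult)
        finally have "hausdorff_const s * diameter (E i) powr s
            \<le> L powr s * (hausdorff_const s * diameter (C i) powr s)"
          using True by (metis mult.left_commute mult_left_mono)
        then show ?thesis
          by (simp add: ennreal_mult'[symmetric] ennreal_leI)
      next
        case False
        then show ?thesis by (simp add: ennreal_neg mult_nonpos_nonneg)
      qed
    qed auto
    finally show ?thesis by simp
  qed
  note le = this
  define X where "X = hausdorff_pre s (L * \<delta>) (f ` A)"
  define k where "k = L powr s"
  have k: "k > 0" using L by (simp add: k_def)
  have inv: "ennreal (1 / k) * (ennreal k * z) = z" for z
    using k by (simp add: mult.assoc[symmetric] ennreal_mult'[symmetric])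
  \<comment> \<open>The factor is first moved to the left, where it does not obstruct the infimum
    over covers, and is restored afterwards.\<close>
  have "ennreal (1 / k) * X \<le> hausdorff_pre s \<delta> A"
    unfolding hausdorff_pre_def[of s \<delta> A]
  proof (rule INF_greatest)
    fix C :: "nat \<Rightarrow> 'a set"
    assume C: "C \<in> {C. A \<subseteq> (\<Union>i. C i) \<and> (\<forall>i. bounded (C i) \<and> diameter (C i) \<le> \<delta>)}"
    have "ennreal (1 / k) * X
        \<le> ennreal (1 / k) * (ennreal k * (\<Sum>i. ennreal (hausdorff_const s * diameter (C i) powr s)))"
      unfolding X_def k_def by (intro mult_left_mono le) (use C in auto)
    then show "ennreal (1 / k) * X \<le> (\<Sum>i. ennreal (hausdorff_const s * diameter (C i) powr s))"
      by (simp only: inv)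
  qed
  then have "ennreal k * (ennreal (1 / k) * X) \<le> ennreal k * hausdorff_pre s \<delta> A"
    by (rule mult_left_mono) simp
  also have "ennreal k * (ennreal (1 / k) * X) = X"
    using inv[of X] by (simp add: mult.left_commute)
  finally show ?thesis by (simp add: X_def k_def)
qed

text \<open>As \<delta> runs through the positive numbers, so does \<open>\<delta> / L\<close>; the
  change of scale in the preliminary measure therefore disappears in the supremum.\<close>

lemma hausdorff_outer_Lipschitz_image:
  fixes f :: "'a::euclidean_space \<Rightarrow> 'b::euclidean_space"
  assumes L: "L > 0" and s: "s \<ge> 0"
    and lip: "\<And>x y. x \<in> A \<Longrightarrow> y \<in> A \<Longrightarrow> norm (f x - f y) \<le> L * norm (x - y)"
  shows "hausdorff_outer s (f ` A) \<le> ennreal (L powr s) * hausdorff_outer s A"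
  unfolding hausdorff_outer_def
proof (rule SUP_least)
  fix \<delta> :: real assume "\<delta> \<in> {0<..}"
  then have \<delta>: "\<delta> / L > 0" using L by simp
  have "hausdorff_pre s (L * (\<delta> / L)) (f ` A) \<le> ennreal (L powr s) * hausdorff_pre s (\<delta> / L) A"
    by (rule hausdorff_pre_Lipschitz_image[OF L s lip])
  also have "\<dots> \<le> ennreal (L powr s) * (SUP \<delta>\<in>{0<..}. hausdorff_pre s \<delta> A)"
    using \<delta> by (intro mult_left_mono SUP_upper) auto
  finally show "hausdorff_pre s \<delta> (f ` A) \<le> ennreal (L powr s) * (SUP \<delta>\<in>{0<..}. hausdorff_pre s \<delta> A)"
    using L by simp
qed

lemma sets_hausdorff_measure [simp]: "sets (hausdorff_measure s :: 'a::euclidean_space measure) = sets borel"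
  and space_hausdorff_measure [simp]: "space (hausdorff_measure s :: 'a measure) = UNIV"
  unfolding hausdorff_measure_def
  by (metis sets.sigma_sets_eq sets_measure_of_conv space_borel subset_Pow_Union top_greatest Pow_UNIV)
     (rule space_measure_of_conv)

text \<open>\<^const>\<open>measure_of\<close> yields the null measure when its argument is not countably additive.  All
  estimates needed here are upper bounds which the null measure satisfies as well, so that
  the measurability theory of Hausdorff measures (Caratheodory) can be bypassed.\<close>
lemma emeasure_hausdorff_measure_cases:
  obtains "\<And>A :: 'a::euclidean_space set. A \<in> sets borel \<Longrightarrow> emeasure (hausdorff_measure s) A = hausdorff_outer s A"
  | "\<And>A :: 'a set. emeasure (hausdorff_measure s) A = 0"
proof (cases "measure_space UNIV (sigma_sets UNIV (sets borel)) (hausdorff_outer s :: 'a set \<Rightarrow> ennreal)")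
  case True
  then show ?thesis
    using sets.sigma_sets_eq[of "borel :: 'a measure"]
    by (intro that(1)) (simp add: hausdorff_measure_def emeasure_measure_of_conv)
next
  case False
  then show ?thesis
    by (intro that(2)) (simp add: hausdorff_measure_def emeasure_measure_of_conv)
qed

section \<open>Surface measure under Lipschitz maps and upper bounds from covers\<close>

lemma space_surface_measure [simp]: "space (surface_measure \<Omega>) = frontier \<Omega>"
  by (simp add: surface_measure_def space_restrict_space)

lemma sets_surface_measure: "sets (surface_measure \<Omega>) = sets (restrict_space borel (frontier \<Omega>))"
  unfolding surface_measure_def by (intro sets_restrict_space_cong) simp

lemma in_sets_surface_measure:
  "A \<in> sets (surface_measure \<Omega>) \<longleftrightarrow> A \<in> sets borel \<and> A \<subseteq> frontier \<Omega>"
  by (auto simp: sets_surface_measure sets_restrict_space_iff borel_closed)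

lemma emeasure_surface_measure:
  fixes \<Omega> :: "'a::euclidean_space set"
  assumes "A \<in> sets borel" "A \<subseteq> frontier \<Omega>"
  shows "emeasure (surface_measure \<Omega>) A = emeasure (hausdorff_measure (real DIM('a) - 1)) A"
  unfolding surface_measure_def using assms
  by (intro emeasure_restrict_space) (auto simp: borel_closed)

lemma emeasure_surface_measure_le:
  fixes \<Omega> :: "'a::euclidean_space set"
  assumes "A \<in> sets borel" "A \<subseteq> frontier \<Omega>"
  shows "emeasure (surface_measure \<Omega>) A \<le> hausdorff_outer (real DIM('a) - 1) A"
  using emeasure_surface_measure[OF assms] assms(1)
  by (cases rule: emeasure_hausdorff_measure_cases[where s = "real DIM('a) - 1" and 'a='a]) simp_all

text \<open>The image is required to be Borel as well: the measure is tied to the outer measure on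
  Borel sets only, and Lipschitz images of Borel sets need not be Borel.\<close>

lemma emeasure_surface_measure_Lipschitz_image:
  fixes \<Omega> :: "'a::euclidean_space set"
  assumes "A \<in> sets borel" "A \<subseteq> frontier \<Omega>" "f ` A \<in> sets borel" "f ` A \<subseteq> frontier \<Omega>" and L: "L > 0"
    and lip: "\<And>x y. x \<in> A \<Longrightarrow> y \<in> A \<Longrightarrow> norm (f x - f y) \<le> L * norm (x - y)"
  shows "emeasure (surface_measure \<Omega>) (f ` A)
           \<le> ennreal (L powr (real DIM('a) - 1)) * emeasure (surface_measure \<Omega>) A"
proof -
  have s: "0 \<le> real DIM('a) - 1" by (simp add: Suc_leI)
  show ?thesis
    using hausdorff_outer_Lipschitz_image[OF L s lip] assms
    by (cases rule: emeasure_hausdorff_measure_cases[where s = "real DIM('a) - 1" and 'a='a])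
       (simp_all add: emeasure_surface_measure del: sets_hausdorff_measure)
qed

text \<open>\<open>hausdorff_pre\<close> asks for sequences, so the finite cover is padded with
  empty sets, whose diameter 0 contributes nothing.\<close>

lemma hausdorff_pre_le_finite_cover:
  fixes A :: "'a::euclidean_space set"
  assumes s: "s > 0" and fin: "finite I" and \<delta>: "\<delta> \<ge> 0"
    and cov: "A \<subseteq> (\<Union>i\<in>I. C i)"
    and C: "\<And>i x y. i \<in> I \<Longrightarrow> x \<in> C i \<Longrightarrow> y \<in> C i \<Longrightarrow> norm (x - y) \<le> \<delta>"
  shows "hausdorff_pre s \<delta> A \<le> ennreal (real (card I) * (hausdorff_const s * \<delta> powr s))"
proof -
  have c0: "hausdorff_const s \<ge> 0"
    unfolding hausdorff_const_def using s by (intro divide_nonneg_nonneg mult_nonneg_nonneg less_imp_le[OF Gamma_real_pos]) auto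
  obtain h where h: "bij_betw h {..<card I} I"
    using ex_bij_betw_nat_finite[OF fin] by (auto simp: atLeast0LessThan)
  define D where "D k = (if k < card I then C (h k) else {})" for k
  have D: "norm (x - y) \<le> \<delta>" if "x \<in> D k" "y \<in> D k" for k x y
    using that C[of "h k"] bij_betw_apply[OF h] unfolding D_def by (auto split: if_splits)
  have bD: "bounded (D k)" for k
  proof (cases "D k = {}")
    case False
    then obtain z where "z \<in> D k" by auto
    then show ?thesis
      unfolding bounded_any_center[where a = z] using D by (auto simp: dist_norm)
  qed auto
  have dD: "diameter (D k) \<le> \<delta>" for k
    by (rule diameter_le) (use D \<delta> in auto)
  have cD: "A \<subseteq> (\<Union>k. D k)"
  proof
    fix x assume "x \<in> A"
    then obtain i where "i \<in> I" "x \<in> C i" using cov by auto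
    have "i \<in> h ` {..<card I}" using \<open>i \<in> I\<close> bij_betw_imp_surj_on[OF h] by simp
    then obtain k where "k < card I" "h k = i" by auto
    then show "x \<in> (\<Union>k. D k)" using \<open>x \<in> C i\<close> by (auto simp: D_def intro!: exI[of _ k])
  qed
  have "hausdorff_pre s \<delta> A \<le> (\<Sum>k. ennreal (hausdorff_const s * diameter (D k) powr s))"
    unfolding hausdorff_pre_def by (rule INF_lower) (use cD bD dD in auto)
  also have "\<dots> = (\<Sum>k<card I. ennreal (hausdorff_const s * diameter (D k) powr s))"
    by (rule suminf_finite) (auto simp: D_def)
  also have "\<dots> \<le> (\<Sum>k<card I. ennreal (hausdorff_const s * \<delta> powr s))"
    using dD s bD c0
    by (intro sum_mono ennreal_leI mult_left_mono powr_mono2) (auto simp: diameter_ge_0)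
  also have "\<dots> = ennreal (real (card I) * (hausdorff_const s * \<delta> powr s))"
    using c0 by (simp add: ennreal_mult' ennreal_of_nat_eq_real_of_nat)
  finally show ?thesis .
qed

text \<open>A set on which the coordinates other than \<open>b\<close> control the distance has \<open>n - 1\<close>-dimensional content
  of order \<open>\<rho> ^ (n - 1)\<close>: subdivide these coordinates into cells of width \<open>\<rho> / N\<close>.\<close>
lemma hausdorff_outer_le_of_coordinates:
  fixes A :: "'a::euclidean_space set"
  assumes n: "DIM('a) \<ge> 2" and b: "b \<in> Basis" and \<rho>: "\<rho> > 0" and K: "K \<ge> 0"
    and A: "A \<subseteq> cball x \<rho>"
    and dist_le: "\<And>y z. y \<in> A \<Longrightarrow> z \<in> A \<Longrightarrow> norm (y - z) \<le> K * (\<Sum>i\<in>Basis - {b}. \<bar>(y - z) \<bullet> i\<bar>)"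
  shows "hausdorff_outer (real DIM('a) - 1) A
     \<le> ennreal (hausdorff_const (real DIM('a) - 1) * (3 * K * DIM('a)) powr (real DIM('a) - 1)
                 * \<rho> powr (real DIM('a) - 1))"
proof -
  define s where "s = real DIM('a) - 1"
  define m where "m = DIM('a) - 1"
  have s: "s > 0" and sm: "s = real m" using n by (auto simp: s_def m_def)
  have cardm: "card (Basis - {b}) = m" using b by (simp add: m_def card_Diff_singleton)
  have c0: "hausdorff_const s \<ge> 0"
    unfolding hausdorff_const_def using s by (intro divide_nonneg_nonneg mult_nonneg_nonneg less_imp_le[OF Gamma_real_pos]) auto
  have pre: "hausdorff_pre s \<delta> A \<le> ennreal (hausdorff_const s * (3 * K * DIM('a)) powr s * \<rho> powr s)"
    if \<delta>: "\<delta> > 0" for \<delta>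
  proof -
    obtain N :: nat where N: "N > K * DIM('a) * \<rho> / \<delta>" and N1: "N \<ge> 1"
    proof -
      obtain N :: nat where "real N > K * DIM('a) * \<rho> / \<delta>" using reals_Archimedean2 by blast
      then show ?thesis by (intro that[of "Suc N"]) auto
    qed
    \<comment> \<open>In each of the remaining coordinates \<open>y - x\<close> lies between -\<rho>
      and \<rho>, so the rounded multiples range from \<open>- N\<close> to \<open>N\<close>, both
      ends included. The resulting \<open>2 * N + 1 \<le> 3 * N\<close> choices per coordinate are
      the origin of the factor 3 in the bound.\<close>
    define I where "I = (Basis - {b}) \<rightarrow>\<^sub>E {- int N..int N}"
    define C where "C k = {y \<in> A. \<forall>i\<in>Basis - {b}. \<lfloor>(y - x) \<bullet> i * N / \<rho>\<rfloor> = k i}" for k :: "'a \<Rightarrow> int"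
    define d where "d = K * DIM('a) * \<rho> / N"
    have d0: "d \<ge> 0" using K \<rho> by (simp add: d_def)
    have d\<delta>: "d \<le> \<delta>"
      using N N1 \<delta> by (simp add: d_def field_simps)
    have finI: "finite I" unfolding I_def by (intro finite_PiE) auto
    have cardI: "card I = (2 * N + 1) ^ m"
    proof -
      have "nat (2 * int N + 1) = 2 * N + 1" by simp
      then show ?thesis unfolding I_def using cardm by (simp add: card_PiE)
    qed
    have cov: "A \<subseteq> (\<Union>k\<in>I. C k)"
    proof
      fix y assume y: "y \<in> A"
      define k where "k = restrict (\<lambda>i. \<lfloor>(y - x) \<bullet> i * N / \<rho>\<rfloor>) (Basis - {b})"
      have "- int N \<le> \<lfloor>(y - x) \<bullet> i * N / \<rho>\<rfloor> \<and> \<lfloor>(y - x) \<bullet> i * N / \<rho>\<rfloor> \<le> int N" if "i \<in> Basis" for i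
      proof -
        have "\<bar>(y - x) \<bullet> i\<bar> \<le> \<rho>"
          using Basis_le_norm[OF that, of "y - x"] A y by (force simp: dist_norm norm_minus_commute)
        then have "\<bar>(y - x) \<bullet> i / \<rho>\<bar> \<le> 1" using \<rho> by (simp add: field_simps)
        then have "\<bar>(y - x) \<bullet> i / \<rho> * N\<bar> \<le> N"
          unfolding abs_mult using mult_right_mono[of _ 1 "real N"] by fastforce
        then have "\<bar>(y - x) \<bullet> i * N / \<rho>\<bar> \<le> N" by simp
        then have 1: "(y - x) \<bullet> i * N / \<rho> \<le> N" "- real N \<le> (y - x) \<bullet> i * N / \<rho>" by linarith+
        show ?thesis using 1 by (simp add: le_floor_iff floor_le_iff)
      qed
      then have "k \<in> I" unfolding k_def I_def by auto
      moreover have "y \<in> C k" using y unfolding C_def k_def by auto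
      ultimately show "y \<in> (\<Union>k\<in>I. C k)" by blast
    qed
    have Cd: "norm (y - z) \<le> d" if "y \<in> C k" "z \<in> C k" for y z k
    proof -
      have "\<bar>(y - z) \<bullet> i\<bar> \<le> \<rho> / N" if i: "i \<in> Basis - {b}" for i
      proof -
        have "\<lfloor>(y - x) \<bullet> i * N / \<rho>\<rfloor> = \<lfloor>(z - x) \<bullet> i * N / \<rho>\<rfloor>"
          using \<open>y \<in> C k\<close> \<open>z \<in> C k\<close> i unfolding C_def by auto
        then have "\<bar>(y - x) \<bullet> i * N / \<rho> - (z - x) \<bullet> i * N / \<rho>\<bar> \<le> 1" by linarith
        also have "(y - x) \<bullet> i * N / \<rho> - (z - x) \<bullet> i * N / \<rho> = ((y - z) \<bullet> i) * (N / \<rho>)"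
          by (simp add: inner_diff_left diff_divide_distrib left_diff_distrib)
        finally have "\<bar>(y - z) \<bullet> i\<bar> * (N / \<rho>) \<le> 1"
          using \<rho> by (simp add: abs_mult)
        then show ?thesis using \<rho> N1 by (simp add: field_simps)
      qed
      then have "(\<Sum>i\<in>Basis - {b}. \<bar>(y - z) \<bullet> i\<bar>) \<le> (\<Sum>i\<in>Basis - {b}. \<rho> / N)"
        by (intro sum_mono) auto
      also have "\<dots> = m * (\<rho> / N)" using cardm by simp
      also have "\<dots> \<le> DIM('a) * (\<rho> / N)"
        using \<rho> by (intro mult_right_mono) (auto simp: m_def)
      finally have "K * (\<Sum>i\<in>Basis - {b}. \<bar>(y - z) \<bullet> i\<bar>) \<le> K * (DIM('a) * (\<rho> / N))"
        using K by (intro mult_left_mono)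
      moreover have "norm (y - z) \<le> K * (\<Sum>i\<in>Basis - {b}. \<bar>(y - z) \<bullet> i\<bar>)"
        using that dist_le unfolding C_def by auto
      ultimately show ?thesis by (simp add: d_def)
    qed
    \<comment> \<open>A smaller scale admits fewer covers. The cells are charged at their own mesh
      \<open>d\<close> instead of \<delta>, because only then do the powers of \<open>N\<close> in
      their number and in their size cancel.\<close>
    have "hausdorff_pre s \<delta> A \<le> hausdorff_pre s d A"
      unfolding hausdorff_pre_def using d\<delta> by (intro INF_superset_mono) (auto intro: order_trans)
    also have "\<dots> \<le> ennreal (real (card I) * (hausdorff_const s * d powr s))"
      by (rule hausdorff_pre_le_finite_cover[OF s finI d0 cov]) (use Cd in auto)
    also have "\<dots> \<le> ennreal (hausdorff_const s * (3 * K * DIM('a)) powr s * \<rho> powr s)"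
    proof (rule ennreal_leI)
      have "real (card I) = (2 * N + 1) powr s"
        unfolding cardI sm by (simp add: powr_realpow)
      also have "\<dots> \<le> (3 * N) powr s"
        using N1 s by (intro powr_mono2) auto
      finally have "real (card I) * (hausdorff_const s * d powr s) \<le> (3 * N) powr s * (hausdorff_const s * d powr s)"
        using c0 by (intro mult_right_mono) auto
      also have "\<dots> = hausdorff_const s * (3 * N * d) powr s"
        using d0 by (simp add: powr_mult)
      also have "3 * N * d = (3 * K * DIM('a)) * \<rho>" using N1 by (simp add: d_def)
      also have "hausdorff_const s * \<dots> powr s = hausdorff_const s * (3 * K * DIM('a)) powr s * \<rho> powr s"
        using K \<rho> by (simp add: powr_mult)
      finally show "real (card I) * (hausdorff_const s * d powr s) \<le> hausdorff_const s * (3 * K * DIM('a)) powr s * \<rho> powr s" .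
    qed
    finally show ?thesis .
  qed
  show ?thesis
    unfolding hausdorff_outer_def s_def[symmetric] by (rule SUP_least) (use pre in auto)
qed

section \<open>Geometry of the boundary\<close>

text \<open>Normalisation is Lipschitz away from the origin. This carries the Hoelder estimate from
  the vectors \<open>e - G (P x)\<close>, whose length is at least 1, to the unit normals.\<close>

lemma norm_normalize_diff_le:
  fixes u v :: "'a::real_inner"
  assumes "norm u \<ge> 1" "norm v \<ge> 1"
  shows "norm (u /\<^sub>R norm u - v /\<^sub>R norm v) \<le> 2 * norm (u - v)"
proof -
  have u: "norm u > 0" and v: "norm v > 0" using assms by linarith+
  have "u /\<^sub>R norm u - v /\<^sub>R norm v = (u - v) /\<^sub>R norm u + ((norm v - norm u) / (norm u * norm v)) *\<^sub>R v"
    using u v by (simp add: algebra_simps divide_simps) (simp add: field_simps flip: scaleR_add_left)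
  also have "norm \<dots> \<le> norm (u - v) / norm u + \<bar>norm v - norm u\<bar> / norm u"
    using u v by (intro order_trans[OF norm_triangle_ineq]) (simp add: divide_simps)
  also have "\<dots> \<le> norm (u - v) / norm u + norm (u - v) / norm u"
    using u norm_triangle_ineq3[of u v] by (intro add_left_mono divide_right_mono) (auto simp: abs_minus_commute)
  also have "\<dots> = 2 * norm (u - v) / norm u" by simp
  also have "\<dots> \<le> 2 * norm (u - v)"
    using assms u by (simp add: divide_le_eq mult_le_cancel_left1)
  finally show ?thesis .
qed

lemma tendsto_norm_powr_0:
  fixes f :: "'b \<Rightarrow> 'a::real_normed_vector"
  assumes "(f \<longlongrightarrow> 0) F" "\<alpha> > 0"
  shows "((\<lambda>x. C * norm (f x) powr \<alpha>) \<longlongrightarrow> 0) F"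
  using assms by (intro tendsto_mult_right_zero tendsto_zero_powrI[where b = \<alpha>] tendsto_norm_zero) auto

text \<open>\<open>G\<close> is the gradient of \<open>g\<close> along the hyperplane orthogonal to
  \<open>e\<close>. Hence \<open>e - G (P x)\<close> is an unnormalised normal of the graph, and it
  points away from the subgraph, that is, out of \<open>\<Omega>\<close>.\<close>

locale boundary_chart =
  fixes \<Omega> :: "'a::euclidean_space set" and p e :: 'a and \<alpha> r \<delta> M :: real
    and g :: "'a \<Rightarrow> real" and G :: "'a \<Rightarrow> 'a" and P :: "'a \<Rightarrow> 'a" and B :: "'a set"
  assumes alpha_pos: "\<alpha> > 0" and open_\<Omega>: "open \<Omega>" and p: "p \<in> frontier \<Omega>"
    and norm_e: "norm e = 1" and r_pos: "r > 0" and \<delta>_pos: "\<delta> > 0"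
  defines "P \<equiv> \<lambda>x. x - (x \<bullet> e) *\<^sub>R e"
    and "B \<equiv> {y. y \<bullet> e = 0 \<and> dist y (P p) < r}"
  assumes g_deriv: "y \<in> B \<Longrightarrow> (g has_derivative (\<lambda>v. G y \<bullet> v)) (at y within {z. z \<bullet> e = 0})"
    and G_orth: "y \<in> B \<Longrightarrow> G y \<bullet> e = 0"
    and G_hoelder: "y \<in> B \<Longrightarrow> z \<in> B \<Longrightarrow> norm (G y - G z) \<le> M * dist y z powr \<alpha>"
    and subgraph: "\<Omega> \<inter> {x. dist (P x) (P p) < r \<and> \<bar>x \<bullet> e - p \<bullet> e\<bar> < \<delta>} =
           {x. dist (P x) (P p) < r \<and> \<bar>x \<bullet> e - p \<bullet> e\<bar> < \<delta> \<and> x \<bullet> e < g (P x)}"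
begin

definition "Cyl = {x. dist (P x) (P p) < r \<and> \<bar>x \<bullet> e - p \<bullet> e\<bar> < \<delta>}"

lemma ee [simp]: "e \<bullet> e = 1"
  using norm_e by (simp add: norm_eq_1)

lemma P_orth [simp]: "P x \<bullet> e = 0"
  by (simp add: P_def inner_diff_left)

lemma P_decomp: "x = P x + (x \<bullet> e) *\<^sub>R e"
  by (simp add: P_def)

lemma P_add: "P (x + y) = P x + P y" and P_scaleR: "P (c *\<^sub>R x) = c *\<^sub>R P x" and P_diff: "P (x - y) = P x - P y"
  by (simp_all add: P_def algebra_simps inner_add_left inner_diff_left scaleR_add_left)

lemma P_e [simp]: "P e = 0"
  by (simp add: P_def)

lemma P_id: "w \<bullet> e = 0 \<Longrightarrow> P w = w"
  by (simp add: P_def)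

lemma norm_P_le: "norm (P x) \<le> norm x"
proof -
  have "P x \<bullet> P x = x \<bullet> x - (x \<bullet> e)\<^sup>2"
    by (simp add: P_def inner_diff_left inner_diff_right inner_commute power2_eq_square)
  then show ?thesis by (simp add: norm_le)
qed

lemma dist_P_le: "dist (P x) (P y) \<le> dist x y"
  using norm_P_le[of "x - y"] by (simp add: dist_norm P_diff)

lemma continuous_P [continuous_intros]: "continuous_on S P"
  unfolding P_def by (intro continuous_intros)

lemma P_in_B: "x \<in> Cyl \<Longrightarrow> P x \<in> B"
  by (simp add: Cyl_def B_def)

lemma open_Cyl: "open Cyl"
  unfolding Cyl_def by (intro open_Collect_conj open_Collect_less continuous_intros)

lemma convex_B: "convex B"
proof -
  have "B = {y. e \<bullet> y = 0} \<inter> ball (P p) r"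
    by (auto simp: B_def dist_commute inner_commute)
  then show ?thesis by (simp add: convex_Int convex_hyperplane)
qed

text \<open>Mean value inequality for \<open>g\<close> minus a linear map on the convex set
  \<open>B \<inter> cball w0 \<rho>\<close>. The linearisation is taken at a third point
  \<open>w0\<close> because the reflection compares increments between arbitrary pairs of points
  with the gradient at its centre.\<close>

lemma g_increment:
  assumes "w0 \<in> B" "w1 \<in> B" "w2 \<in> B" "dist w1 w0 \<le> \<rho>" "dist w2 w0 \<le> \<rho>"
  shows "\<bar>g w1 - g w2 - G w0 \<bullet> (w1 - w2)\<bar> \<le> \<bar>M\<bar> * \<rho> powr \<alpha> * norm (w1 - w2)"
proof -
  define S where "S = B \<inter> cball w0 \<rho>"
  have S: "convex S" unfolding S_def by (intro convex_Int convex_B convex_cball)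
  have "norm ((g w1 - G w0 \<bullet> w1) - (g w2 - G w0 \<bullet> w2)) \<le> (\<bar>M\<bar> * \<rho> powr \<alpha>) * norm (w1 - w2)"
  proof (rule differentiable_bound[OF S])
    fix y assume y: "y \<in> S"
    have "(g has_derivative (\<lambda>v. G y \<bullet> v)) (at y within S)"
      by (rule has_derivative_subset[OF g_deriv]) (use y in \<open>auto simp: S_def B_def\<close>)
    then show "((\<lambda>y. g y - G w0 \<bullet> y) has_derivative (\<lambda>v. G y \<bullet> v - G w0 \<bullet> v)) (at y within S)"
      by (auto intro!: derivative_eq_intros)
    show "onorm (\<lambda>v. G y \<bullet> v - G w0 \<bullet> v) \<le> \<bar>M\<bar> * \<rho> powr \<alpha>"
    proof (rule onorm_le)
      fix v
      have "norm (G y \<bullet> v - G w0 \<bullet> v) \<le> norm (G y - G w0) * norm v"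
        by (simp add: Cauchy_Schwarz_ineq2 flip: inner_diff_left)
      moreover have "norm (G y - G w0) \<le> \<bar>M\<bar> * \<rho> powr \<alpha>"
      proof -
        have "norm (G y - G w0) \<le> M * dist y w0 powr \<alpha>"
          using y assms by (intro G_hoelder) (auto simp: S_def)
        also have "\<dots> \<le> \<bar>M\<bar> * \<rho> powr \<alpha>"
          using y alpha_pos by (intro mult_mono powr_mono2) (auto simp: S_def dist_commute)
        finally show ?thesis .
      qed
      ultimately show "norm (G y \<bullet> v - G w0 \<bullet> v) \<le> \<bar>M\<bar> * \<rho> powr \<alpha> * norm v"
        by (meson dual_order.trans mult_right_mono norm_ge_zero)
    qed
  qed (use assms in \<open>auto simp: S_def dist_commute\<close>)
  then show ?thesis by (simp add: inner_diff_right algebra_simps)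
qed

lemma continuous_on_g: "continuous_on B g"
  unfolding continuous_on_eq_continuous_within
  by (auto intro!: has_derivative_continuous[OF has_derivative_subset[OF g_deriv]]) (auto simp: B_def)

lemma in_\<Omega>_iff: "x \<in> Cyl \<Longrightarrow> x \<in> \<Omega> \<longleftrightarrow> x \<bullet> e < g (P x)"
  using subgraph unfolding Cyl_def by auto

text \<open>A point above the graph has, by continuity of \<open>g\<close>, a neighbourhood that
  misses \<open>\<Omega>\<close>; a point on the graph is a limit of points directly below
  it.\<close>

lemma in_frontier_iff:
  assumes x: "x \<in> Cyl"
  shows "x \<in> frontier \<Omega> \<longleftrightarrow> x \<bullet> e = g (P x)"
proof
  assume F: "x \<in> frontier \<Omega>"
  then have "x \<notin> \<Omega>" and cl: "x \<in> closure \<Omega>" using open_\<Omega> by (auto simp: frontier_def interior_open)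
  then have ge: "x \<bullet> e \<ge> g (P x)" using in_\<Omega>_iff[OF x] by simp
  have "\<not> x \<bullet> e > g (P x)"
  proof
    assume gt: "x \<bullet> e > g (P x)"
    define V where "V = {y \<in> Cyl. y \<bullet> e - g (P y) > 0}"
    have "continuous_on Cyl (\<lambda>y. y \<bullet> e - g (P y))"
      by (intro continuous_intros continuous_on_compose2[OF continuous_on_g]) (auto simp: P_in_B)
    then have "open V"
      using continuous_open_preimage[OF _ open_Cyl, of "\<lambda>y. y \<bullet> e - g (P y)" "{0<..}"]
      by (simp add: V_def vimage_def Int_def conj_commute)
    moreover have "x \<in> V" using gt x by (simp add: V_def)
    moreover have "V \<inter> \<Omega> = {}" using in_\<Omega>_iff by (force simp: V_def)
    ultimately show False using cl by (metis IntI closure_iff_nhds_not_empty empty_iff order_refl inf_commute)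
  qed
  then show "x \<bullet> e = g (P x)" using ge by simp
next
  assume eq: "x \<bullet> e = g (P x)"
  have "x \<notin> \<Omega>" using in_\<Omega>_iff[OF x] eq by simp
  moreover have "x \<in> closure \<Omega>"
    unfolding closure_approachable
  proof (intro allI impI)
    fix \<epsilon> :: real assume \<epsilon>: "\<epsilon> > 0"
    define t where "t = min (\<epsilon> / 2) ((\<delta> - \<bar>x \<bullet> e - p \<bullet> e\<bar>) / 2)"
    have t: "t > 0" "t < \<epsilon>" "t < \<delta> - \<bar>x \<bullet> e - p \<bullet> e\<bar>"
      using \<epsilon> x by (auto simp: t_def Cyl_def min_def)
    have P: "P (x - t *\<^sub>R e) = P x" by (simp add: P_diff P_scaleR)
    have "x - t *\<^sub>R e \<in> Cyl"
      using x t by (auto simp: Cyl_def P inner_diff_left)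
    then have "x - t *\<^sub>R e \<in> \<Omega>"
      using in_\<Omega>_iff eq t by (simp add: P inner_diff_left)
    moreover have "dist (x - t *\<^sub>R e) x < \<epsilon>" using t norm_e by (simp add: dist_norm)
    ultimately show "\<exists>y\<in>\<Omega>. dist y x < \<epsilon>" by blast
  qed
  ultimately show "x \<in> frontier \<Omega>" using open_\<Omega> by (simp add: frontier_def interior_open)
qed

lemma norm_normal_ge: "y \<in> B \<Longrightarrow> norm (e - G y) \<ge> 1"
  using Cauchy_Schwarz_ineq2[of "e - G y" e] G_orth[of y] norm_e by (simp add: inner_diff_left)

text \<open>For two points of the graph, the inner product with \<open>e - G (P x)\<close> is
  exactly the error of the linearisation of \<open>g\<close> at \<open>P x\<close>, and the Hoelder
  gradient makes it of order \<open>1 + \<alpha>\<close>.\<close>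

lemma normal_increment:
  assumes "x \<in> Cyl" "y \<in> Cyl" "x \<in> frontier \<Omega>" "y \<in> frontier \<Omega>"
  shows "\<bar>(y - x) \<bullet> (e - G (P x))\<bar> \<le> \<bar>M\<bar> * norm (y - x) powr (1 + \<alpha>)"
proof -
  have xe: "x \<bullet> e = g (P x)" and ye: "y \<bullet> e = g (P y)"
    using assms in_frontier_iff by auto
  have "(y - x) \<bullet> G (P x) = G (P x) \<bullet> (P y - P x)"
    using G_orth[OF P_in_B[OF assms(1)]] by (simp add: P_def inner_diff_right inner_diff_left inner_commute algebra_simps)
  then have "(y - x) \<bullet> (e - G (P x)) = g (P y) - g (P x) - G (P x) \<bullet> (P y - P x)"
    by (simp add: inner_diff_right inner_diff_left xe ye)
  also have "\<bar>\<dots>\<bar> \<le> \<bar>M\<bar> * dist (P y) (P x) powr \<alpha> * norm (P y - P x)"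
    using assms by (intro g_increment) (auto simp: P_in_B)
  also have "\<dots> \<le> \<bar>M\<bar> * norm (y - x) powr \<alpha> * norm (y - x)"
    using alpha_pos dist_P_le[of y x] by (intro mult_mono powr_mono2) (auto simp: dist_norm)
  also have "\<dots> = \<bar>M\<bar> * norm (y - x) powr (1 + \<alpha>)"
    by (cases "y = x") (simp_all add: powr_add)
  finally show ?thesis .
qed

lemma eventually_in_Cyl:
  assumes "x \<in> Cyl" "(f \<longlongrightarrow> x) F"
  shows "\<forall>\<^sub>F t in F. f t \<in> Cyl"
  using topological_tendstoD[OF assms(2) open_Cyl assms(1)] .

text \<open>Along the ray the height changes by \<open>t * c\<close>, while the height of the graph
  below it changes by \<open>- (t * c) * (norm G0)\<^sup>2\<close> up to an error smaller than
  \<open>\<bar>t * c\<bar>\<close>. The two main terms have opposite signs and cannot compensate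
  each other. This is what distinguishes the outward from the inward normal.\<close>

lemma normal_ray:
  assumes x: "x \<in> Cyl" "x \<in> frontier \<Omega>" and c: "c \<noteq> 0"
  shows "\<forall>\<^sub>F t in at_right 0. x + (t * c) *\<^sub>R (e - G (P x)) \<in> \<Omega> \<longleftrightarrow> c < 0"
proof -
  define G0 where "G0 = G (P x)"
  have G0: "G0 \<bullet> e = 0" using G_orth[OF P_in_B[OF x(1)]] by (simp add: G0_def)
  define z where "z t = x + (t * c) *\<^sub>R (e - G0)" for t
  have "(z \<longlongrightarrow> x + (0 * c) *\<^sub>R (e - G0)) (at_right 0)"
    unfolding z_def by (intro tendsto_intros)
  then have ev1: "\<forall>\<^sub>F t in at_right 0. z t \<in> Cyl"
    using x by (intro eventually_in_Cyl) auto
  have "((\<lambda>t. (\<bar>M\<bar> * norm G0) * norm ((t * c) *\<^sub>R G0) powr \<alpha>) \<longlongrightarrow> 0) (at_right 0)"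
    by (rule tendsto_norm_powr_0[OF _ alpha_pos]) (auto intro!: tendsto_eq_intros)
  then have ev2: "\<forall>\<^sub>F t in at_right 0. (\<bar>M\<bar> * norm G0) * norm ((t * c) *\<^sub>R G0) powr \<alpha> < 1"
    by (rule order_tendstoD) simp
  have ev3: "\<forall>\<^sub>F t in at_right (0::real). t > 0"
    by (rule eventually_at_right_less)
  show ?thesis
    using ev1 ev2 ev3
  proof eventually_elim
    case (elim t)
    have Pz: "P (z t) = P x - (t * c) *\<^sub>R G0"
      using G0 by (simp add: z_def P_add P_scaleR P_diff P_id)
    have ze: "z t \<bullet> e = g (P x) + t * c"
      using G0 x in_frontier_iff[OF x(1)] by (simp add: z_def inner_add_left inner_diff_left)
    have "\<bar>g (P (z t)) - g (P x) - G (P x) \<bullet> (P (z t) - P x)\<bar>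
        \<le> \<bar>M\<bar> * dist (P (z t)) (P x) powr \<alpha> * norm (P (z t) - P x)"
      using x elim(1) by (intro g_increment) (auto simp: P_in_B)
    also have "G (P x) \<bullet> (P (z t) - P x) = - (t * c) * (norm G0)\<^sup>2"
      by (simp add: Pz G0_def power2_norm_eq_inner)
    also have "\<bar>M\<bar> * dist (P (z t)) (P x) powr \<alpha> * norm (P (z t) - P x)
        = ((\<bar>M\<bar> * norm G0) * norm ((t * c) *\<^sub>R G0) powr \<alpha>) * \<bar>t * c\<bar>"
      by (simp add: Pz dist_norm)
    finally have "\<bar>g (P (z t)) - g (P x) + (t * c) * (norm G0)\<^sup>2\<bar>
        \<le> ((\<bar>M\<bar> * norm G0) * norm ((t * c) *\<^sub>R G0) powr \<alpha>) * \<bar>t * c\<bar>" by simp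
    also have "\<dots> < 1 * \<bar>t * c\<bar>"
      using elim c by (intro mult_strict_right_mono) auto
    finally have lt: "\<bar>g (P (z t)) - g (P x) + (t * c) * (norm G0)\<^sup>2\<bar> < \<bar>t * c\<bar>" by simp
    have "z t \<bullet> e < g (P (z t)) \<longleftrightarrow> c < 0"
    proof (cases "c < 0")
      case True
      then have "t * c < 0" "(t * c) * (norm G0)\<^sup>2 \<le> 0"
        using elim by (auto simp: mult_pos_neg mult_le_0_iff)
      then show ?thesis using lt ze True by linarith
    next
      case False
      then have "t * c > 0" "(t * c) * (norm G0)\<^sup>2 \<ge> 0" using elim c by auto
      then show ?thesis using lt ze False by linarith
    qed
    then show ?case
      using in_\<Omega>_iff[OF elim(1)] by (simp add: z_def G0_def)
  qed
qed

text \<open>The limit is tested along the curve on the graph over the segment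
  \<open>P x + t *\<^sub>R w\<close>. Its direction tends to
  \<open>w + (G (P x) \<bullet> w) *\<^sub>R e\<close>, which is nonzero because \<open>w\<close> is
  nonzero and orthogonal to \<open>e\<close>, so \<open>v\<close> must be orthogonal to it.\<close>

lemma tangent_vector:
  assumes x: "x \<in> Cyl" "x \<in> frontier \<Omega>" and w: "w \<bullet> e = 0"
    and lim: "((\<lambda>y. ((y - x) \<bullet> v) / norm (y - x)) \<longlongrightarrow> 0) (at x within frontier \<Omega>)"
  shows "w \<bullet> v + (G (P x) \<bullet> w) * (e \<bullet> v) = 0"
proof (cases "w = 0")
  case False
  define G0 where "G0 = G (P x)"
  define q where "q t = (g (P x + t *\<^sub>R w) - g (P x)) / t" for t
  define y where "y t = x + t *\<^sub>R w + (g (P x + t *\<^sub>R w) - g (P x)) *\<^sub>R e" for t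
  have Py: "P (y t) = P x + t *\<^sub>R w" for t
    using w by (simp add: y_def P_add P_scaleR P_id)
  have xe: "x \<bullet> e = g (P x)" using x in_frontier_iff by auto
  have ye: "y t \<bullet> e = g (P (y t))" for t
    using w xe unfolding Py by (simp add: y_def inner_add_left)
  have PB: "P x \<in> B" by (rule P_in_B[OF x(1)])
  have "((\<lambda>t. dist (P x + t *\<^sub>R w) (P p)) \<longlongrightarrow> dist (P x + 0 *\<^sub>R w) (P p)) (at_right 0)"
    by (intro tendsto_intros)
  then have "\<forall>\<^sub>F t in at_right 0. dist (P x + t *\<^sub>R w) (P p) < r"
    by (rule order_tendstoD) (use PB in \<open>simp add: B_def\<close>)
  then have evB: "\<forall>\<^sub>F t in at_right 0. P x + t *\<^sub>R w \<in> B"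
    by eventually_elim (use w in \<open>simp add: B_def inner_add_left\<close>)
  have pos: "\<forall>\<^sub>F t in at_right (0::real). t > 0"
    by (rule eventually_at_right_less)
  have "((\<lambda>t. q t - G0 \<bullet> w) \<longlongrightarrow> 0) (at_right 0)"
  proof (rule Lim_null_comparison)
    show "((\<lambda>t. (\<bar>M\<bar> * norm w) * norm (t *\<^sub>R w) powr \<alpha>) \<longlongrightarrow> 0) (at_right 0)"
      by (rule tendsto_norm_powr_0[OF _ alpha_pos]) (auto intro!: tendsto_eq_intros)
    show "\<forall>\<^sub>F t in at_right 0. norm (q t - G0 \<bullet> w) \<le> (\<bar>M\<bar> * norm w) * norm (t *\<^sub>R w) powr \<alpha>"
      using evB pos
    proof eventually_elim
      case (elim t)
      have "\<bar>g (P x + t *\<^sub>R w) - g (P x) - G (P x) \<bullet> (P x + t *\<^sub>R w - P x)\<bar>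
          \<le> \<bar>M\<bar> * dist (P x + t *\<^sub>R w) (P x) powr \<alpha> * norm (P x + t *\<^sub>R w - P x)"
        using elim PB by (intro g_increment) auto
      then have "\<bar>g (P x + t *\<^sub>R w) - g (P x) - t * (G0 \<bullet> w)\<bar> \<le> (\<bar>M\<bar> * norm w) * norm (t *\<^sub>R w) powr \<alpha> * t"
        using elim by (simp add: G0_def dist_norm mult_ac)
      moreover have "q t - G0 \<bullet> w = (g (P x + t *\<^sub>R w) - g (P x) - t * (G0 \<bullet> w)) / t"
        using elim by (simp add: q_def field_simps)
      ultimately show ?case using elim by (simp add: abs_divide divide_le_eq)
    qed
  qed
  then have q: "(q \<longlongrightarrow> G0 \<bullet> w) (at_right 0)" by (simp add: LIM_zero_iff)
  have yq: "\<forall>\<^sub>F t in at_right 0. y t = x + t *\<^sub>R (w + q t *\<^sub>R e)"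
    using pos by eventually_elim (simp add: y_def q_def scaleR_add_right)
  have "((\<lambda>t. x + t *\<^sub>R (w + q t *\<^sub>R e)) \<longlongrightarrow> x + 0 *\<^sub>R (w + (G0 \<bullet> w) *\<^sub>R e)) (at_right 0)"
    by (intro tendsto_intros q)
  then have ylim: "(y \<longlongrightarrow> x) (at_right 0)"
    using yq by (simp add: tendsto_cong)
  have ne: "w + c *\<^sub>R e \<noteq> 0" for c
    using False w by (metis P_add P_e P_id P_scaleR add.right_neutral diff_self P_diff scaleR_zero_right)
  have "filterlim y (at x within frontier \<Omega>) (at_right 0)"
    unfolding filterlim_at
  proof (intro conjI ylim)
    show "\<forall>\<^sub>F t in at_right 0. y t \<in> frontier \<Omega> \<and> y t \<noteq> x"
      using eventually_in_Cyl[OF x(1) ylim] yq pos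
    proof eventually_elim
      case (elim t)
      then show ?case using in_frontier_iff[OF elim(1)] ye[of t] ne[of "q t"] by auto
    qed
  qed
  then have "((\<lambda>t. ((y t - x) \<bullet> v) / norm (y t - x)) \<longlongrightarrow> 0) (at_right 0)"
    by (rule filterlim_compose[OF lim])
  moreover have "\<forall>\<^sub>F t in at_right 0. ((y t - x) \<bullet> v) / norm (y t - x)
      = ((w + q t *\<^sub>R e) \<bullet> v) / norm (w + q t *\<^sub>R e)"
    using yq pos by eventually_elim simp
  ultimately have "((\<lambda>t. ((w + q t *\<^sub>R e) \<bullet> v) / norm (w + q t *\<^sub>R e)) \<longlongrightarrow> 0) (at_right 0)"
    by (simp add: tendsto_cong)
  moreover have "((\<lambda>t. ((w + q t *\<^sub>R e) \<bullet> v) / norm (w + q t *\<^sub>R e)) \<longlongrightarrow>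
      ((w + (G0 \<bullet> w) *\<^sub>R e) \<bullet> v) / norm (w + (G0 \<bullet> w) *\<^sub>R e)) (at_right 0)"
    using ne by (intro tendsto_intros q) auto
  ultimately have "((w + (G0 \<bullet> w) *\<^sub>R e) \<bullet> v) / norm (w + (G0 \<bullet> w) *\<^sub>R e) = 0"
    using tendsto_unique trivial_limit_at_right_real by blast
  then show ?thesis using ne by (simp add: G0_def inner_add_left)
qed simp

text \<open>This resolves the definite description. The tangency limit is
  \<open>normal_increment\<close> divided by the distance; uniqueness follows from
  \<open>tangent_vector\<close> up to sign, and the sign from \<open>normal_ray\<close>.\<close>

lemma outward_normal_chart:
  assumes x: "x \<in> Cyl" "x \<in> frontier \<Omega>"
  shows "outward_normal \<Omega> x = (e - G (P x)) /\<^sub>R norm (e - G (P x))"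
proof -
  define N where "N = e - G (P x)"
  have N: "norm N \<ge> 1" using norm_normal_ge[OF P_in_B[OF x(1)]] by (simp add: N_def)
  have Ge: "G (P x) \<bullet> e = 0" using G_orth[OF P_in_B[OF x(1)]] .
  define c where "c = 1 / norm N"
  have c: "c > 0" using N unfolding c_def by (intro divide_pos_pos) auto
  show ?thesis
    unfolding outward_normal_def N_def[symmetric]
  proof (rule the_equality)
    have "((\<lambda>y. ((y - x) \<bullet> (N /\<^sub>R norm N)) / norm (y - x)) \<longlongrightarrow> 0) (at x within frontier \<Omega>)"
    proof (rule Lim_null_comparison)
      have "((\<lambda>y. y - x) \<longlongrightarrow> x - x) (at x within frontier \<Omega>)" by (intro tendsto_intros)
      then show "((\<lambda>y. \<bar>M\<bar> * norm (y - x) powr \<alpha>) \<longlongrightarrow> 0) (at x within frontier \<Omega>)"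
        by (intro tendsto_norm_powr_0 alpha_pos) simp
      have "\<forall>\<^sub>F y in at x within frontier \<Omega>. y \<in> Cyl"
        by (rule eventually_in_Cyl[OF x(1)]) (rule tendsto_ident_at)
      moreover have "\<forall>\<^sub>F y in at x within frontier \<Omega>. y \<in> frontier \<Omega> \<and> y \<noteq> x"
        by (simp add: eventually_at_filter)
      ultimately show "\<forall>\<^sub>F y in at x within frontier \<Omega>.
          norm (((y - x) \<bullet> (N /\<^sub>R norm N)) / norm (y - x)) \<le> \<bar>M\<bar> * norm (y - x) powr \<alpha>"
      proof eventually_elim
        case (elim y)
        have "\<bar>(y - x) \<bullet> N\<bar> / norm N \<le> \<bar>(y - x) \<bullet> N\<bar> / 1"
          using N by (intro divide_left_mono) auto
        also have "\<dots> \<le> \<bar>M\<bar> * norm (y - x) powr (1 + \<alpha>)"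
          using normal_increment x elim unfolding N_def by simp
        also have "\<dots> = (\<bar>M\<bar> * norm (y - x) powr \<alpha>) * norm (y - x)"
          using elim by (simp add: powr_add)
        finally have "\<bar>(y - x) \<bullet> N\<bar> / norm N / norm (y - x) \<le> \<bar>M\<bar> * norm (y - x) powr \<alpha>"
          using elim by (subst pos_divide_le_eq) auto
        then show ?case using N by (simp add: divide_inverse abs_mult mult_ac)
      qed
    qed
    moreover have "\<forall>\<^sub>F t in at_right 0. x - t *\<^sub>R (N /\<^sub>R norm N) \<in> \<Omega>"
      using normal_ray[OF x, of "- c"] c unfolding N_def[symmetric] by (simp add: c_def divide_inverse)
    moreover have "N \<noteq> 0" using N by auto
    then have "norm (N /\<^sub>R norm N) = 1" by simp
    ultimately show "norm (N /\<^sub>R norm N) = 1 \<and>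
      ((\<lambda>y. ((y - x) \<bullet> (N /\<^sub>R norm N)) / norm (y - x)) \<longlongrightarrow> 0) (at x within frontier \<Omega>) \<and>
      (\<forall>\<^sub>F t in at_right 0. x - t *\<^sub>R (N /\<^sub>R norm N) \<in> \<Omega>)" by blast
  next
    fix v
    assume v: "norm v = 1 \<and> ((\<lambda>y. ((y - x) \<bullet> v) / norm (y - x)) \<longlongrightarrow> 0) (at x within frontier \<Omega>) \<and>
      (\<forall>\<^sub>F t in at_right 0. x - t *\<^sub>R v \<in> \<Omega>)"
    \<comment> \<open>Since \<open>N \<bullet> e = 1\<close>, the vector \<open>z\<close> lies in
      the hyperplane and is an admissible direction in \<open>tangent_vector\<close>. The expression
      which that lemma annihilates turns out to be \<open>z \<bullet> z\<close>.\<close>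
    define z where "z = v - (v \<bullet> e) *\<^sub>R N"
    have ze: "z \<bullet> e = 0" using Ge by (simp add: z_def N_def inner_diff_left)
    have "z \<bullet> v + (G (P x) \<bullet> z) * (e \<bullet> v) = 0"
      using tangent_vector[OF x ze] v by blast
    moreover have "z \<bullet> z = z \<bullet> v + (G (P x) \<bullet> z) * (e \<bullet> v)"
      using ze by (subst (2) z_def) (simp add: N_def inner_diff_right inner_commute algebra_simps)
    ultimately have "z = 0" by simp
    then have vN: "v = (v \<bullet> e) *\<^sub>R N" by (simp add: z_def)
    then have "\<bar>v \<bullet> e\<bar> * norm N = 1" using v by (metis norm_scaleR)
    moreover have "N \<noteq> 0" using N by auto
    ultimately have "\<bar>v \<bullet> e\<bar> = c" unfolding c_def by (simp add: field_simps)
    moreover have "v \<bullet> e > 0"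
    proof (rule ccontr)
      assume "\<not> v \<bullet> e > 0"
      then have neg: "v \<bullet> e = - c" using \<open>\<bar>v \<bullet> e\<bar> = c\<close> by linarith
      have "\<forall>\<^sub>F t in at_right 0. x - t *\<^sub>R v \<in> \<Omega>" using v by blast
      moreover have "\<forall>\<^sub>F t in at_right 0. \<not> x + (t * c) *\<^sub>R N \<in> \<Omega>"
        using normal_ray[OF x, of c] c unfolding N_def[symmetric] by simp
      ultimately have "\<forall>\<^sub>F t in at_right (0::real). False"
      proof eventually_elim
        case (elim t)
        have "x - t *\<^sub>R v = x + (t * c) *\<^sub>R N" by (subst vN) (simp add: neg)
        with elim show ?case by metis
      qed
      then show False by simp
    qed
    ultimately show "v = N /\<^sub>R norm N" using vN by (simp add: c_def divide_inverse)
  qed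
qed

lemma outward_normal_local:
  assumes "x \<in> Cyl" "x \<in> frontier \<Omega>" "y \<in> Cyl" "y \<in> frontier \<Omega>"
  shows "norm (outward_normal \<Omega> x) = 1"
    and "norm (outward_normal \<Omega> x - outward_normal \<Omega> y) \<le> 2 * \<bar>M\<bar> * norm (x - y) powr \<alpha>"
    and "\<bar>outward_normal \<Omega> x \<bullet> (x - y)\<bar> \<le> 2 * \<bar>M\<bar> * norm (x - y) powr (1 + \<alpha>)"
proof -
  let ?N = "\<lambda>x. e - G (P x)"
  have N: "norm (?N x) \<ge> 1" "norm (?N y) \<ge> 1"
    using assms norm_normal_ge P_in_B by auto
  have "?N x \<noteq> 0" using N by auto
  then show "norm (outward_normal \<Omega> x) = 1"
    by (simp add: outward_normal_chart[OF assms(1,2)])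
  have "norm (outward_normal \<Omega> x - outward_normal \<Omega> y) \<le> 2 * norm (?N x - ?N y)"
    unfolding outward_normal_chart[OF assms(1,2)] outward_normal_chart[OF assms(3,4)]
    using norm_normalize_diff_le[OF N] .
  also have "norm (?N x - ?N y) = norm (G (P x) - G (P y))"
    by (simp add: norm_minus_commute)
  also have "\<dots> \<le> M * dist (P x) (P y) powr \<alpha>"
    using assms by (intro G_hoelder) (auto simp: P_in_B)
  also have "\<dots> \<le> \<bar>M\<bar> * norm (x - y) powr \<alpha>"
    using alpha_pos dist_P_le[of x y] by (intro mult_mono powr_mono2) (auto simp: dist_norm)
  finally show "norm (outward_normal \<Omega> x - outward_normal \<Omega> y) \<le> 2 * \<bar>M\<bar> * norm (x - y) powr \<alpha>"
    by simp
  have "\<bar>outward_normal \<Omega> x \<bullet> (x - y)\<bar> = \<bar>(y - x) \<bullet> ?N x\<bar> / norm (?N x)"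
    by (simp add: outward_normal_chart[OF assms(1,2)] inner_commute abs_mult divide_inverse_commute)
       (metis abs_minus_commute inner_diff_left)
  also have "\<dots> \<le> \<bar>(y - x) \<bullet> ?N x\<bar> / 1"
    using N by (intro divide_left_mono) auto
  also have "\<dots> \<le> \<bar>M\<bar> * norm (y - x) powr (1 + \<alpha>)"
    using normal_increment assms by simp
  also have "\<dots> \<le> 2 * \<bar>M\<bar> * norm (x - y) powr (1 + \<alpha>)"
    by (simp add: norm_minus_commute mult_right_mono)
  finally show "\<bar>outward_normal \<Omega> x \<bullet> (x - y)\<bar> \<le> 2 * \<bar>M\<bar> * norm (x - y) powr (1 + \<alpha>)" .
qed

end

text \<open>A point reflection of the surface at \<open>x\<close>, defined on a neighbourhood of size \<open>\<rho>\<close>, that differs from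
  \<open>y \<mapsto> 2 *\<^sub>R x - y\<close> by a map with Lipschitz constant \<open>\<epsilon>\<close>.\<close>
definition near_reflection :: "'a::euclidean_space set \<Rightarrow> 'a \<Rightarrow> real \<Rightarrow> real \<Rightarrow> 'a set \<Rightarrow> ('a \<Rightarrow> 'a) \<Rightarrow> bool" where
  "near_reflection F x \<rho> \<epsilon> U R \<longleftrightarrow>
     U \<in> sets borel \<and> F \<inter> ball x \<rho> \<subseteq> U \<and> U \<subseteq> F \<and> x \<in> U \<and> R x = x \<and>
     (\<forall>y\<in>U. R y \<in> U \<and> R (R y) = y) \<and>
     (\<forall>y\<in>U. \<forall>z\<in>U. norm ((R y - R z) + (y - z)) \<le> \<epsilon> * norm (y - z))"

context boundary_chart
begin

text \<open>The reflection \<open>2 *\<^sub>R P x - P y\<close> of the parameter domain is lifted to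
  the graph. In \<open>(R y - R z) + (y - z)\<close> the horizontal parts cancel exactly. The
  vertical parts are two increments of \<open>g\<close> in opposite directions; linearised at the
  same point \<open>P x\<close>, they cancel up to twice the error of
  \<open>g_increment\<close>.\<close>

lemma near_reflection_local:
  obtains \<eta> where "\<eta> > 0" "ball p \<eta> \<subseteq> Cyl"
    "\<And>x \<rho>. x \<in> frontier \<Omega> \<Longrightarrow> x \<in> ball p \<eta> \<Longrightarrow> 0 < \<rho> \<Longrightarrow> \<rho> \<le> \<eta> \<Longrightarrow>
        \<exists>U R. near_reflection (frontier \<Omega>) x \<rho> (2 * \<bar>M\<bar> * \<rho> powr \<alpha>) U R"
proof -
  have pC: "p \<in> Cyl" using r_pos \<delta>_pos by (simp add: Cyl_def)
  then have gp: "g (P p) = p \<bullet> e" using in_frontier_iff p by auto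
  obtain d where d: "d > 0" "\<And>w. w \<in> B \<Longrightarrow> dist w (P p) < d \<Longrightarrow> dist (g w) (g (P p)) < \<delta>"
    using continuous_on_g P_in_B[OF pC] \<delta>_pos unfolding continuous_on_iff by meson
  obtain d' where d': "d' > 0" "ball p d' \<subseteq> Cyl" using open_Cyl pC openE by blast
  \<comment> \<open>The factor one half leaves room for the reflected parameter, which lies within
    \<open>\<rho> + \<eta> \<le> 2 * \<eta>\<close> of \<open>P p\<close> and must still carry a
    point of the graph inside the cylinder.\<close>
  define \<eta> where "\<eta> = min (min d d') r / 2"
  have \<eta>: "\<eta> > 0" "2 * \<eta> \<le> d" "2 * \<eta> \<le> d'" "2 * \<eta> \<le> r"
    using d d' r_pos by (auto simp: \<eta>_def)
  have graph: "w \<in> B \<and> w + g w *\<^sub>R e \<in> Cyl \<and> w + g w *\<^sub>R e \<in> frontier \<Omega> \<and> P (w + g w *\<^sub>R e) = w"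
    if w: "w \<bullet> e = 0" "dist w (P p) < 2 * \<eta>" for w
  proof -
    have B: "w \<in> B" using w \<eta> by (simp add: B_def)
    have Pw: "P (w + g w *\<^sub>R e) = w" using w by (simp add: P_add P_scaleR P_id)
    have "\<bar>g w - p \<bullet> e\<bar> < \<delta>" using d(2)[OF B] w \<eta> gp by (simp add: dist_real_def)
    then have C: "w + g w *\<^sub>R e \<in> Cyl" using w \<eta> by (simp add: Cyl_def Pw inner_add_left)
    then show ?thesis using in_frontier_iff[OF C] B Pw w by (simp add: inner_add_left)
  qed
  show thesis
  proof (rule that[OF \<eta>(1)])
    show "ball p \<eta> \<subseteq> Cyl" using d'(2) subset_ball[of \<eta> d' p] \<eta> by auto
    fix x \<rho> assume x: "x \<in> frontier \<Omega>" "x \<in> ball p \<eta>" and \<rho>: "0 < \<rho>" "\<rho> \<le> \<eta>"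
    have xC: "x \<in> Cyl" using x d' \<eta> by (auto simp: subset_iff)
    have xe: "x = P x + g (P x) *\<^sub>R e" using P_decomp[of x] in_frontier_iff[OF xC] x by simp
    \<comment> \<open>Measuring the distance between projections makes \<open>U\<close> invariant
      under the reflection. It still contains the surface ball of radius \<rho>, because
      \<open>P\<close> does not increase distances.\<close>
    define U where "U = {y \<in> frontier \<Omega> \<inter> Cyl. dist (P y) (P x) < \<rho>}"
    define w where "w y = 2 *\<^sub>R P x - P y" for y
    define R where "R y = w y + g (w y) *\<^sub>R e" for y
    have Px: "dist (P x) (P p) < \<eta>"
      using dist_P_le[of x p] x by (simp add: dist_commute)
    have dw: "dist (w y) (P x) = dist (P y) (P x)" for y
      by (simp add: w_def dist_norm scaleR_2 norm_minus_commute)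
    have we: "w y \<bullet> e = 0" for y by (simp add: w_def inner_diff_left)
    have wp: "dist (w y) (P p) < 2 * \<eta>" if "y \<in> U" for y
      using that dw[of y] Px \<rho> dist_triangle[of "w y" "P p" "P x"] by (simp add: U_def)
    have Uy: "y = P y + g (P y) *\<^sub>R e" if "y \<in> U" for y
      using that P_decomp[of y] in_frontier_iff[of y] by (simp add: U_def)
    have PR: "P (R y) = w y" if "y \<in> U" for y
      using graph[OF we wp[OF that]] by (simp add: R_def)
    have RU: "R y \<in> U" if "y \<in> U" for y
      using graph[OF we wp[OF that]] PR[OF that] dw[of y] that by (simp add: U_def R_def)
    have "near_reflection (frontier \<Omega>) x \<rho> (2 * \<bar>M\<bar> * \<rho> powr \<alpha>) U R"
      unfolding near_reflection_def
    proof (intro conjI ballI)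
      have "open {y. dist (P y) (P x) < \<rho>}" by (intro open_Collect_less continuous_intros)
      moreover have "U = frontier \<Omega> \<inter> (Cyl \<inter> {y. dist (P y) (P x) < \<rho>})" by (auto simp: U_def)
      ultimately show "U \<in> sets borel" using open_Cyl by auto
      show "frontier \<Omega> \<inter> ball x \<rho> \<subseteq> U"
      proof
        fix y assume y: "y \<in> frontier \<Omega> \<inter> ball x \<rho>"
        have "dist p y < d'" using y x \<eta> \<rho> dist_triangle[of p y x] by simp
        then have "y \<in> Cyl" using d' by (auto simp: subset_iff)
        moreover have "dist (P y) (P x) < \<rho>" using dist_P_le[of y x] y by (simp add: dist_commute)
        ultimately show "y \<in> U" using y by (simp add: U_def)
      qed
      show "U \<subseteq> frontier \<Omega>" by (auto simp: U_def)
      show "x \<in> U" using x xC \<rho> by (simp add: U_def)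
      show "R x = x" using xe by (simp add: R_def w_def scaleR_2)
    next
      fix y assume y: "y \<in> U"
      show "R y \<in> U" using RU[OF y] .
      have "w (R y) = P y" by (simp add: w_def[of "R y"] PR[OF y]) (simp add: w_def)
      then show "R (R y) = y" using Uy[OF y] by (simp add: R_def[of "R y"])
    next
      fix y z assume y: "y \<in> U" and z: "z \<in> U"
      have B: "P x \<in> B" "P y \<in> B" "P z \<in> B" "w y \<in> B" "w z \<in> B"
        using y z xC graph[OF we wp] by (auto simp: U_def P_in_B)
      have 1: "\<bar>g (P y) - g (P z) - G (P x) \<bullet> (P y - P z)\<bar> \<le> \<bar>M\<bar> * \<rho> powr \<alpha> * norm (P y - P z)"
        using y z B by (intro g_increment) (auto simp: U_def)
      have 2: "\<bar>g (w y) - g (w z) - G (P x) \<bullet> (w y - w z)\<bar> \<le> \<bar>M\<bar> * \<rho> powr \<alpha> * norm (w y - w z)"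
        using y z B by (intro g_increment) (auto simp: U_def dw)
      have wd: "w y - w z = - (P y - P z)" by (simp add: w_def)
      have 3: "\<bar>g (w y) - g (w z) + G (P x) \<bullet> (P y - P z)\<bar> \<le> \<bar>M\<bar> * \<rho> powr \<alpha> * norm (P y - P z)"
        using 2 by (simp only: wd inner_minus_right norm_minus_cancel diff_minus_eq_add)
      have "(R y - R z) + (y - z) = ((g (P y) - g (P z)) + (g (w y) - g (w z))) *\<^sub>R e"
        by (subst Uy[OF y], subst (2) Uy[OF z]) (simp add: R_def w_def algebra_simps)
      then have "norm ((R y - R z) + (y - z)) = \<bar>(g (P y) - g (P z)) + (g (w y) - g (w z))\<bar>"
        by (simp add: norm_e)
      also have "\<dots> \<le> 2 * \<bar>M\<bar> * \<rho> powr \<alpha> * norm (P y - P z)"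
        using 1 3 by linarith
      also have "\<dots> \<le> 2 * \<bar>M\<bar> * \<rho> powr \<alpha> * norm (y - z)"
        using norm_P_le[of "y - z"] by (intro mult_left_mono) (auto simp: P_diff)
      finally show "norm ((R y - R z) + (y - z)) \<le> 2 * \<bar>M\<bar> * \<rho> powr \<alpha> * norm (y - z)" .
    qed
    then show "\<exists>U R. near_reflection (frontier \<Omega>) x \<rho> (2 * \<bar>M\<bar> * \<rho> powr \<alpha>) U R" by blast
  qed
qed

end

section \<open>Uniform constants on a compact boundary\<close>

lemma C1alpha_local:
  fixes \<Omega> :: "'a::euclidean_space set"
  assumes "0 < \<alpha>" "open \<Omega>" "C1alpha_domain \<alpha> \<Omega>" "p \<in> frontier \<Omega>"
  obtains \<eta> C where "\<eta> > 0" "C \<ge> 0"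
    "\<And>x. x \<in> frontier \<Omega> \<inter> ball p \<eta> \<Longrightarrow> norm (outward_normal \<Omega> x) = 1"
    "\<And>x y. x \<in> frontier \<Omega> \<inter> ball p \<eta> \<Longrightarrow> y \<in> frontier \<Omega> \<inter> ball p \<eta> \<Longrightarrow>
       norm (outward_normal \<Omega> x - outward_normal \<Omega> y) \<le> C * norm (x - y) powr \<alpha>"
    "\<And>x y. x \<in> frontier \<Omega> \<inter> ball p \<eta> \<Longrightarrow> y \<in> frontier \<Omega> \<inter> ball p \<eta> \<Longrightarrow>
       \<bar>outward_normal \<Omega> x \<bullet> (x - y)\<bar> \<le> C * norm (x - y) powr (1 + \<alpha>)"
    "\<And>x \<rho>. x \<in> frontier \<Omega> \<inter> ball p \<eta> \<Longrightarrow> 0 < \<rho> \<Longrightarrow> \<rho> \<le> \<eta> \<Longrightarrow>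
       \<exists>U R. near_reflection (frontier \<Omega>) x \<rho> (C * \<rho> powr \<alpha>) U R"
proof -
  obtain e r \<delta> M and g :: "'a \<Rightarrow> real" and G :: "'a \<Rightarrow> 'a" where
    e: "norm e = 1" "r > 0" "\<delta> > 0" and
    *: "let P = (\<lambda>x. x - (x \<bullet> e) *\<^sub>R e); B = {y. y \<bullet> e = 0 \<and> dist y (P p) < r} in
         (\<forall>y\<in>B. (g has_derivative (\<lambda>v. G y \<bullet> v)) (at y within {z. z \<bullet> e = 0}) \<and> G y \<bullet> e = 0) \<and>
         (\<forall>y\<in>B. \<forall>z\<in>B. norm (G y - G z) \<le> M * dist y z powr \<alpha>) \<and>
         \<Omega> \<inter> {x. dist (P x) (P p) < r \<and> \<bar>x \<bullet> e - p \<bullet> e\<bar> < \<delta>} =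
           {x. dist (P x) (P p) < r \<and> \<bar>x \<bullet> e - p \<bullet> e\<bar> < \<delta> \<and> x \<bullet> e < g (P x)}"
    using assms(3)[unfolded C1alpha_domain_def, rule_format, OF assms(4)] by (elim exE conjE)
  define P where "P = (\<lambda>x. x - (x \<bullet> e) *\<^sub>R e)"
  define B where "B = {y. y \<bullet> e = 0 \<and> dist y (P p) < r}"
  have h: "(\<forall>y\<in>B. (g has_derivative (\<lambda>v. G y \<bullet> v)) (at y within {z. z \<bullet> e = 0}) \<and> G y \<bullet> e = 0) \<and>
    (\<forall>y\<in>B. \<forall>z\<in>B. norm (G y - G z) \<le> M * dist y z powr \<alpha>) \<and>
    \<Omega> \<inter> {x. dist (P x) (P p) < r \<and> \<bar>x \<bullet> e - p \<bullet> e\<bar> < \<delta>} =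
       {x. dist (P x) (P p) < r \<and> \<bar>x \<bullet> e - p \<bullet> e\<bar> < \<delta> \<and> x \<bullet> e < g (P x)}"
    using * unfolding Let_def P_def B_def by assumption
  interpret boundary_chart \<Omega> p e \<alpha> r \<delta> M g G P B
    by unfold_locales (use h assms e in \<open>simp_all only: P_def B_def mem_Collect_eq\<close>)
  obtain \<eta> where \<eta>: "\<eta> > 0" "ball p \<eta> \<subseteq> Cyl"
    "\<And>x \<rho>. x \<in> frontier \<Omega> \<Longrightarrow> x \<in> ball p \<eta> \<Longrightarrow> 0 < \<rho> \<Longrightarrow> \<rho> \<le> \<eta> \<Longrightarrow>
        \<exists>U R. near_reflection (frontier \<Omega>) x \<rho> (2 * \<bar>M\<bar> * \<rho> powr \<alpha>) U R"
    using near_reflection_local by blast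
  show thesis
  proof (rule that[OF \<eta>(1), of "2 * \<bar>M\<bar>"])
    fix x y assume "x \<in> frontier \<Omega> \<inter> ball p \<eta>" "y \<in> frontier \<Omega> \<inter> ball p \<eta>"
    then have xy: "x \<in> Cyl" "x \<in> frontier \<Omega>" "y \<in> Cyl" "y \<in> frontier \<Omega>" using \<eta>(2) by auto
    show "norm (outward_normal \<Omega> x - outward_normal \<Omega> y) \<le> 2 * \<bar>M\<bar> * norm (x - y) powr \<alpha>"
      "\<bar>outward_normal \<Omega> x \<bullet> (x - y)\<bar> \<le> 2 * \<bar>M\<bar> * norm (x - y) powr (1 + \<alpha>)"
      using outward_normal_local[OF xy] by auto
  next
    fix x assume "x \<in> frontier \<Omega> \<inter> ball p \<eta>"
    then have x: "x \<in> Cyl" "x \<in> frontier \<Omega>" using \<eta>(2) by auto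
    show "norm (outward_normal \<Omega> x) = 1" using outward_normal_local(1)[OF x x] .
  qed (use \<eta>(3) in auto)
qed

lemma near_reflection_mono:
  assumes "near_reflection F x \<rho> \<epsilon> U R" "\<epsilon> \<le> \<epsilon>'"
  shows "near_reflection F x \<rho> \<epsilon>' U R"
proof -
  have "\<epsilon> * norm (y - z) \<le> \<epsilon>' * norm (y - z)" for y z using assms(2) by (rule mult_right_mono) simp
  then show ?thesis using assms(1) unfolding near_reflection_def by (meson order_trans)
qed

text \<open>A Lebesgue number argument: balls of half the local radius cover the boundary, so two
  points closer than \<open>\<rho>0\<close> share a chart. For points further apart, the estimates
  hold because normals are unit vectors, at the cost of the summand
  \<open>2 * \<rho>0 powr (- \<alpha>)\<close> in \<open>Q\<close>.\<close>

lemma C1alpha_global: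
  fixes \<Omega> :: "'a::euclidean_space set"
  assumes \<alpha>: "0 < \<alpha>" and \<Omega>: "bounded \<Omega>" "open \<Omega>" "C1alpha_domain \<alpha> \<Omega>"
  obtains \<rho>0 C where "\<rho>0 > 0" "C \<ge> 0"
    "\<And>x. x \<in> frontier \<Omega> \<Longrightarrow> norm (outward_normal \<Omega> x) = 1"
    "\<And>x y. x \<in> frontier \<Omega> \<Longrightarrow> y \<in> frontier \<Omega> \<Longrightarrow>
       norm (outward_normal \<Omega> x - outward_normal \<Omega> y) \<le> C * norm (x - y) powr \<alpha>"
    "\<And>x y. x \<in> frontier \<Omega> \<Longrightarrow> y \<in> frontier \<Omega> \<Longrightarrow>
       \<bar>outward_normal \<Omega> x \<bullet> (x - y)\<bar> \<le> C * norm (x - y) powr (1 + \<alpha>)"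
    "\<And>x \<rho>. x \<in> frontier \<Omega> \<Longrightarrow> 0 < \<rho> \<Longrightarrow> \<rho> \<le> \<rho>0 \<Longrightarrow>
       \<exists>U R. near_reflection (frontier \<Omega>) x \<rho> (C * \<rho> powr \<alpha>) U R"
proof -
  define F where "F = frontier \<Omega>"
  define \<nu> where "\<nu> = outward_normal \<Omega>"
  define good where "good p \<eta> C \<longleftrightarrow> \<eta> > 0 \<and> C \<ge> 0 \<and> (\<forall>x\<in>F \<inter> ball p \<eta>. norm (\<nu> x) = 1)
      \<and> (\<forall>x\<in>F \<inter> ball p \<eta>. \<forall>y\<in>F \<inter> ball p \<eta>. norm (\<nu> x - \<nu> y) \<le> C * norm (x - y) powr \<alpha>)
      \<and> (\<forall>x\<in>F \<inter> ball p \<eta>. \<forall>y\<in>F \<inter> ball p \<eta>. \<bar>\<nu> x \<bullet> (x - y)\<bar> \<le> C * norm (x - y) powr (1 + \<alpha>))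
      \<and> (\<forall>x\<in>F \<inter> ball p \<eta>. \<forall>\<rho>. 0 < \<rho> \<longrightarrow> \<rho> \<le> \<eta> \<longrightarrow> (\<exists>U R. near_reflection F x \<rho> (C * \<rho> powr \<alpha>) U R))" for p \<eta> C
  have "\<exists>\<eta> C. good p \<eta> C" if p: "p \<in> F" for p
  proof (rule C1alpha_local[OF \<alpha> \<Omega>(2,3) p[unfolded F_def]], fold F_def \<nu>_def, goal_cases)
    case (1 \<eta> C)
    then have "good p \<eta> C" unfolding good_def by blast
    then show ?case by blast
  qed
  then obtain \<eta> C where good: "\<And>p. p \<in> F \<Longrightarrow> good p (\<eta> p) (C p)" by metis
  have cF: "compact F" unfolding F_def using \<Omega>(1) by (rule compact_frontier_bounded)
  have cov: "F \<subseteq> (\<Union>p\<in>F. ball p (\<eta> p / 2))"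
  proof
    fix x assume "x \<in> F"
    then show "x \<in> (\<Union>p\<in>F. ball p (\<eta> p / 2))"
      using good[of x] by (intro UN_I[of x]) (auto simp: good_def)
  qed
  obtain D where D: "D \<subseteq> F" "finite D" "F \<subseteq> (\<Union>p\<in>D. ball p (\<eta> p / 2))"
    by (rule compactE_image[OF cF _ cov]) auto
  define \<rho>0 where "\<rho>0 = Min (insert 1 ((\<lambda>p. \<eta> p / 2) ` D))"
  define K where "K = Max (insert 1 (C ` D))"
  have \<rho>0: "\<rho>0 > 0" "\<And>p. p \<in> D \<Longrightarrow> \<rho>0 \<le> \<eta> p / 2"
  proof -
    have "\<eta> p > 0" if "p \<in> D" for p using good[of p] that D(1) by (auto simp: good_def)
    then show "\<rho>0 > 0" using D(2) unfolding \<rho>0_def by (subst Min_gr_iff) auto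
    show "\<rho>0 \<le> \<eta> p / 2" if "p \<in> D" for p
      unfolding \<rho>0_def using D(2) that by (intro Min_le) auto
  qed
  have K: "K \<ge> 1" "\<And>p. p \<in> D \<Longrightarrow> C p \<le> K" using D by (auto simp: K_def)
  define Q where "Q = K + 2 * \<rho>0 powr (- \<alpha>)"
  have Q: "K \<le> Q" "2 * \<rho>0 powr (- \<alpha>) \<le> Q" "Q \<ge> 0" using K by (auto simp: Q_def)
  have near: "\<exists>p\<in>D. x \<in> F \<inter> ball p (\<eta> p) \<and> F \<inter> ball x \<rho>0 \<subseteq> ball p (\<eta> p)" if x: "x \<in> F" for x
  proof -
    obtain p where p: "p \<in> D" "dist p x < \<eta> p / 2" using D x by auto
    have "ball x \<rho>0 \<subseteq> ball p (\<eta> p)"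
    proof
      fix y assume "y \<in> ball x \<rho>0"
      then show "y \<in> ball p (\<eta> p)" using \<rho>0(2)[OF p(1)] p(2) dist_triangle[of p y x] by simp
    qed
    moreover have "x \<in> ball x \<rho>0" using \<rho>0(1) by simp
    ultimately show ?thesis using p x by blast
  qed
  have gD: "good p (\<eta> p) (C p)" if "p \<in> D" for p using good D that by blast
  have n1: "norm (\<nu> x) = 1" if "x \<in> F" for x
    using near[OF that] gD unfolding good_def by blast
  have far: "1 \<le> \<rho>0 powr (- \<alpha>) * norm (x - y) powr \<alpha>" if "norm (x - y) \<ge> \<rho>0" for x y :: 'a
    using powr_mono2[OF _ _ that, of \<alpha>] \<alpha> \<rho>0 by (simp add: powr_minus field_simps)
  show thesis
  proof (rule that[OF \<rho>0(1) Q(3)]; fold F_def \<nu>_def)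
    fix x assume x: "x \<in> F"
    show "norm (\<nu> x) = 1" using n1[OF x] .
    fix y assume y: "y \<in> F"
    show "norm (\<nu> x - \<nu> y) \<le> Q * norm (x - y) powr \<alpha>"
    proof (cases "norm (x - y) < \<rho>0")
      case True
      then obtain p where p: "p \<in> D" "x \<in> F \<inter> ball p (\<eta> p)" "y \<in> F \<inter> ball p (\<eta> p)"
        using near[OF x] y by (auto simp: dist_norm)
      then have "norm (\<nu> x - \<nu> y) \<le> C p * norm (x - y) powr \<alpha>"
        using gD unfolding good_def by blast
      also have "\<dots> \<le> Q * norm (x - y) powr \<alpha>"
        using K(2)[OF p(1)] Q by (intro mult_right_mono) auto
      finally show ?thesis .
    next
      case False
      have "norm (\<nu> x - \<nu> y) \<le> 2 * 1"
        using norm_triangle_ineq4[of "\<nu> x" "\<nu> y"] n1 x y by simp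
      also have "\<dots> \<le> 2 * (\<rho>0 powr (- \<alpha>) * norm (x - y) powr \<alpha>)"
        using far[of x y] False by (intro mult_left_mono) auto
      also have "\<dots> \<le> Q * norm (x - y) powr \<alpha>"
        using Q(2) unfolding mult.assoc[symmetric] by (intro mult_right_mono) auto
      finally show ?thesis .
    qed
    show "\<bar>\<nu> x \<bullet> (x - y)\<bar> \<le> Q * norm (x - y) powr (1 + \<alpha>)"
    proof (cases "norm (x - y) < \<rho>0")
      case True
      then obtain p where p: "p \<in> D" "x \<in> F \<inter> ball p (\<eta> p)" "y \<in> F \<inter> ball p (\<eta> p)"
        using near[OF x] y by (auto simp: dist_norm)
      then have "\<bar>\<nu> x \<bullet> (x - y)\<bar> \<le> C p * norm (x - y) powr (1 + \<alpha>)"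
        using gD unfolding good_def by blast
      also have "\<dots> \<le> Q * norm (x - y) powr (1 + \<alpha>)"
        using K(2)[OF p(1)] Q by (intro mult_right_mono) auto
      finally show ?thesis .
    next
      case False
      have "\<bar>\<nu> x \<bullet> (x - y)\<bar> \<le> 1 * norm (x - y)"
        using Cauchy_Schwarz_ineq2[of "\<nu> x" "x - y"] n1[OF x] by simp
      also have "\<dots> \<le> (\<rho>0 powr (- \<alpha>) * norm (x - y) powr \<alpha>) * norm (x - y)"
        using far[of x y] False by (intro mult_right_mono) auto
      also have "\<dots> = \<rho>0 powr (- \<alpha>) * norm (x - y) powr (1 + \<alpha>)"
        by (cases "x = y") (simp_all add: powr_add)
      also have "\<dots> \<le> Q * norm (x - y) powr (1 + \<alpha>)"
      proof (rule mult_right_mono)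
        have "\<rho>0 powr (- \<alpha>) \<ge> 0" by simp
        then show "\<rho>0 powr (- \<alpha>) \<le> Q" using Q(2) by linarith
      qed simp
      finally show ?thesis .
    qed
  next
    fix x \<rho> assume x: "x \<in> F" and \<rho>: "0 < \<rho>" "\<rho> \<le> \<rho>0"
    obtain p where p: "p \<in> D" "x \<in> F \<inter> ball p (\<eta> p)" using near[OF x] by auto
    have "\<eta> p > 0" using gD[OF p(1)] by (simp add: good_def)
    then have "\<rho> \<le> \<eta> p" using \<rho>0(2)[OF p(1)] \<rho> by linarith
    then obtain U R where "near_reflection F x \<rho> (C p * \<rho> powr \<alpha>) U R"
      using gD[OF p(1)] p(2) \<rho> unfolding good_def by meson
    moreover have "C p * \<rho> powr \<alpha> \<le> Q * \<rho> powr \<alpha>"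
      using K(2)[OF p(1)] Q by (intro mult_right_mono) auto
    ultimately show "\<exists>U R. near_reflection F x \<rho> (Q * \<rho> powr \<alpha>) U R"
      using near_reflection_mono by blast
  qed
qed

text \<open>Upper Ahlfors regularity: near \<open>x\<close> the surface is almost orthogonal to \<open>\<nu> x\<close>, so the coordinates other
  than one in which \<open>\<nu> x\<close> is large control distances.\<close>
lemma surface_measure_ball_le:
  fixes \<Omega> :: "'a::euclidean_space set" and \<nu> :: "'a \<Rightarrow> 'a"
  assumes n: "DIM('a) \<ge> 2" and \<alpha>: "0 < \<alpha>" and \<Omega>: "bounded \<Omega>" and C: "C \<ge> 0"
    and n1: "\<And>x. x \<in> frontier \<Omega> \<Longrightarrow> norm (\<nu> x) = 1"
    and nh: "\<And>x y. x \<in> frontier \<Omega> \<Longrightarrow> y \<in> frontier \<Omega> \<Longrightarrow> norm (\<nu> x - \<nu> y) \<le> C * norm (x - y) powr \<alpha>"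
    and nt: "\<And>x y. x \<in> frontier \<Omega> \<Longrightarrow> y \<in> frontier \<Omega> \<Longrightarrow> \<bar>\<nu> x \<bullet> (x - y)\<bar> \<le> C * norm (x - y) powr (1 + \<alpha>)"
  obtains A where "A \<ge> 0" "\<And>x \<rho>. x \<in> frontier \<Omega> \<Longrightarrow> \<rho> > 0 \<Longrightarrow>
     emeasure (surface_measure \<Omega>) (frontier \<Omega> \<inter> cball x \<rho>) \<le> ennreal (A * \<rho> powr (real DIM('a) - 1))"
proof -
  define F where "F = frontier \<Omega>"
  define s where "s = real DIM('a) - 1"
  define d where "d = real DIM('a)"
  have d: "d \<ge> 2" and s: "s > 0" using n by (auto simp: d_def s_def)
  \<comment> \<open>With this slope and a coordinate of the normal of size at least
    \<open>1 / d\<close>, the coordinate \<open>\<bar>v \<bullet> b\<bar>\<close> is at most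
    \<open>norm v / 2 + d * S\<close>, and the half of \<open>norm v\<close> can be absorbed. The
    radius \<open>\<rho>1\<close> is where the Hoelder bounds fall below this slope.\<close>
  define \<epsilon> where "\<epsilon> = 1 / (2 * d)"
  have \<epsilon>: "\<epsilon> > 0" using d by (simp add: \<epsilon>_def)
  define \<rho>1 where "\<rho>1 = (\<epsilon> / (4 * (C + 1))) powr (1 / \<alpha>)"
  have \<rho>1: "\<rho>1 > 0" using \<epsilon> C by (simp add: \<rho>1_def)
  have \<rho>1\<alpha>: "C * (2 * (t powr \<alpha>)) \<le> \<epsilon> / 2" if "0 \<le> t" "t \<le> \<rho>1" for t
  proof -
    have "t powr \<alpha> \<le> \<rho>1 powr \<alpha>" using that \<alpha> by (intro powr_mono2) auto
    also have "\<dots> = \<epsilon> / (4 * (C + 1))" using \<alpha> \<epsilon> C by (simp add: \<rho>1_def powr_powr)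
    finally have "C * (2 * (t powr \<alpha>)) \<le> C * (2 * (\<epsilon> / (4 * (C + 1))))" using C by (intro mult_left_mono) auto
    also have "\<dots> \<le> \<epsilon> / 2" using C \<epsilon> by (simp add: field_simps)
    finally show ?thesis .
  qed
  have flat: "\<bar>\<nu> x \<bullet> (y - z)\<bar> \<le> \<epsilon> * norm (y - z)"
    if x: "x \<in> F" "y \<in> F" "z \<in> F" and yx: "norm (x - y) \<le> \<rho>1 / 2" "norm (x - z) \<le> \<rho>1 / 2" for x y z
  proof -
    have yz: "norm (y - z) \<le> \<rho>1" using norm_triangle_ineq4[of "x - z" "x - y"] yx by simp
    have "\<nu> x \<bullet> (y - z) = (\<nu> x - \<nu> y) \<bullet> (y - z) + \<nu> y \<bullet> (y - z)" by (simp add: inner_diff_left)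
    also have "\<bar>\<dots>\<bar> \<le> norm (\<nu> x - \<nu> y) * norm (y - z) + C * norm (y - z) powr (1 + \<alpha>)"
      using Cauchy_Schwarz_ineq2[of "\<nu> x - \<nu> y" "y - z"] nt[of y z] x by (simp add: F_def)
    also have "\<dots> = (norm (\<nu> x - \<nu> y) + C * norm (y - z) powr \<alpha>) * norm (y - z)"
      by (cases "y = z") (simp_all add: powr_add algebra_simps)
    also have "\<dots> \<le> (\<epsilon> / 2 + \<epsilon> / 2) * norm (y - z)"
    proof (intro mult_right_mono add_mono)
      have nn: "0 \<le> C * t powr \<alpha>" for t using C by simp
      have "norm (\<nu> x - \<nu> y) \<le> C * norm (x - y) powr \<alpha>" using nh x by (simp add: F_def)
      also have "\<dots> \<le> \<epsilon> / 2" using \<rho>1\<alpha>[of "norm (x - y)"] nn[of "norm (x - y)"] yx \<rho>1 by simp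
      finally show "norm (\<nu> x - \<nu> y) \<le> \<epsilon> / 2" .
      show "C * norm (y - z) powr \<alpha> \<le> \<epsilon> / 2" using \<rho>1\<alpha>[of "norm (y - z)"] nn[of "norm (y - z)"] yz by simp
    qed simp
    finally show ?thesis by simp
  qed
  define K where "K = 1 + 2 * (1 + d)"
  define A0 where "A0 = hausdorff_const s * (3 * K * d) powr s"
  have c0: "hausdorff_const s \<ge> 0"
    unfolding hausdorff_const_def using s by (intro divide_nonneg_nonneg mult_nonneg_nonneg less_imp_le[OF Gamma_real_pos]) auto
  then have A0: "A0 \<ge> 0" by (simp add: A0_def)
  have F_borel: "F \<inter> cball x \<rho> \<in> sets borel" for x \<rho> by (auto simp: F_def)
  have small: "emeasure (surface_measure \<Omega>) (F \<inter> cball x \<rho>) \<le> ennreal (A0 * \<rho> powr s)"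
    if x: "x \<in> F" and \<rho>: "\<rho> > 0" "\<rho> \<le> \<rho>1 / 2" for x \<rho>
  proof -
    \<comment> \<open>The absolute coordinates of a unit vector sum to at least 1, so one of the
      \<open>d\<close> coordinates reaches the average.\<close>
    have "\<exists>b\<in>Basis. \<bar>\<nu> x \<bullet> b\<bar> \<ge> 1 / d"
    proof (rule ccontr)
      assume "\<not> ?thesis"
      then have "(\<Sum>b\<in>Basis. \<bar>\<nu> x \<bullet> b\<bar>) < (\<Sum>b\<in>(Basis::'a set). 1 / d)"
        by (intro sum_strict_mono) auto
      also have "\<dots> = 1" using d by (simp add: d_def)
      finally show False using norm_le_l1[of "\<nu> x"] n1 x by (simp add: F_def)
    qed
    then obtain b where b: "b \<in> Basis" "\<bar>\<nu> x \<bullet> b\<bar> \<ge> 1 / d" by blast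
    have "norm (y - z) \<le> K * (\<Sum>i\<in>Basis - {b}. \<bar>(y - z) \<bullet> i\<bar>)"
      if y: "y \<in> F \<inter> cball x \<rho>" and z: "z \<in> F \<inter> cball x \<rho>" for y z
    proof -
      define v where "v = y - z"
      define S where "S = (\<Sum>i\<in>Basis - {b}. \<bar>v \<bullet> i\<bar>)"
      have S0: "S \<ge> 0" by (simp add: S_def sum_nonneg)
      have vS: "norm v \<le> \<bar>v \<bullet> b\<bar> + S"
        using norm_le_l1[of v] b by (simp add: S_def sum.remove[of Basis b])
      have fl: "\<bar>\<nu> x \<bullet> v\<bar> \<le> \<epsilon> * norm v"
        unfolding v_def using x y z \<rho> by (intro flat) (auto simp: dist_norm)
      have "\<nu> x \<bullet> v = (\<Sum>i\<in>Basis. (\<nu> x \<bullet> i) * (v \<bullet> i))" by (rule euclidean_inner)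
      also have "\<dots> = (\<nu> x \<bullet> b) * (v \<bullet> b) + (\<Sum>i\<in>Basis - {b}. (\<nu> x \<bullet> i) * (v \<bullet> i))"
        using b by (simp add: sum.remove[of Basis b])
      finally have eq: "(\<nu> x \<bullet> b) * (v \<bullet> b) = \<nu> x \<bullet> v - (\<Sum>i\<in>Basis - {b}. (\<nu> x \<bullet> i) * (v \<bullet> i))" by simp
      have "\<bar>\<Sum>i\<in>Basis - {b}. (\<nu> x \<bullet> i) * (v \<bullet> i)\<bar> \<le> S"
        unfolding S_def
      proof (rule order_trans[OF sum_abs], rule sum_mono)
        fix i assume i: "i \<in> Basis - {b}"
        have "\<bar>\<nu> x \<bullet> i\<bar> \<le> 1" using Basis_le_norm[of i "\<nu> x"] i n1 x by (simp add: F_def)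
        then show "\<bar>(\<nu> x \<bullet> i) * (v \<bullet> i)\<bar> \<le> \<bar>v \<bullet> i\<bar>"
          by (simp add: abs_mult mult_left_le_one_le)
      qed
      then have 1: "\<bar>\<nu> x \<bullet> b\<bar> * \<bar>v \<bullet> b\<bar> \<le> \<epsilon> * norm v + S"
        using fl eq by (simp flip: abs_mult)
      have "1 / d * \<bar>v \<bullet> b\<bar> \<le> \<bar>\<nu> x \<bullet> b\<bar> * \<bar>v \<bullet> b\<bar>" using b(2) by (rule mult_right_mono) simp
      then have "1 / d * \<bar>v \<bullet> b\<bar> \<le> \<epsilon> * norm v + S" using 1 by linarith
      then have "d * (1 / d * \<bar>v \<bullet> b\<bar>) \<le> d * (\<epsilon> * norm v + S)" using d by (intro mult_left_mono) auto
      then have "\<bar>v \<bullet> b\<bar> \<le> norm v / 2 + d * S" using d by (simp add: \<epsilon>_def algebra_simps)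
      then have "norm v \<le> 2 * (1 + d) * S" using vS by (simp add: algebra_simps)
      also have "\<dots> \<le> K * S" using S0 by (intro mult_right_mono) (auto simp: K_def)
      finally show ?thesis by (simp add: S_def v_def)
    qed
    then have "hausdorff_outer s (F \<inter> cball x \<rho>) \<le> ennreal (A0 * \<rho> powr s)"
      unfolding s_def A0_def d_def using n b \<rho> d
      by (intro hausdorff_outer_le_of_coordinates[where b = b and x = x]) (auto simp: K_def d_def)
    then show ?thesis
      using emeasure_surface_measure_le[of "F \<inter> cball x \<rho>" \<Omega>] F_borel[of x \<rho>]
      by (simp add: F_def s_def)
  qed
  have cF: "compact F" unfolding F_def using \<Omega> by (rule compact_frontier_bounded)
  have cov: "F \<subseteq> (\<Union>x\<in>F. ball x (\<rho>1 / 2))" using \<rho>1 by (auto intro!: UN_I)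
  obtain D where D: "D \<subseteq> F" "finite D" "F \<subseteq> (\<Union>x\<in>D. ball x (\<rho>1 / 2))"
    by (rule compactE_image[OF cF _ cov]) auto
  define T where "T = real (card D) * (A0 * (\<rho>1 / 2) powr s)"
  have total: "emeasure (surface_measure \<Omega>) F \<le> ennreal T"
  proof -
    have "F = (\<Union>x\<in>D. F \<inter> cball x (\<rho>1 / 2))"
    proof (intro equalityI subsetI)
      fix y assume "y \<in> F"
      then obtain x where "x \<in> D" "y \<in> ball x (\<rho>1 / 2)" using D(3) by blast
      then show "y \<in> (\<Union>x\<in>D. F \<inter> cball x (\<rho>1 / 2))" using \<open>y \<in> F\<close> by (intro UN_I[of x]) auto
    qed auto
    then have "emeasure (surface_measure \<Omega>) F = emeasure (surface_measure \<Omega>) (\<Union>x\<in>D. F \<inter> cball x (\<rho>1 / 2))"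
      by simp
    also have "\<dots> \<le> (\<Sum>x\<in>D. emeasure (surface_measure \<Omega>) (F \<inter> cball x (\<rho>1 / 2)))"
      using D(2) F_borel by (intro emeasure_subadditive_finite) (auto simp: in_sets_surface_measure F_def)
    also have "\<dots> \<le> (\<Sum>x\<in>D. ennreal (A0 * (\<rho>1 / 2) powr s))"
      using D \<rho>1 by (intro sum_mono small) auto
    also have "\<dots> = ennreal T"
      using A0 by (simp add: T_def ennreal_mult' ennreal_of_nat_eq_real_of_nat)
    finally show ?thesis .
  qed
  have T0: "T \<ge> 0" using A0 by (simp add: T_def)
  \<comment> \<open>The second summand serves radii above \<open>\<rho>1 / 2\<close>, where the
    total mass \<open>T\<close> is compared with the smallest such radius.\<close>
  define A where "A = A0 + T / (\<rho>1 / 2) powr s"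
  have A: "A0 \<le> A" "A \<ge> 0" "T / (\<rho>1 / 2) powr s \<le> A" using A0 T0 by (auto simp: A_def)
  show thesis
  proof (rule that[OF A(2)]; fold F_def s_def)
    fix x \<rho> assume x: "x \<in> F" and \<rho>: "(\<rho>::real) > 0"
    show "emeasure (surface_measure \<Omega>) (F \<inter> cball x \<rho>) \<le> ennreal (A * \<rho> powr s)"
    proof (cases "\<rho> \<le> \<rho>1 / 2")
      case True
      have "ennreal (A0 * \<rho> powr s) \<le> ennreal (A * \<rho> powr s)"
        using A by (intro ennreal_leI mult_right_mono) auto
      then show ?thesis using small[OF x \<rho> True] by (rule order_trans[rotated])
    next
      case False
      have "emeasure (surface_measure \<Omega>) (F \<inter> cball x \<rho>) \<le> emeasure (surface_measure \<Omega>) F"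
        by (intro emeasure_mono) (auto simp: in_sets_surface_measure F_def)
      also have "\<dots> \<le> ennreal T" by (rule total)
      also have "\<dots> \<le> ennreal (A * \<rho> powr s)"
      proof (rule ennreal_leI)
        have "T = T / (\<rho>1 / 2) powr s * (\<rho>1 / 2) powr s" using \<rho>1 by simp
        also have "\<dots> \<le> A * \<rho> powr s"
          using A False \<rho>1 s by (intro mult_mono powr_mono2) auto
        finally show "T \<le> A * \<rho> powr s" .
      qed
      finally show ?thesis .
    qed
  qed
qed

section \<open>Gaussian estimates and reflections\<close>

text \<open>A power of the distance is traded for the same power of \<open>sqrt u\<close> at the
  price of half the Gaussian exponent. After rescaling by \<open>sqrt u\<close>,
  \<open>z powr p \<le> exp (p * z)\<close> reduces the claim to completing a square, which produces
  the constant \<open>exp (p\<^sup>2 / (2 * c))\<close>.\<close>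

lemma powr_mult_exp_le:
  fixes d u :: real
  assumes "p \<ge> 0" "c > 0" "u > 0" "d \<ge> 0"
  shows "d powr p * exp (- c * d\<^sup>2 / u) \<le> exp (p\<^sup>2 / (2 * c)) * u powr (p / 2) * exp (- (c / 2) * d\<^sup>2 / u)"
proof (cases "d = 0")
  case False
  define z where "z = d / sqrt u"
  have z: "z > 0" using assms False by (simp add: z_def)
  have z2: "z\<^sup>2 = d\<^sup>2 / u" using assms by (simp add: z_def power_divide)
  have "d = z * sqrt u" using assms by (simp add: z_def)
  then have dz: "d powr p = u powr (p / 2) * z powr p"
    using z assms by (simp add: powr_mult powr_half_sqrt[symmetric] powr_powr)
  have le: "z powr p * exp (- c * z\<^sup>2) \<le> exp (p\<^sup>2 / (2 * c)) * exp (- (c / 2) * z\<^sup>2)"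
  proof -
    have "ln z \<le> z" using ln_le_minus_one[OF z] by linarith
    then have "z powr p \<le> exp (p * z)" using z assms by (simp add: powr_def mult_left_mono)
    then have "z powr p * exp (- c * z\<^sup>2) \<le> exp (p * z) * exp (- c * z\<^sup>2)" by (rule mult_right_mono) simp
    also have "\<dots> = exp (p * z - c * z\<^sup>2)" by (simp add: exp_add[symmetric])
    also have "\<dots> \<le> exp (p\<^sup>2 / (2 * c) - (c / 2) * z\<^sup>2)"
    proof -
      have "0 \<le> (c / 2) * (z - p / c)\<^sup>2" using assms by simp
      also have "\<dots> = p\<^sup>2 / (2 * c) - (c / 2) * z\<^sup>2 - (p * z - c * z\<^sup>2)"
        using assms by (simp add: power2_eq_square field_simps)
      finally show ?thesis by simp
    qed
    also have "\<dots> = exp (p\<^sup>2 / (2 * c)) * exp (- (c / 2) * z\<^sup>2)" by (simp add: exp_add[symmetric])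
    finally show ?thesis .
  qed
  show ?thesis
    using mult_left_mono[OF le, of "u powr (p / 2)"] by (simp add: dz z2 mult_ac)
qed (use assms in simp)

text \<open>A mean value estimate whose common lower bound \<open>c\<close> keeps one fixed Gaussian
  as a factor when kernels at different times or points are compared.\<close>

lemma abs_exp_minus_diff_le:
  fixes a b c :: real
  assumes "c \<le> a" "c \<le> b"
  shows "\<bar>exp (- a) - exp (- b)\<bar> \<le> \<bar>a - b\<bar> * exp (- c)"
proof -
  have *: "exp (- a) - exp (- b) \<le> (b - a) * exp (- c)" if "a \<le> b" "c \<le> a" for a b :: real
  proof -
    have "1 - exp (- (b - a)) \<le> b - a" using exp_ge_add_one_self[of "- (b - a)"] by linarith
    then have "exp (- a) * (1 - exp (- (b - a))) \<le> exp (- a) * (b - a)" by (intro mult_left_mono) auto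
    also have "\<dots> \<le> exp (- c) * (b - a)" using that by (intro mult_right_mono) auto
    finally show ?thesis by (simp add: right_diff_distrib mult.commute flip: exp_add)
  qed
  show ?thesis
  proof (cases "a \<le> b")
    case True
    then show ?thesis using *[of a b] assms by simp
  next
    case False
    then show ?thesis using *[of b a] assms by simp
  qed
qed

text \<open>The time kernels below are bounded by \<open>v powr (a - 1)\<close> up to scale \<open>h\<close> and decay like
  \<open>v powr (- b - 1)\<close> beyond it, so that their integrals have the order \<open>h powr a\<close>.\<close>
definition power_tail :: "real \<Rightarrow> real \<Rightarrow> real \<Rightarrow> real \<Rightarrow> real" where
  "power_tail h a b v = (if v \<le> 0 then 0 else if v \<le> h then v powr (a - 1) else h powr (a + b) * v powr (- b - 1))"

lemma power_tail_nonneg: "0 \<le> power_tail h a b v"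
  by (simp add: power_tail_def)

lemma integrable_power_tail:
  assumes "h > 0" "a > 0" "b > 0"
  shows "integrable lborel (\<lambda>\<tau>. power_tail h a b (t - \<tau>))"
    and "integral\<^sup>L lborel (\<lambda>\<tau>. power_tail h a b (t - \<tau>)) = h powr a * (1 / a + 1 / b)"
proof -
  define D where "D = power_tail h a b"
  have D_nn: "0 \<le> D v" for v by (simp add: D_def power_tail_nonneg)
  have D_meas: "D \<in> borel_measurable borel" unfolding D_def power_tail_def[abs_def] by measurable
  have 1: "((\<lambda>v. if v \<in> {0..h} then v powr (a - 1) else 0) has_integral (h powr a / a)) UNIV"
    unfolding has_integral_restrict_UNIV using has_integral_powr_from_0[of "a - 1" h] assms by simp
  have 2: "((\<lambda>v. if v \<in> {h..} then v powr (- b - 1) else 0) has_integral (h powr (- b) / b)) UNIV"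
    unfolding has_integral_restrict_UNIV using has_integral_powr_to_inf[of "- b - 1" h] assms by simp
  have "((\<lambda>v. (if v \<in> {0..h} then v powr (a - 1) else 0) + h powr (a + b) * (if v \<in> {h..} then v powr (- b - 1) else 0))
      has_integral (h powr a / a + h powr (a + b) * (h powr (- b) / b))) UNIV"
    by (intro has_integral_add has_integral_mult_right 1 2)
  moreover have "h powr a / a + h powr (a + b) * (h powr (- b) / b) = h powr a * (1 / a + 1 / b)"
    by (simp add: ring_distribs flip: powr_add)
  ultimately have "((\<lambda>v. (if v \<in> {0..h} then v powr (a - 1) else 0) + h powr (a + b) * (if v \<in> {h..} then v powr (- b - 1) else 0))
      has_integral (h powr a * (1 / a + 1 / b))) UNIV" by simp
  \<comment> \<open>At \<open>v = h\<close> both summands are active, so the sum agrees with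
    \<open>D\<close> only off a finite set.\<close>
  then have "(D has_integral (h powr a * (1 / a + 1 / b))) UNIV"
    by (rule has_integral_spike_finite[where S = "{0, h}", rotated 2]) (use assms in \<open>auto simp: D_def power_tail_def\<close>)
  from nn_integral_has_integral_lborel[OF D_meas D_nn this]
  have nn: "(\<integral>\<^sup>+ v. ennreal (D v) \<partial>lborel) = ennreal (h powr a * (1 / a + 1 / b))" .
  then have i: "integrable lborel D"
    using D_nn D_meas by (intro integrableI_nonneg) auto
  have I: "integral\<^sup>L lborel D = h powr a * (1 / a + 1 / b)"
    using nn D_nn D_meas assms by (subst integral_eq_nn_integral) auto
  show "integrable lborel (\<lambda>\<tau>. power_tail h a b (t - \<tau>))"
    using lborel_integrable_real_affine[OF i, of "-1" t] by (simp add: D_def)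
  show "integral\<^sup>L lborel (\<lambda>\<tau>. power_tail h a b (t - \<tau>)) = h powr a * (1 / a + 1 / b)"
    using lborel_integral_real_affine[of "-1" D t] I by (simp add: D_def)
qed

section \<open>Cancellation under an almost isometric involution\<close>

lemma nn_integral_le_scale:
  assumes "sets N = sets M" "\<And>A. A \<in> sets M \<Longrightarrow> emeasure N A \<le> c * emeasure M A"
    and "f \<in> borel_measurable M"
  shows "nn_integral N f \<le> c * nn_integral M f"
proof -
  have "nn_integral N f \<le> nn_integral (scale_measure c M) f"
    using assms by (intro nn_integral_mono_measure) (auto simp: le_measure)
  then show ?thesis using assms(3) by (simp add: nn_integral_scale_measure)
qed

text \<open>The Lipschitz quasi-invariance of the measure under the reflection stands in for the area formula:
  an almost odd function has a small integral.\<close>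
lemma near_reflection_integral:
  fixes R :: "'a::euclidean_space \<Rightarrow> 'a" and f E :: "'a \<Rightarrow> real"
  assumes rfl: "near_reflection F x \<rho> \<epsilon> U R" and \<epsilon>: "\<epsilon> \<ge> 0"
    and sets: "\<And>A. A \<in> sets \<sigma> \<longleftrightarrow> A \<in> sets borel \<and> A \<subseteq> F"
    and quasi: "\<And>A L. A \<in> sets \<sigma> \<Longrightarrow> R ` A \<in> sets \<sigma> \<Longrightarrow> L > 0 \<Longrightarrow>
        (\<And>y z. y \<in> A \<Longrightarrow> z \<in> A \<Longrightarrow> norm (R y - R z) \<le> L * norm (y - z)) \<Longrightarrow>
        emeasure \<sigma> (R ` A) \<le> ennreal (L powr s) * emeasure \<sigma> A"
    and f: "integrable \<sigma> f" and E: "integrable \<sigma> E"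
    and fE: "\<And>y. y \<in> U \<Longrightarrow> \<bar>f y + f (R y)\<bar> \<le> E y" and s: "s \<ge> 0"
  shows "\<bar>\<integral>y. f y * indicator U y \<partial>\<sigma>\<bar> \<le> ((1 + \<epsilon>) powr s - 1) * (\<integral>y. \<bar>f y\<bar> * indicator U y \<partial>\<sigma>)
            + (\<integral>y. E y * indicator U y \<partial>\<sigma>)"
proof -
  define L where "L = 1 + \<epsilon>"
  have L: "L > 0" "L \<ge> 1" using \<epsilon> by (auto simp: L_def)
  define k where "k = L powr s"
  have k: "k \<ge> 1" using L s by (simp add: k_def ge_one_powr_ge_zero)
  have U: "U \<in> sets borel" "U \<subseteq> F" and RU: "\<And>y. y \<in> U \<Longrightarrow> R y \<in> U" "\<And>y. y \<in> U \<Longrightarrow> R (R y) = y"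
    and RL: "\<And>y z. y \<in> U \<Longrightarrow> z \<in> U \<Longrightarrow> norm ((R y - R z) + (y - z)) \<le> \<epsilon> * norm (y - z)"
    using rfl unfolding near_reflection_def by auto
  have U\<sigma>: "U \<in> sets \<sigma>" using U by (simp add: sets)
  have Rlip: "norm (R y - R z) \<le> L * norm (y - z)" if "y \<in> U" "z \<in> U" for y z
  proof -
    have "norm (R y - R z) \<le> norm ((R y - R z) + (y - z)) + norm (y - z)"
      by (metis add_diff_cancel_right' norm_triangle_ineq4)
    then show ?thesis using RL[OF that] by (simp add: L_def algebra_simps)
  qed
  have Rcont: "continuous_on U R"
    by (rule lipschitz_on_continuous_on[of L]) (use Rlip L in \<open>auto simp: lipschitz_on_def dist_norm\<close>)
  define N where "N = restrict_space \<sigma> U"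
  have spF: "U \<inter> space \<sigma> = U" using U\<sigma> sets.sets_into_space by auto
  have spN: "space N = U" by (simp add: N_def space_restrict_space spF)
  have setsN: "A \<in> sets N \<longleftrightarrow> A \<in> sets borel \<and> A \<subseteq> U" for A
    unfolding N_def using sets_restrict_space_iff[of U \<sigma> A] U\<sigma> spF U(2) by (auto simp: sets)
  have setsN': "sets N = sets (restrict_space borel U)"
    using setsN U(1) by (auto simp: sets_restrict_space_iff)
  have R_meas: "R \<in> measurable N N"
  proof -
    have "R \<in> borel_measurable (restrict_space borel U)"
      by (rule borel_measurable_continuous_on_restrict[OF Rcont])
    then have "R \<in> measurable N borel" using measurable_cong_sets[OF setsN' refl] by blast
    then have "R \<in> measurable N (restrict_space borel U)"
      using RU spN by (intro measurable_restrict_space2) auto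
    then show ?thesis using measurable_cong_sets[OF refl setsN'] by blast
  qed
  \<comment> \<open>As \<open>R\<close> is an involution of \<open>U\<close>, the preimage of
    \<open>A\<close> is its image, and images are what the quasi-invariance controls.\<close>
  have em: "emeasure (distr N N R) A \<le> ennreal k * emeasure N A" if A: "A \<in> sets N" for A
  proof -
    have AU: "A \<in> sets borel" "A \<subseteq> U" using A setsN by auto
    have img: "R -` A \<inter> space N = R ` A"
      using AU RU unfolding spN by (auto simp: image_iff) (metis RU(2) subsetD)
    have imgN: "R ` A \<in> sets N" using measurable_sets[OF R_meas A] img by simp
    have "emeasure (distr N N R) A = emeasure N (R ` A)"
      using A R_meas img by (simp add: emeasure_distr)
    also have "\<dots> = emeasure \<sigma> (R ` A)"
      using imgN U\<sigma> spF setsN unfolding N_def by (intro emeasure_restrict_space) auto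
    also have "\<dots> \<le> ennreal k * emeasure \<sigma> A"
      unfolding k_def
    proof (rule quasi[OF _ _ L(1)])
      show "A \<in> sets \<sigma>" "R ` A \<in> sets \<sigma>" using AU U imgN by (auto simp: sets setsN)
      show "norm (R y - R z) \<le> L * norm (y - z)" if "y \<in> A" "z \<in> A" for y z
        by (rule Rlip) (use that AU in blast)+
    qed
    also have "emeasure \<sigma> A = emeasure N A"
      using AU U\<sigma> spF unfolding N_def by (intro emeasure_restrict_space[symmetric]) auto
    finally show ?thesis .
  qed
  have intN: "integrable N g" if "integrable \<sigma> g" for g :: "'a \<Rightarrow> real"
    unfolding N_def using integrable_mult_indicator[OF U\<sigma> that] U\<sigma> spF
    by (subst integrable_restrict_space) simp_all
  have LN: "(\<integral>y. g y \<partial>N) = (\<integral>y. g y * indicator U y \<partial>\<sigma>)" for g :: "'a \<Rightarrow> real"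
    unfolding N_def using U\<sigma> spF by (subst integral_restrict_space) (auto simp: mult.commute)
  have EN: "E y \<ge> 0" if "y \<in> U" for y using fE[OF that] by linarith
  have E0: "0 \<le> (\<integral>y. E y \<partial>N)" by (rule integral_nonneg_AE) (use EN spN in auto)
  \<comment> \<open>Near oddness bounds the positive part of \<open>g\<close> at \<open>y\<close> by
    the negative part at \<open>R y\<close> plus \<open>E y\<close>, and the pushforward bound
    removes \<open>R\<close> at the cost of the factor \<open>k\<close>. Applied to \<open>f\<close>
    and to \<open>- f\<close>, this compares the masses \<open>p\<close> and \<open>q\<close> of the
    two parts in both directions, so that \<open>\<bar>p - q\<bar>\<close> carries the small factor
    \<open>k - 1\<close>.\<close>
  have key: "(\<integral>y. max 0 (g y) \<partial>N) \<le> k * (\<integral>y. max 0 (- g y) \<partial>N) + (\<integral>y. E y \<partial>N)"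
    if g: "integrable N g" and gE: "\<And>y. y \<in> U \<Longrightarrow> \<bar>g y + g (R y)\<bar> \<le> E y" for g
  proof -
    have ip: "integrable N (\<lambda>y. max 0 (g y))" "integrable N (\<lambda>y. max 0 (- g y))"
      using g by auto
    have gm: "g \<in> borel_measurable N" using g by auto
    have "(\<integral>\<^sup>+y. ennreal (max 0 (g y)) \<partial>N) \<le> (\<integral>\<^sup>+y. ennreal (max 0 (- g (R y))) + ennreal (E y) \<partial>N)"
    proof (rule nn_integral_mono)
      fix y assume "y \<in> space N"
      then have y: "y \<in> U" by (simp add: spN)
      have "max 0 (g y) \<le> max 0 (- g (R y)) + E y" using gE[OF y] EN[OF y] by linarith
      then show "ennreal (max 0 (g y)) \<le> ennreal (max 0 (- g (R y))) + ennreal (E y)"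
        using EN[OF y] by (simp add: ennreal_leI flip: ennreal_plus)
    qed
    also have "\<dots> = (\<integral>\<^sup>+y. ennreal (max 0 (- g (R y))) \<partial>N) + (\<integral>\<^sup>+y. ennreal (E y) \<partial>N)"
    proof (rule nn_integral_add)
      have "(\<lambda>y. g (R y)) \<in> borel_measurable N" using measurable_compose[OF R_meas gm] .
      then show "(\<lambda>y. ennreal (max 0 (- g (R y)))) \<in> borel_measurable N" by measurable
      show "(\<lambda>y. ennreal (E y)) \<in> borel_measurable N" using intN[OF E] by measurable
    qed
    finally have le: "(\<integral>\<^sup>+y. ennreal (max 0 (g y)) \<partial>N)
        \<le> (\<integral>\<^sup>+y. ennreal (max 0 (- g (R y))) \<partial>N) + (\<integral>\<^sup>+y. ennreal (E y) \<partial>N)" .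
    have "(\<integral>\<^sup>+y. ennreal (max 0 (- g (R y))) \<partial>N) = (\<integral>\<^sup>+y. ennreal (max 0 (- g y)) \<partial>distr N N R)"
      using gm R_meas by (subst nn_integral_distr) auto
    also have "\<dots> \<le> ennreal k * (\<integral>\<^sup>+y. ennreal (max 0 (- g y)) \<partial>N)"
      using em gm by (intro nn_integral_le_scale) auto
    also have "(\<integral>\<^sup>+y. ennreal (max 0 (- g y)) \<partial>N) = ennreal (\<integral>y. max 0 (- g y) \<partial>N)"
      using ip by (intro nn_integral_eq_integral) auto
    finally have le': "(\<integral>\<^sup>+y. ennreal (max 0 (- g (R y))) \<partial>N) \<le> ennreal (k * (\<integral>y. max 0 (- g y) \<partial>N))"
      using k by (simp add: ennreal_mult')
    have "ennreal (\<integral>y. max 0 (g y) \<partial>N) = (\<integral>\<^sup>+y. ennreal (max 0 (g y)) \<partial>N)"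
      using ip by (intro nn_integral_eq_integral[symmetric]) auto
    also have "\<dots> \<le> ennreal (k * (\<integral>y. max 0 (- g y) \<partial>N)) + (\<integral>\<^sup>+y. ennreal (E y) \<partial>N)"
      using le add_right_mono[OF le'] by (rule order_trans)
    also have "(\<integral>\<^sup>+y. ennreal (E y) \<partial>N) = ennreal (\<integral>y. E y \<partial>N)"
      using intN[OF E] EN by (intro nn_integral_eq_integral AE_I2) (auto simp: spN)
    also have "ennreal (k * (\<integral>y. max 0 (- g y) \<partial>N)) + ennreal (\<integral>y. E y \<partial>N)
        = ennreal (k * (\<integral>y. max 0 (- g y) \<partial>N) + (\<integral>y. E y \<partial>N))"
      using k E0 by (simp add: ennreal_plus)
    finally show ?thesis
      using k E0 by (subst (asm) ennreal_le_iff) (auto intro!: add_nonneg_nonneg mult_nonneg_nonneg)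
  qed
  have fN: "integrable N f" by (rule intN[OF f])
  define p where "p = (\<integral>y. max 0 (f y) \<partial>N)"
  define q where "q = (\<integral>y. max 0 (- f y) \<partial>N)"
  define e where "e = (\<integral>y. E y \<partial>N)"
  have pq: "p \<ge> 0" "q \<ge> 0" by (simp_all add: p_def q_def)
  have 1: "p \<le> k * q + e" using key[OF fN fE] by (simp add: p_def q_def e_def)
  have 2: "q \<le> k * p + e"
  proof -
    have "\<bar>- f y + - f (R y)\<bar> \<le> E y" if "y \<in> U" for y using fE[OF that] by linarith
    then show ?thesis using key[of "\<lambda>y. - f y"] fN by (simp add: p_def q_def e_def)
  qed
  have diff: "(\<integral>y. f y \<partial>N) = p - q"
  proof -
    have "(\<integral>y. f y \<partial>N) = (\<integral>y. max 0 (f y) - max 0 (- f y) \<partial>N)"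
      by (rule Bochner_Integration.integral_cong) (auto simp: max_def)
    also have "\<dots> = p - q" unfolding p_def q_def by (rule Bochner_Integration.integral_diff) (use fN in auto)
    finally show ?thesis .
  qed
  have sum: "(\<integral>y. \<bar>f y\<bar> \<partial>N) = p + q"
  proof -
    have "(\<integral>y. \<bar>f y\<bar> \<partial>N) = (\<integral>y. max 0 (f y) + max 0 (- f y) \<partial>N)"
      by (rule Bochner_Integration.integral_cong) (auto simp: max_def)
    also have "\<dots> = p + q" unfolding p_def q_def by (rule Bochner_Integration.integral_add) (use fN in auto)
    finally show ?thesis .
  qed
  have "p - q \<le> (k - 1) * q + e" "q - p \<le> (k - 1) * p + e" using 1 2 by (auto simp: algebra_simps)
  moreover have "(k - 1) * q \<le> (k - 1) * (p + q)" "(k - 1) * p \<le> (k - 1) * (p + q)"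
    using k pq by (auto intro!: mult_left_mono)
  ultimately have "\<bar>p - q\<bar> \<le> (k - 1) * (p + q) + e" by linarith
  then show ?thesis
    using diff sum unfolding LN by (simp add: k_def L_def e_def LN)
qed

lemma norm_square_diff_le:
  fixes a b :: "'b::real_normed_vector"
  shows "\<bar>(norm a)\<^sup>2 - (norm b)\<^sup>2\<bar> \<le> norm (a - b) * (norm a + norm b)"
proof -
  have "(norm a)\<^sup>2 - (norm b)\<^sup>2 = (norm a - norm b) * (norm a + norm b)"
    by (simp add: power2_eq_square algebra_simps)
  then have "\<bar>(norm a)\<^sup>2 - (norm b)\<^sup>2\<bar> = \<bar>norm a - norm b\<bar> * (norm a + norm b)"
    by (simp add: abs_mult)
  also have "\<dots> \<le> norm (a - b) * (norm a + norm b)"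
    using norm_triangle_ineq3[of a b] by (intro mult_right_mono) auto
  finally show ?thesis .
qed

text \<open>The sum splits into the difference of the Gaussians times the linear factor at
  \<open>y\<close>, and the Gaussian at \<open>y'\<close> times the nearly cancelling linear
  factors. The former costs \<epsilon> times the square of the distance over \<open>u\<close>,
  whence the cubic term. The bound \<open>\<epsilon> \<le> 1/2\<close> gives
  \<open>d / 2 \<le> d'\<close>, so both Gaussians lie below the one with a quarter of the
  exponent.\<close>

lemma gaussian_reflection_sum_le:
  fixes y y' x a :: "'a::real_inner"
  assumes u: "u > 0" and \<epsilon>: "0 \<le> \<epsilon>" "\<epsilon> \<le> 1/2"
    and near: "norm ((y' - x) + (y - x)) \<le> \<epsilon> * norm (y - x)"
  defines "f \<equiv> \<lambda>y. exp (- (1/4) * (norm (x - y))\<^sup>2 / u) * ((x - y) \<bullet> a)"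
  shows "\<bar>f y + f y'\<bar> \<le> norm a * (\<epsilon> * (norm (x - y) + (norm (x - y)) ^ 3 / u)) * exp (- (1/16) * (norm (x - y))\<^sup>2 / u)"
proof -
  define d where "d = norm (x - y)"
  define d' where "d' = norm (x - y')"
  have d: "d \<ge> 0" "d' \<ge> 0" by (auto simp: d_def d'_def)
  have near': "norm ((x - y) + (x - y')) \<le> \<epsilon> * d"
    using near by (metis (no_types, lifting) add.commute add_uminus_conv_diff d_def minus_add_distrib minus_diff_eq norm_minus_cancel norm_minus_commute)
  have dd: "\<bar>d - d'\<bar> \<le> \<epsilon> * d"
    using near' norm_triangle_ineq3[of "x - y" "- (x - y')"]
    unfolding d_def d'_def norm_minus_cancel diff_minus_eq_add by linarith
  have ed: "\<epsilon> * d \<le> d / 2" using mult_right_mono[OF \<epsilon>(2) d(1)] by simp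
  have d2: "d / 2 \<le> d'" "d' \<le> 2 * d" using dd ed d by linarith+
  have sq: "d\<^sup>2 / 4 \<le> d'\<^sup>2"
    using power_mono[OF d2(1), of 2] d by (simp add: power_divide)
  define c where "c = d\<^sup>2 / (16 * u)"
  have c1: "c \<le> d\<^sup>2 / (4 * u)" unfolding c_def using u by (intro divide_left_mono) auto
  have c2: "c \<le> d'\<^sup>2 / (4 * u)"
    unfolding c_def using divide_right_mono[OF sq, of "4 * u"] u by simp
  define e where "e = exp (- (d\<^sup>2 / (4 * u)))"
  define e' where "e' = exp (- (d'\<^sup>2 / (4 * u)))"
  have e': "e' \<le> exp (- c)" "e' \<ge> 0" using c2 by (auto simp: e'_def)
  have ee: "\<bar>e - e'\<bar> \<le> \<epsilon> * (d\<^sup>2 / u) * exp (- c)"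
  proof -
    have "\<bar>e - e'\<bar> \<le> \<bar>d\<^sup>2 / (4 * u) - d'\<^sup>2 / (4 * u)\<bar> * exp (- c)"
      unfolding e_def e'_def by (rule abs_exp_minus_diff_le[OF c1 c2])
    also have "\<dots> \<le> (\<epsilon> * (d\<^sup>2 / u)) * exp (- c)"
    proof (rule mult_right_mono)
      have "\<bar>d\<^sup>2 - d'\<^sup>2\<bar> = \<bar>d - d'\<bar> * (d + d')"
        using d by (simp add: power2_eq_square square_diff_square_factored abs_mult mult.commute)
      also have "\<dots> \<le> (\<epsilon> * d) * (4 * d)"
        using dd d d2 by (intro mult_mono) auto
      finally have "\<bar>d\<^sup>2 - d'\<^sup>2\<bar> / (4 * u) \<le> (\<epsilon> * d) * (4 * d) / (4 * u)"
        using u by (intro divide_right_mono) auto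
      then show "\<bar>d\<^sup>2 / (4 * u) - d'\<^sup>2 / (4 * u)\<bar> \<le> \<epsilon> * (d\<^sup>2 / u)"
        using u by (simp add: diff_divide_distrib[symmetric] power2_eq_square)
    qed simp
    finally show ?thesis .
  qed
  have "f y + f y' = (e - e') * ((x - y) \<bullet> a) + e' * (((x - y) + (x - y')) \<bullet> a)"
    by (simp add: f_def e_def e'_def d_def d'_def inner_add_left algebra_simps)
  also have "\<bar>\<dots>\<bar> \<le> \<bar>e - e'\<bar> * \<bar>(x - y) \<bullet> a\<bar> + e' * \<bar>((x - y) + (x - y')) \<bullet> a\<bar>"
    using abs_triangle_ineq[of "(e - e') * ((x - y) \<bullet> a)" "e' * (((x - y) + (x - y')) \<bullet> a)"] e'(2)
    by (simp only: abs_mult abs_of_nonneg)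
  also have "\<dots> \<le> (\<epsilon> * (d\<^sup>2 / u) * exp (- c)) * (d * norm a) + exp (- c) * (\<epsilon> * d * norm a)"
  proof (intro add_mono mult_mono ee)
    show "\<bar>(x - y) \<bullet> a\<bar> \<le> d * norm a" unfolding d_def by (rule Cauchy_Schwarz_ineq2)
    have "\<bar>((x - y) + (x - y')) \<bullet> a\<bar> \<le> norm ((x - y) + (x - y')) * norm a" by (rule Cauchy_Schwarz_ineq2)
    also have "\<dots> \<le> \<epsilon> * d * norm a" using near' by (intro mult_right_mono) auto
    finally show "\<bar>((x - y) + (x - y')) \<bullet> a\<bar> \<le> \<epsilon> * d * norm a" .
  qed (use e' \<epsilon> u in auto)
  also have "\<dots> = norm a * (\<epsilon> * (d + d ^ 3 / u)) * exp (- (1/16) * d\<^sup>2 / u)"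
    by (simp add: c_def algebra_simps power2_eq_square power3_eq_cube)
  finally show ?thesis by (simp add: d_def)
qed

lemma lborel_integral_dominated:
  fixes f g :: "real \<Rightarrow> real"
  assumes f: "integrable lborel f" and g: "integrable lborel g"
    and le: "\<And>\<tau>. \<tau> \<noteq> c \<Longrightarrow> \<bar>f \<tau>\<bar> \<le> g \<tau>"
  shows "\<bar>integral\<^sup>L lborel f\<bar> \<le> integral\<^sup>L lborel g"
proof -
  have "AE \<tau> in lborel. \<tau> \<noteq> c" by (rule AE_lborel_singleton)
  then have "AE \<tau> in lborel. \<bar>f \<tau>\<bar> \<le> g \<tau>" by eventually_elim (rule le)
  then have "(\<integral>\<tau>. \<bar>f \<tau>\<bar> \<partial>lborel) \<le> integral\<^sup>L lborel g"
    using f g by (intro integral_mono_AE) auto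
  then show ?thesis using integral_abs_bound[of lborel f] by linarith
qed

section \<open>The normal derivative of the heat kernel\<close>

lemma powr_mult_divide: "(u::real) > 0 \<Longrightarrow> u powr a * u powr b / u = u powr (a + b - 1)"
  by (simp add: powr_add powr_diff)

text \<open>The interface between geometry and analysis: the potential estimates see
  \<open>\<Omega>\<close> only through these properties of its boundary, its normal and its
  measure.\<close>

locale heat_surface =
  fixes F :: "'a::euclidean_space set" and \<sigma> :: "'a measure" and \<nu> :: "'a \<Rightarrow> 'a" and \<alpha> C A \<rho>0 :: real
  assumes dim: "DIM('a) \<ge> 2" and \<alpha>: "0 < \<alpha>" "\<alpha> < 1"
    and compact_F: "compact F"
    and sets_\<sigma>: "\<And>B. B \<in> sets \<sigma> \<longleftrightarrow> B \<in> sets borel \<and> B \<subseteq> F"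
    and C: "C \<ge> 0" and A: "A \<ge> 0" and \<rho>0: "\<rho>0 > 0"
    and ball_le: "\<And>x \<rho>. x \<in> F \<Longrightarrow> \<rho> > 0 \<Longrightarrow> emeasure \<sigma> (F \<inter> cball x \<rho>) \<le> ennreal (A * \<rho> powr (real DIM('a) - 1))"
    and \<nu>_hoelder: "\<And>x y. x \<in> F \<Longrightarrow> y \<in> F \<Longrightarrow> norm (\<nu> x - \<nu> y) \<le> C * norm (x - y) powr \<alpha>"
    and \<nu>_flat: "\<And>x y. x \<in> F \<Longrightarrow> y \<in> F \<Longrightarrow> \<bar>\<nu> x \<bullet> (x - y)\<bar> \<le> C * norm (x - y) powr (1 + \<alpha>)"
    and reflection: "\<And>x \<rho>. x \<in> F \<Longrightarrow> 0 < \<rho> \<Longrightarrow> \<rho> \<le> \<rho>0 \<Longrightarrow> \<exists>U R. near_reflection F x \<rho> (C * \<rho> powr \<alpha>) U R"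
    and quasi_invariant: "\<And>B L R. B \<in> sets \<sigma> \<Longrightarrow> R ` B \<in> sets \<sigma> \<Longrightarrow> L > 0 \<Longrightarrow>
        (\<And>y z. y \<in> B \<Longrightarrow> z \<in> B \<Longrightarrow> norm (R y - R z) \<le> L * norm (y - z)) \<Longrightarrow>
        emeasure \<sigma> (R ` B) \<le> ennreal (L powr (real DIM('a) - 1)) * emeasure \<sigma> B"
begin

text \<open>With half the dimension as parameter, the heat kernel is normalised by
  \<open>u powr (- m)\<close>, and a Gaussian integrated over the surface has order
  \<open>u powr (m - 1/2)\<close>.\<close>

definition m :: real where "m = real DIM('a) / 2"

lemma m: "m \<ge> 1" using dim by (simp add: m_def)

lemma borel_F: "F \<in> sets borel"
  using compact_F by (simp add: borel_closed compact_imp_closed)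

lemma space_\<sigma> [simp]: "space \<sigma> = F"
proof
  show "space \<sigma> \<subseteq> F" using sets.top[of \<sigma>] sets_\<sigma> by blast
  have "F \<in> sets \<sigma>" using sets_\<sigma> borel_F by blast
  then show "F \<subseteq> space \<sigma>" by (rule sets.sets_into_space)
qed

lemma sets_\<sigma>_eq: "sets \<sigma> = sets (restrict_space borel F)"
  using sets_\<sigma> borel_F by (auto simp: sets_restrict_space_iff)

lemma measurable_\<sigma>_continuous: "continuous_on F f \<Longrightarrow> f \<in> borel_measurable \<sigma>"
  using borel_measurable_continuous_on_restrict[of F f] measurable_cong_sets[OF sets_\<sigma>_eq refl] by blast

sublocale finite_measure \<sigma>
proof
  show "emeasure \<sigma> (space \<sigma>) \<noteq> \<infinity>"
  proof (cases "F = {}")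
    case False
    then obtain x where x: "x \<in> F" by auto
    obtain \<rho> where "F \<subseteq> cball x \<rho>"
      using bounded_subset_ballD[OF compact_imp_bounded[OF compact_F], of x] ball_subset_cball by blast
    then have "F = F \<inter> cball x (max \<rho> 1)" by auto
    then have "emeasure \<sigma> F \<le> ennreal (A * (max \<rho> 1) powr (real DIM('a) - 1))"
      using ball_le[OF x, of "max \<rho> 1"] by simp
    then show ?thesis by (auto simp: top_unique)
  qed simp
qed

text \<open>A point at distance between \<open>k * sqrt u\<close> and
  \<open>(k + 1) * sqrt u\<close> from \<open>x\<close> has weight at most
  \<open>exp (- c * (real k)\<^sup>2)\<close>, and the ball of the larger radius has mass of order
  \<open>((k + 1) * sqrt u) powr (n - 1)\<close>, where \<open>n\<close> is the dimension. Summing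
  over \<open>k\<close> leaves the power \<open>(n - 1) / 2 = m - 1/2\<close> of
  \<open>u\<close>.\<close>

lemma gauss_nn_integral:
  assumes c: "c > 0"
  shows "\<exists>B\<ge>0. \<forall>x\<in>F. \<forall>u>0. (\<integral>\<^sup>+y. ennreal (exp (- c * (norm (x - y))\<^sup>2 / u)) \<partial>\<sigma>) \<le> ennreal (B * u powr (m - 1/2))"
proof -
  define s where "s = real DIM('a) - 1"
  have s: "s > 0" "s / 2 = m - 1/2" using dim by (auto simp: s_def m_def)
  \<comment> \<open>The factor \<open>exp c\<close> pays for replacing \<open>k\<close> by
    \<open>k + 1\<close> in the Gaussian. The other factor is that of
    \<open>powr_mult_exp_le\<close> for the exponent \<open>s + 2\<close>, two more than the volume
    growth, which leaves the summable inverse squares.\<close>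
  define K where "K = exp c * exp ((s + 2)\<^sup>2 / c)"
  have tm: "exp (- c * (real k)\<^sup>2) * (real k + 1) powr s \<le> K * inverse ((real (Suc k))\<^sup>2)" for k
  proof -
    define z where "z = real k + 1"
    have z: "z \<ge> 1" by (simp add: z_def)
    have "0 \<le> (real k - 1)\<^sup>2" by simp
    then have "z\<^sup>2 \<le> 2 * (real k)\<^sup>2 + 2" by (simp add: z_def power2_eq_square algebra_simps)
    then have "c * z\<^sup>2 \<le> c * (2 * (real k)\<^sup>2 + 2)" using c by (intro mult_left_mono) auto
    then have "exp (- c * (real k)\<^sup>2) \<le> exp (c + - (c / 2) * z\<^sup>2)" by (simp add: algebra_simps)
    then have "exp (- c * (real k)\<^sup>2) * z powr s \<le> (exp c * exp (- (c / 2) * z\<^sup>2)) * z powr s"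
      by (intro mult_right_mono) (simp_all add: exp_add[symmetric])
    also have "\<dots> = exp c * (z powr (s + 2) * exp (- (c / 2) * z\<^sup>2 / 1)) * inverse (z\<^sup>2)"
      using z by (simp add: powr_add powr_numeral)
    also have "\<dots> \<le> exp c * exp ((s + 2)\<^sup>2 / c) * inverse (z\<^sup>2)"
    proof (intro mult_right_mono mult_left_mono)
      have "z powr (s + 2) * exp (- (c / 2) * z\<^sup>2 / 1)
          \<le> exp ((s + 2)\<^sup>2 / (2 * (c / 2))) * 1 powr ((s + 2) / 2) * exp (- (c / 2 / 2) * z\<^sup>2 / 1)"
        using s c z by (intro powr_mult_exp_le) auto
      also have "\<dots> \<le> exp ((s + 2)\<^sup>2 / c) * 1" using c by (simp add: mult_left_mono)
      finally show "z powr (s + 2) * exp (- (c / 2) * z\<^sup>2 / 1) \<le> exp ((s + 2)\<^sup>2 / c)" by simp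
    qed (use z in auto)
    finally show ?thesis by (simp add: z_def K_def add.commute)
  qed
  have summ: "summable (\<lambda>k. inverse ((real (Suc k))\<^sup>2))"
    using summable_Suc_iff[of "\<lambda>k. inverse ((real k)\<^sup>2)"] inverse_power_summable[of 2, where 'a = real] by simp
  define Z where "Z = (\<Sum>k. inverse ((real (Suc k))\<^sup>2))"
  have Z: "Z \<ge> 0" unfolding Z_def by (intro suminf_nonneg summ) auto
  have K: "K \<ge> 0" by (simp add: K_def)
  show ?thesis
  proof (intro exI[of _ "A * K * Z"] conjI ballI allI impI)
    show "0 \<le> A * K * Z" using A K Z by simp
    fix x and u :: real assume x: "x \<in> F" and u: "u > 0"
    define a where "a k = ennreal (exp (- c * (real k)\<^sup>2))" for k
    define V where "V k = F \<inter> cball x ((real k + 1) * sqrt u)" for k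
    have V: "V k \<in> sets \<sigma>" for k using borel_F by (simp add: sets_\<sigma> V_def)
    have "(\<integral>\<^sup>+y. ennreal (exp (- c * (norm (x - y))\<^sup>2 / u)) \<partial>\<sigma>) \<le> (\<integral>\<^sup>+y. (\<Sum>k. a k * indicator (V k) y) \<partial>\<sigma>)"
    proof (rule nn_integral_mono)
      fix y assume "y \<in> space \<sigma>"
      then have y: "y \<in> F" by simp
      define z where "z = norm (x - y) / sqrt u"
      define k where "k = nat \<lfloor>z\<rfloor>"
      have z: "z \<ge> 0" using u by (simp add: z_def)
      have kz: "real k \<le> z" "z \<le> real k + 1" using z by (auto simp: k_def)
      have "z\<^sup>2 = (norm (x - y))\<^sup>2 / u" using u by (simp add: z_def power_divide)
      moreover have "c * (real k)\<^sup>2 \<le> c * z\<^sup>2" using kz c by (intro mult_left_mono power_mono) auto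
      ultimately have 1: "exp (- c * (norm (x - y))\<^sup>2 / u) \<le> exp (- c * (real k)\<^sup>2)" by simp
      have "norm (x - y) \<le> (real k + 1) * sqrt u" using kz(2) u by (simp add: z_def divide_le_eq)
      then have "y \<in> V k" using y by (simp add: V_def dist_norm)
      then have "ennreal (exp (- c * (norm (x - y))\<^sup>2 / u)) \<le> a k * indicator (V k) y"
        using 1 by (simp add: a_def ennreal_leI)
      also have "\<dots> \<le> (\<Sum>k. a k * indicator (V k) y)"
      proof -
        define f where "f j = a j * indicator (V j) y" for j
        have "sum f {k} \<le> suminf f" by (rule sum_le_suminf) auto
        then show ?thesis by (simp add: f_def[abs_def] del: sum_mult_indicator)
      qed
      finally show "ennreal (exp (- c * (norm (x - y))\<^sup>2 / u)) \<le> (\<Sum>k. a k * indicator (V k) y)" .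
    qed
    also have "\<dots> = (\<Sum>k. \<integral>\<^sup>+y. a k * indicator (V k) y \<partial>\<sigma>)"
      using V by (intro nn_integral_suminf) auto
    also have "\<dots> = (\<Sum>k. a k * emeasure \<sigma> (V k))" using V by (simp add: nn_integral_cmult_indicator)
    also have "\<dots> \<le> (\<Sum>k. ennreal (A * K * u powr (m - 1/2) * inverse ((real (Suc k))\<^sup>2)))"
    proof (rule suminf_le)
      fix k
      have "emeasure \<sigma> (V k) \<le> ennreal (A * ((real k + 1) * sqrt u) powr s)"
        unfolding V_def s_def using u by (intro ball_le x) auto
      also have "((real k + 1) * sqrt u) powr s = (real k + 1) powr s * u powr (m - 1/2)"
      proof -
        have "sqrt u powr s = u powr (s / 2)" using u by (simp add: powr_half_sqrt[symmetric] powr_powr)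
        then show ?thesis unfolding s(2) using u by (simp add: powr_mult)
      qed
      finally have "a k * emeasure \<sigma> (V k) \<le> a k * ennreal (A * ((real k + 1) powr s * u powr (m - 1/2)))"
        by (rule mult_left_mono) simp
      also have "\<dots> = ennreal (A * u powr (m - 1/2) * (exp (- c * (real k)\<^sup>2) * (real k + 1) powr s))"
        by (simp add: a_def mult_ac flip: ennreal_mult')
      also have "\<dots> \<le> ennreal (A * u powr (m - 1/2) * (K * inverse ((real (Suc k))\<^sup>2)))"
        using tm[of k] A by (intro ennreal_leI mult_left_mono) auto
      finally show "a k * emeasure \<sigma> (V k) \<le> ennreal (A * K * u powr (m - 1/2) * inverse ((real (Suc k))\<^sup>2))"
        by (simp add: mult_ac)
    qed auto
    also have "\<dots> = ennreal (A * K * Z * u powr (m - 1/2))"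
    proof -
      define w where "w = A * K * u powr (m - 1/2)"
      have "(\<Sum>k. ennreal (w * inverse ((real (Suc k))\<^sup>2))) = ennreal (\<Sum>k. w * inverse ((real (Suc k))\<^sup>2))"
        using A K by (intro suminf_ennreal2 summable_mult summ) (auto simp: w_def)
      also have "(\<Sum>k. w * inverse ((real (Suc k))\<^sup>2)) = w * Z"
        unfolding Z_def by (rule suminf_mult[OF summ])
      finally show ?thesis by (simp add: w_def mult_ac)
    qed
    finally show "(\<integral>\<^sup>+y. ennreal (exp (- c * (norm (x - y))\<^sup>2 / u)) \<partial>\<sigma>) \<le> ennreal (A * K * Z * u powr (m - 1/2))" .
  qed
qed

text \<open>A choice from the preceding existence statement, so that the constant visibly depends on
  \<open>c\<close> alone and not on \<open>x\<close> or \<open>u\<close>.\<close>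

definition gauss_const :: "real \<Rightarrow> real" where
  "gauss_const c = (SOME B. B \<ge> 0 \<and> (\<forall>x\<in>F. \<forall>u>0.
     (\<integral>\<^sup>+y. ennreal (exp (- c * (norm (x - y))\<^sup>2 / u)) \<partial>\<sigma>) \<le> ennreal (B * u powr (m - 1/2))))"

lemma gauss_const:
  assumes "c > 0"
  shows "gauss_const c \<ge> 0"
    and "x \<in> F \<Longrightarrow> u > 0 \<Longrightarrow> (\<integral>\<^sup>+y. ennreal (exp (- c * (norm (x - y))\<^sup>2 / u)) \<partial>\<sigma>) \<le> ennreal (gauss_const c * u powr (m - 1/2))"
  using someI_ex[OF gauss_nn_integral[OF assms, unfolded Bex_def]] unfolding gauss_const_def[symmetric] by auto

text \<open>The form in which Gaussian bounds are used throughout: a pointwise bound turns into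
  integrability and a factor \<open>u powr (m - 1/2)\<close>.\<close>

lemma gauss_dominated:
  fixes f :: "'a \<Rightarrow> real"
  assumes c: "c > 0" and x: "x \<in> F" and u: "u > 0" and Q: "Q \<ge> 0"
    and f: "f \<in> borel_measurable \<sigma>"
    and le: "\<And>y. y \<in> F \<Longrightarrow> \<bar>f y\<bar> \<le> Q * exp (- c * (norm (x - y))\<^sup>2 / u)"
  shows "integrable \<sigma> f" and "(\<integral>y. \<bar>f y\<bar> \<partial>\<sigma>) \<le> Q * gauss_const c * u powr (m - 1/2)"
    and "\<bar>\<integral>y. f y \<partial>\<sigma>\<bar> \<le> Q * gauss_const c * u powr (m - 1/2)"
proof -
  have "(\<integral>\<^sup>+y. ennreal \<bar>f y\<bar> \<partial>\<sigma>) \<le> (\<integral>\<^sup>+y. ennreal Q * ennreal (exp (- c * (norm (x - y))\<^sup>2 / u)) \<partial>\<sigma>)"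
    using le Q by (intro nn_integral_mono) (simp add: ennreal_leI flip: ennreal_mult')
  also have "\<dots> = ennreal Q * (\<integral>\<^sup>+y. ennreal (exp (- c * (norm (x - y))\<^sup>2 / u)) \<partial>\<sigma>)"
    using u by (intro nn_integral_cmult measurable_compose[OF measurable_\<sigma>_continuous measurable_ennreal] continuous_intros) auto
  also have "\<dots> \<le> ennreal Q * ennreal (gauss_const c * u powr (m - 1/2))"
    by (intro mult_left_mono gauss_const c x u) auto
  also have "\<dots> = ennreal (Q * gauss_const c * u powr (m - 1/2))"
    using Q by (simp add: mult.assoc flip: ennreal_mult')
  finally have nn: "(\<integral>\<^sup>+y. ennreal \<bar>f y\<bar> \<partial>\<sigma>) \<le> ennreal (Q * gauss_const c * u powr (m - 1/2))" .
  show i: "integrable \<sigma> f"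
    using f nn by (intro integrableI_bounded) (auto intro: le_less_trans)
  have "ennreal (\<integral>y. \<bar>f y\<bar> \<partial>\<sigma>) = (\<integral>\<^sup>+y. ennreal \<bar>f y\<bar> \<partial>\<sigma>)"
    using i by (intro nn_integral_eq_integral[symmetric]) auto
  then show 1: "(\<integral>y. \<bar>f y\<bar> \<partial>\<sigma>) \<le> Q * gauss_const c * u powr (m - 1/2)"
    using nn Q gauss_const(1)[OF c] by (metis ennreal_le_iff mult_nonneg_nonneg powr_ge_zero)
  show "\<bar>\<integral>y. f y \<partial>\<sigma>\<bar> \<le> Q * gauss_const c * u powr (m - 1/2)"
    using integral_abs_bound[of \<sigma> f] 1 by linarith
qed

section \<open>Pointwise bounds for the normal derivative and its increments\<close>

lemma heat_kernel_eq: "u > 0 \<Longrightarrow> heat_kernel u (z::'a) = (4 * pi) powr (- m) * u powr (- m) * exp (- (1/4) * (norm z)\<^sup>2 / u)"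
  by (simp add: heat_kernel_def m_def powr_mult)

lemma four_pi_powr: "0 < (4 * pi) powr (- m)" "(4 * pi) powr (- m) \<le> 1"
proof -
  have "1 \<le> 4 * pi" using pi_gt3 by linarith
  then show "(4 * pi) powr (- m) \<le> 1"
    using powr_mono[of "- m" 0 "4 * pi"] m by simp
qed simp

lemma heat_kernel_nonneg: "0 \<le> heat_kernel u (z::'a)"
  by (simp add: heat_kernel_def)

lemma heat_kernel_le: "u > 0 \<Longrightarrow> heat_kernel u (z::'a) \<le> u powr (- m) * exp (- (1/4) * (norm z)\<^sup>2 / u)"
  using four_pi_powr by (simp add: heat_kernel_eq mult_left_le_one_le mult.assoc)

lemma continuous_heat_kernel [continuous_intros]:
  "continuous_on S f \<Longrightarrow> continuous_on S (\<lambda>y. heat_kernel u (f y :: 'a))"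
  unfolding heat_kernel_def by (cases "u > 0") (auto intro!: continuous_intros)

text \<open>The derivative of \<open>heat_kernel u (z - y)\<close> in \<open>z\<close> at
  \<open>x\<close> along \<open>\<nu> x\<close>. For \<open>u \<le> 0\<close> it is 0 together with
  the heat kernel, division by 0 included.\<close>

definition flux :: "real \<Rightarrow> 'a \<Rightarrow> 'a \<Rightarrow> real" where
  "flux u x y = - heat_kernel u (x - y) * ((x - y) \<bullet> \<nu> x) / (2 * u)"

lemma \<nu>_flat': "x \<in> F \<Longrightarrow> y \<in> F \<Longrightarrow> \<bar>(x - y) \<bullet> \<nu> x\<bar> \<le> C * norm (x - y) powr (1 + \<alpha>)"
  using \<nu>_flat[of x y] by (simp add: inner_commute)

lemma measurable_flux: "flux u x \<in> borel_measurable \<sigma>"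
  unfolding flux_def[abs_def]
  by (rule measurable_\<sigma>_continuous) (cases "u = 0"; auto intro!: continuous_intros)

text \<open>Flatness supplies \<open>norm (x - y) powr (1 + \<alpha>)\<close>, which the Gaussian
  converts into \<open>u powr ((1 + \<alpha>) / 2)\<close>. The exponent is the one that becomes
  \<open>\<alpha> / 2 - 1\<close> after integration over the surface.\<close>

lemma flux_bound: "\<exists>K\<ge>0. \<forall>x\<in>F. \<forall>y\<in>F. \<forall>u>0.
    \<bar>flux u x y\<bar> \<le> K * u powr (\<alpha> / 2 - 1/2 - m) * exp (- (1/8) * (norm (x - y))\<^sup>2 / u)"
proof -
  define K where "K = C / 2 * exp ((1 + \<alpha>)\<^sup>2 / (2 * (1/4)))"
  show ?thesis
  proof (intro exI[of _ K] conjI ballI allI impI)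
    show "K \<ge> 0" using C by (simp add: K_def)
    fix x y and u :: real assume x: "x \<in> F" and y: "y \<in> F" and u: "u > 0"
    define d where "d = norm (x - y)"
    have d: "d \<ge> 0" by (simp add: d_def)
    have "\<bar>flux u x y\<bar> = heat_kernel u (x - y) * \<bar>(x - y) \<bullet> \<nu> x\<bar> / (2 * u)"
      using u by (simp add: flux_def abs_mult heat_kernel_nonneg)
    also have "\<dots> \<le> (u powr (- m) * exp (- (1/4) * d\<^sup>2 / u)) * (C * d powr (1 + \<alpha>)) / (2 * u)"
      using u heat_kernel_le[OF u, of "x - y"] \<nu>_flat'[OF x y] unfolding d_def
      by (intro divide_right_mono mult_mono) auto
    also have "\<dots> = (C / 2 * u powr (- m) / u) * (d powr (1 + \<alpha>) * exp (- (1/4) * d\<^sup>2 / u))"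
      by (simp add: field_simps)
    also have "\<dots> \<le> (C / 2 * u powr (- m) / u) * (exp ((1 + \<alpha>)\<^sup>2 / (2 * (1/4))) * u powr ((1 + \<alpha>) / 2) * exp (- (1/4/2) * d\<^sup>2 / u))"
      using u C d \<alpha> by (intro mult_left_mono powr_mult_exp_le) auto
    also have "\<dots> = K * (u powr (- m) * u powr ((1 + \<alpha>) / 2) / u) * exp (- (1/4/2) * d\<^sup>2 / u)"
      by (simp add: K_def)
    also have "\<dots> = K * u powr (\<alpha> / 2 - 1/2 - m) * exp (- (1/8) * d\<^sup>2 / u)"
      unfolding powr_mult_divide[OF u] by (simp add: add_divide_distrib algebra_simps)
    finally show "\<bar>flux u x y\<bar> \<le> K * u powr (\<alpha> / 2 - 1/2 - m) * exp (- (1/8) * (norm (x - y))\<^sup>2 / u)"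
      by (simp add: d_def)
  qed
qed

text \<open>The power \<open>u powr (- m - 1)\<close> is moved into the exponent \<Phi> as a
  logarithm, so that a single use of \<open>abs_exp_minus_diff_le\<close> covers both ways in which
  the kernel depends on time. The increment of \<Phi> is \<open>h / u\<close> times a constant plus
  a multiple of \<open>d\<^sup>2 / u\<close>; the latter raises the exponent
  \<open>1 + \<alpha>\<close> to \<open>3 + \<alpha>\<close>.\<close>

lemma flux_time_increment: "\<exists>K\<ge>0. \<forall>x\<in>F. \<forall>y\<in>F. \<forall>u>0. \<forall>h\<in>{0..u}.
    \<bar>flux (u + h) x y - flux u x y\<bar> \<le> K * (h / u * u powr (\<alpha> / 2 - 1/2 - m)) * exp (- (1/16) * (norm (x - y))\<^sup>2 / u)"
proof -
  define E1 where "E1 = exp ((1 + \<alpha>)\<^sup>2 / (2 * (1/8)))"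
  define E2 where "E2 = exp ((3 + \<alpha>)\<^sup>2 / (2 * (1/8)))"
  define K where "K = C / 2 * ((1 + m) * E1 + 1/4 * E2)"
  show ?thesis
  proof (intro exI[of _ K] conjI ballI allI impI)
    show "K \<ge> 0" using C m by (simp add: K_def E1_def E2_def)
    fix x y and u h :: real assume x: "x \<in> F" and y: "y \<in> F" and u: "u > 0" and "h \<in> {0..u}"
    then have h: "0 \<le> h" "h \<le> u" by auto
    define d where "d = norm (x - y)"
    have d: "d \<ge> 0" by (simp add: d_def)
    define q where "q = (x - y) \<bullet> \<nu> x"
    define \<Phi> where "\<Phi> v = (1 + m) * ln v + d\<^sup>2 / (4 * v)" for v
    have fl: "flux v x y = - ((4 * pi) powr (- m) * q / 2) * exp (- \<Phi> v)" if v: "v > 0" for v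
    proof -
      have "exp (- \<Phi> v) = v powr (- m) * v powr (-1) * exp (- (1/4) * d\<^sup>2 / v)"
        using v by (simp add: \<Phi>_def powr_def exp_add[symmetric] algebra_simps)
      then show ?thesis
        using v by (simp add: flux_def heat_kernel_eq q_def d_def powr_minus_divide mult_ac)
    qed
    \<comment> \<open>The 8 accommodates \<open>u + h \<le> 2 * u\<close>, so that \<open>c\<close>
      bounds \<Phi> from below at both times.\<close>
    define c where "c = (1 + m) * ln u + d\<^sup>2 / (8 * u)"
    have c1: "c \<le> \<Phi> u"
      using u by (simp add: c_def \<Phi>_def frac_le)
    have c2: "c \<le> \<Phi> (u + h)"
      unfolding c_def \<Phi>_def using u h m by (intro add_mono mult_left_mono divide_left_mono) auto
    have dl: "\<bar>\<Phi> (u + h) - \<Phi> u\<bar> \<le> h / u * ((1 + m) + d\<^sup>2 / (4 * u))"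
    proof -
      have "ln (u + h) - ln u = ln (1 + h / u)"
      proof -
        have "1 + h / u = (u + h) / u" using u by (simp add: add_divide_distrib)
        then show ?thesis using u h by (simp add: ln_div)
      qed
      also have "\<dots> \<le> h / u" using u h by (intro ln_add_one_self_le_self) auto
      finally have 1: "ln (u + h) - ln u \<le> h / u" .
      have 0: "0 \<le> ln (u + h) - ln u" using u h by simp
      have "\<bar>(1 + m) * (ln (u + h) - ln u)\<bar> \<le> (1 + m) * (h / u)"
        using mult_left_mono[OF 1, of "1 + m"] mult_nonneg_nonneg[OF _ 0, of "1 + m"] m
        by (subst abs_of_nonneg) auto
      moreover have "\<bar>d\<^sup>2 / (4 * (u + h)) - d\<^sup>2 / (4 * u)\<bar> \<le> h / u * (d\<^sup>2 / (4 * u))"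
      proof -
        have eq: "d\<^sup>2 / (4 * u) - d\<^sup>2 / (4 * (u + h)) = (h / (u + h)) * (d\<^sup>2 / (4 * u))"
          using u h by (simp add: field_simps)
        have "0 \<le> (h / (u + h)) * (d\<^sup>2 / (4 * u))" using u h by simp
        then have "\<bar>d\<^sup>2 / (4 * (u + h)) - d\<^sup>2 / (4 * u)\<bar> = (h / (u + h)) * (d\<^sup>2 / (4 * u))"
          by (subst abs_minus_commute) (simp only: eq abs_of_nonneg)
        also have "\<dots> \<le> h / u * (d\<^sup>2 / (4 * u))"
          using u h by (intro mult_right_mono divide_left_mono) auto
        finally show ?thesis .
      qed
      moreover have "\<Phi> (u + h) - \<Phi> u = (1 + m) * (ln (u + h) - ln u) + (d\<^sup>2 / (4 * (u + h)) - d\<^sup>2 / (4 * u))"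
        by (simp add: \<Phi>_def algebra_simps)
      moreover have "h / u * ((1 + m) + d\<^sup>2 / (4 * u)) = (1 + m) * (h / u) + h / u * (d\<^sup>2 / (4 * u))"
        by (simp add: algebra_simps)
      ultimately show ?thesis by linarith
    qed
    have ec: "exp (- c) = u powr (- m) / u * exp (- (1/8) * d\<^sup>2 / u)"
    proof -
      have "exp (- c) = u powr (- m) * u powr (-1) * exp (- (1/8) * d\<^sup>2 / u)"
        using u by (simp add: c_def powr_def exp_add[symmetric] algebra_simps)
      then show ?thesis using u by (simp add: powr_minus_divide)
    qed
    have "\<bar>flux (u + h) x y - flux u x y\<bar> = (4 * pi) powr (- m) * (\<bar>q\<bar> / 2 * \<bar>exp (- \<Phi> (u + h)) - exp (- \<Phi> u)\<bar>)"
    proof -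
      have "flux (u + h) x y - flux u x y = - ((4 * pi) powr (- m) * q / 2) * (exp (- \<Phi> (u + h)) - exp (- \<Phi> u))"
        using u h by (simp add: fl right_diff_distrib)
      then show ?thesis by (simp only: abs_mult) (simp add: abs_mult)
    qed
    also have "\<dots> \<le> 1 * (C * d powr (1 + \<alpha>) / 2 * (\<bar>\<Phi> (u + h) - \<Phi> u\<bar> * exp (- c)))"
      using \<nu>_flat'[OF x y] four_pi_powr abs_exp_minus_diff_le[OF c2 c1]
      by (intro mult_mono divide_right_mono mult_nonneg_nonneg) (auto simp: q_def d_def C)
    also have "\<dots> \<le> 1 * (C * d powr (1 + \<alpha>) / 2 * ((h / u * ((1 + m) + d\<^sup>2 / (4 * u))) * exp (- c)))"
      using dl C by (intro mult_left_mono mult_right_mono) auto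
    also have "\<dots> = (C / 2 * (h / u) * (u powr (- m) / u)) *
        ((1 + m) * (d powr (1 + \<alpha>) * exp (- (1/8) * d\<^sup>2 / u)) + 1 / (4 * u) * (d powr (3 + \<alpha>) * exp (- (1/8) * d\<^sup>2 / u)))"
    proof -
      have "d powr (3 + \<alpha>) = d powr (1 + \<alpha>) * d\<^sup>2"
      proof (cases "d = 0")
        case False
        then have "d powr (1 + \<alpha>) * d\<^sup>2 = d powr (1 + \<alpha>) * d powr 2" using d by (simp add: powr_numeral)
        also have "\<dots> = d powr (3 + \<alpha>)" by (simp add: powr_add[symmetric] add.commute)
        finally show ?thesis by simp
      qed simp
      then show ?thesis by (simp add: ec algebra_simps add_divide_distrib)
    qed
    also have "\<dots> \<le> (C / 2 * (h / u) * (u powr (- m) / u)) *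
        ((1 + m) * (E1 * u powr ((1 + \<alpha>) / 2) * exp (- (1/8/2) * d\<^sup>2 / u)) +
         1 / (4 * u) * (E2 * u powr ((3 + \<alpha>) / 2) * exp (- (1/8/2) * d\<^sup>2 / u)))"
      unfolding E1_def E2_def using u h C d \<alpha> m
      by (intro mult_left_mono add_mono powr_mult_exp_le) auto
    also have "u powr ((3 + \<alpha>) / 2) = u * u powr ((1 + \<alpha>) / 2)"
    proof -
      have "(3 + \<alpha>) / 2 = 1 + (1 + \<alpha>) / 2" by (simp add: field_simps)
      then show ?thesis using u by (simp only: powr_add) simp
    qed
    also have "(C / 2 * (h / u) * (u powr (- m) / u)) *
        ((1 + m) * (E1 * u powr ((1 + \<alpha>) / 2) * exp (- (1/8/2) * d\<^sup>2 / u)) +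
         1 / (4 * u) * (E2 * (u * u powr ((1 + \<alpha>) / 2)) * exp (- (1/8/2) * d\<^sup>2 / u)))
       = K * (h / u * (u powr (- m) * u powr ((1 + \<alpha>) / 2) / u)) * exp (- (1/8/2) * d\<^sup>2 / u)"
      using u by (simp add: K_def algebra_simps add_divide_distrib)
    also have "\<dots> = K * (h / u * u powr (\<alpha> / 2 - 1/2 - m)) * exp (- (1/16) * d\<^sup>2 / u)"
      unfolding powr_mult_divide[OF u] by (simp add: add_divide_distrib algebra_simps)
    finally show "\<bar>flux (u + h) x y - flux u x y\<bar>
        \<le> K * (h / u * u powr (\<alpha> / 2 - 1/2 - m)) * exp (- (1/16) * (norm (x - y))\<^sup>2 / u)"
      by (simp add: d_def)
  qed
qed

text \<open>The added term removes the effect of the change of the normal: it is merely linear in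
  \<open>x - y\<close>, without the extra power \<alpha> of flatness, and is treated by cancellation
  later. What remains is the displacement \<open>x - x'\<close> against \<open>\<nu> x'\<close>,
  small by flatness, and the increment of the heat kernel against the flat factor at
  \<open>x'\<close>.\<close>

lemma flux_space_increment: "\<exists>K\<ge>0. \<forall>x\<in>F. \<forall>x'\<in>F. \<forall>y\<in>F. \<forall>u>0. (norm (x - x'))\<^sup>2 \<le> u \<longrightarrow>
    \<bar>flux u x y - flux u x' y + heat_kernel u (x - y) * ((x - y) \<bullet> (\<nu> x - \<nu> x')) / (2 * u)\<bar>
      \<le> K * (norm (x - x') * u powr (\<alpha> / 2 - 1 - m)) *
          (exp (- (1/16) * (norm (x - y))\<^sup>2 / u) + exp (- (1/16) * (norm (x' - y))\<^sup>2 / u))"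
proof -
  define E1 where "E1 = exp ((1 + \<alpha>)\<^sup>2 / (2 * (1/8)))"
  define E2 where "E2 = exp ((2 + \<alpha>)\<^sup>2 / (2 * (1/8)))"
  define K where "K = C / 2 + C / 8 * exp (1/4) * (2 * E2 + E1)"
  show ?thesis
  proof (intro exI[of _ K] conjI ballI allI impI)
    show "K \<ge> 0" using C by (simp add: K_def E1_def E2_def)
    fix x x' y and u :: real
    assume x: "x \<in> F" and x': "x' \<in> F" and y: "y \<in> F" and u: "u > 0" and ru: "(norm (x - x'))\<^sup>2 \<le> u"
    define r where "r = norm (x - x')"
    define d where "d = norm (x - y)"
    define d' where "d' = norm (x' - y)"
    define U where "U = u powr (\<alpha> / 2 - 1 - m)"
    have d: "d \<ge> 0" "d' \<ge> 0" "r \<ge> 0" by (auto simp: d_def d'_def r_def)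
    have rsq: "r \<le> sqrt u" using ru u by (simp add: r_def real_le_rsqrt)
    have r\<alpha>: "r powr \<alpha> \<le> u powr (\<alpha> / 2)"
    proof -
      have "r powr \<alpha> \<le> sqrt u powr \<alpha>" using rsq d \<alpha> by (intro powr_mono2) auto
      also have "\<dots> = u powr (\<alpha> / 2)" using u by (simp add: powr_half_sqrt[symmetric] powr_powr)
      finally show ?thesis .
    qed
    have xx': "\<bar>(x - x') \<bullet> \<nu> x'\<bar> \<le> C * (r * u powr (\<alpha> / 2))"
    proof -
      have "\<bar>(x - x') \<bullet> \<nu> x'\<bar> \<le> C * r powr (1 + \<alpha>)"
        using \<nu>_flat'[OF x' x] by (metis (no_types, lifting) abs_minus_cancel inner_minus_left minus_diff_eq norm_minus_commute r_def)
      also have "r powr (1 + \<alpha>) = r * r powr \<alpha>" using d by (cases "r = 0") (simp_all add: powr_add)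
      also have "C * (r * r powr \<alpha>) \<le> C * (r * u powr (\<alpha> / 2))"
        using C d r\<alpha> by (intro mult_left_mono) auto
      finally show ?thesis .
    qed
    define k where "k z = heat_kernel u (z - y)" for z
    have split: "flux u x y - flux u x' y + k x * ((x - y) \<bullet> (\<nu> x - \<nu> x')) / (2 * u)
        = - (k x * ((x - x') \<bullet> \<nu> x') / (2 * u) + (k x - k x') * ((x' - y) \<bullet> \<nu> x') / (2 * u))"
      using u by (simp add: flux_def k_def inner_diff_left inner_diff_right field_simps)
    have T1: "\<bar>k x * ((x - x') \<bullet> \<nu> x') / (2 * u)\<bar> \<le> C / 2 * (r * U) * exp (- (1/16) * d\<^sup>2 / u)"
    proof -
      have "\<bar>k x * ((x - x') \<bullet> \<nu> x') / (2 * u)\<bar> = k x * \<bar>(x - x') \<bullet> \<nu> x'\<bar> / (2 * u)"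
        using u by (simp add: abs_mult k_def heat_kernel_nonneg)
      also have "\<dots> \<le> (u powr (- m) * exp (- (1/4) * d\<^sup>2 / u)) * (C * (r * u powr (\<alpha> / 2))) / (2 * u)"
        using xx' heat_kernel_le[OF u, of "x - y"] u unfolding k_def d_def
        by (intro divide_right_mono mult_mono) auto
      also have "\<dots> \<le> (u powr (- m) * exp (- (1/16) * d\<^sup>2 / u)) * (C * (r * u powr (\<alpha> / 2))) / (2 * u)"
        using u C d by (intro divide_right_mono mult_right_mono mult_left_mono) (auto intro!: divide_left_mono)
      also have "\<dots> = C / 2 * (r * (u powr (- m) * u powr (\<alpha> / 2) / u)) * exp (- (1/16) * d\<^sup>2 / u)"
        by simp
      also have "u powr (- m) * u powr (\<alpha> / 2) / u = U"
        unfolding powr_mult_divide[OF u] U_def by (simp add: algebra_simps)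
      finally show ?thesis .
    qed
    have T2: "\<bar>(k x - k x') * ((x' - y) \<bullet> \<nu> x') / (2 * u)\<bar>
        \<le> C / 8 * exp (1/4) * (2 * E2 + E1) * (r * U) * exp (- (1/16) * d'\<^sup>2 / u)"
    proof -
      have dd: "d \<le> d' + r" "d' \<le> d + r"
        using norm_triangle_ineq[of "x - x'" "x' - y"] norm_triangle_ineq4[of "x - y" "x - x'"]
        by (auto simp: d_def d'_def r_def)
      \<comment> \<open>Replacing the distance to \<open>x\<close> by that to \<open>x'\<close>
        halves the exponent and, as the squared displacement is at most \<open>u\<close>, costs only
        the additive 1/4.\<close>
      have c2: "d'\<^sup>2 / (8 * u) - 1/4 \<le> d\<^sup>2 / (4 * u)"
      proof -
        have "d'\<^sup>2 \<le> (d + r)\<^sup>2" using dd d by (intro power_mono) auto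
        also have "\<dots> \<le> 2 * d\<^sup>2 + 2 * r\<^sup>2"
          using zero_le_power2[of "d - r"] by (simp add: power2_eq_square algebra_simps)
        also have "\<dots> \<le> 2 * d\<^sup>2 + 2 * u" using ru by (simp add: r_def)
        finally have "d'\<^sup>2 / (8 * u) \<le> (2 * d\<^sup>2 + 2 * u) / (8 * u)" using u by (intro divide_right_mono) auto
        then show ?thesis using u by (simp add: add_divide_distrib)
      qed
      have c1: "d'\<^sup>2 / (8 * u) - 1/4 \<le> d'\<^sup>2 / (4 * u)"
      proof -
        have "d'\<^sup>2 / (8 * u) \<le> d'\<^sup>2 / (4 * u)" using u by (intro divide_left_mono) auto
        then show ?thesis by linarith
      qed
      have keq: "k z = (4 * pi) powr (- m) * u powr (- m) * exp (- ((norm (z - y))\<^sup>2 / (4 * u)))" for z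
        unfolding k_def heat_kernel_eq[OF u] by simp
      have "\<bar>k x - k x'\<bar> = (4 * pi) powr (- m) * (u powr (- m) * \<bar>exp (- (d\<^sup>2 / (4 * u))) - exp (- (d'\<^sup>2 / (4 * u)))\<bar>)"
        by (simp add: keq d_def d'_def abs_mult flip: right_diff_distrib)
      also have "\<dots> \<le> 1 * (u powr (- m) * (\<bar>d\<^sup>2 / (4 * u) - d'\<^sup>2 / (4 * u)\<bar> * exp (- (d'\<^sup>2 / (8 * u) - 1/4))))"
        using four_pi_powr by (intro mult_mono abs_exp_minus_diff_le c1 c2) auto
      also have "\<dots> \<le> 1 * (u powr (- m) * ((r * (2 * d' + sqrt u)) / (4 * u) * exp (- (d'\<^sup>2 / (8 * u) - 1/4))))"
      proof (intro mult_left_mono mult_right_mono)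
        have "\<bar>d\<^sup>2 / (4 * u) - d'\<^sup>2 / (4 * u)\<bar> = \<bar>d\<^sup>2 - d'\<^sup>2\<bar> / (4 * u)"
          using u by (simp add: diff_divide_distrib[symmetric])
        also have "\<dots> \<le> (r * (d + d')) / (4 * u)"
          using norm_square_diff_le[of "x - y" "x' - y"] u by (intro divide_right_mono) (auto simp: d_def d'_def r_def)
        also have "\<dots> \<le> (r * (2 * d' + sqrt u)) / (4 * u)"
          using d dd rsq u by (intro divide_right_mono mult_left_mono) auto
        finally show "\<bar>d\<^sup>2 / (4 * u) - d'\<^sup>2 / (4 * u)\<bar> \<le> (r * (2 * d' + sqrt u)) / (4 * u)" .
      qed auto
      also have "exp (- (d'\<^sup>2 / (8 * u) - 1/4)) = exp (1/4) * exp (- (1/8) * d'\<^sup>2 / u)"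
        by (simp add: exp_add[symmetric])
      finally have kk: "\<bar>k x - k x'\<bar> \<le> u powr (- m) * ((r * (2 * d' + sqrt u)) / (4 * u) * (exp (1/4) * exp (- (1/8) * d'\<^sup>2 / u)))"
        by simp
      have "\<bar>(k x - k x') * ((x' - y) \<bullet> \<nu> x') / (2 * u)\<bar> = \<bar>k x - k x'\<bar> * \<bar>(x' - y) \<bullet> \<nu> x'\<bar> / (2 * u)"
        using u by (simp add: abs_mult)
      also have "\<dots> \<le> (u powr (- m) * ((r * (2 * d' + sqrt u)) / (4 * u) * (exp (1/4) * exp (- (1/8) * d'\<^sup>2 / u)))) * (C * d' powr (1 + \<alpha>)) / (2 * u)"
        using kk \<nu>_flat'[OF x' y] u d C unfolding d'_def
        by (intro divide_right_mono mult_mono) auto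
      also have "\<dots> = (C / 8 * exp (1/4) * r * (u powr (- m) / u) / u) *
          (2 * (d' powr (2 + \<alpha>) * exp (- (1/8) * d'\<^sup>2 / u)) + sqrt u * (d' powr (1 + \<alpha>) * exp (- (1/8) * d'\<^sup>2 / u)))"
      proof -
        have "2 + \<alpha> = 1 + (1 + \<alpha>)" by simp
        then have "d' powr (2 + \<alpha>) = d' * d' powr (1 + \<alpha>)"
          using d by (simp only: powr_add[of d' 1 "1 + \<alpha>"]) simp
        then show ?thesis by (simp add: algebra_simps add_divide_distrib)
      qed
      also have "\<dots> \<le> (C / 8 * exp (1/4) * r * (u powr (- m) / u) / u) *
          (2 * (E2 * u powr ((2 + \<alpha>) / 2) * exp (- (1/8/2) * d'\<^sup>2 / u)) +
           sqrt u * (E1 * u powr ((1 + \<alpha>) / 2) * exp (- (1/8/2) * d'\<^sup>2 / u)))"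
        unfolding E1_def E2_def using u C d \<alpha>
        by (intro mult_left_mono add_mono powr_mult_exp_le) auto
      also have "\<dots> = C / 8 * exp (1/4) * (2 * E2 + E1) * (r * (u powr (- m) * u powr ((2 + \<alpha>) / 2) / u / u)) * exp (- (1/8/2) * d'\<^sup>2 / u)"
      proof -
        have "(2 + \<alpha>) / 2 = 1/2 + (1 + \<alpha>) / 2" by (simp add: field_simps)
        then have "sqrt u * u powr ((1 + \<alpha>) / 2) = u powr ((2 + \<alpha>) / 2)"
          using u by (simp only: powr_add) (simp add: powr_half_sqrt)
        then have "sqrt u * (E1 * u powr ((1 + \<alpha>) / 2) * exp (- (1/8/2) * d'\<^sup>2 / u))
            = E1 * u powr ((2 + \<alpha>) / 2) * exp (- (1/8/2) * d'\<^sup>2 / u)" by simp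
        then show ?thesis by (simp only:) (simp add: algebra_simps add_divide_distrib)
      qed
      also have "u powr (- m) * u powr ((2 + \<alpha>) / 2) / u / u = U"
      proof -
        have "- m + (2 + \<alpha>) / 2 - 1 - 1 = \<alpha> / 2 - 1 - m" by (simp add: field_simps)
        moreover have "u powr b / u = u powr (b - 1)" for b using u by (simp add: powr_diff)
        ultimately show ?thesis unfolding powr_mult_divide[OF u] U_def by (simp only:)
      qed
      finally show ?thesis by simp
    qed
    have e: "0 \<le> r * U * exp t" for t using d by (simp add: U_def)
    have "\<bar>flux u x y - flux u x' y + k x * ((x - y) \<bullet> (\<nu> x - \<nu> x')) / (2 * u)\<bar>
        \<le> C / 2 * (r * U) * exp (- (1/16) * d\<^sup>2 / u) + C / 8 * exp (1/4) * (2 * E2 + E1) * (r * U) * exp (- (1/16) * d'\<^sup>2 / u)"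
      unfolding split using T1 T2 by linarith
    also have "\<dots> \<le> K * (r * U) * exp (- (1/16) * d\<^sup>2 / u) + K * (r * U) * exp (- (1/16) * d'\<^sup>2 / u)"
      using C d by (intro add_mono mult_right_mono) (auto simp: K_def U_def E1_def E2_def)
    finally show "\<bar>flux u x y - flux u x' y + heat_kernel u (x - y) * ((x - y) \<bullet> (\<nu> x - \<nu> x')) / (2 * u)\<bar>
      \<le> K * (norm (x - x') * u powr (\<alpha> / 2 - 1 - m)) *
          (exp (- (1/16) * (norm (x - y))\<^sup>2 / u) + exp (- (1/16) * (norm (x' - y))\<^sup>2 / u))"
      by (simp add: k_def r_def d_def d'_def U_def distrib_left)
  qed
qed

text \<open>The almost odd kernel gains the factor \<open>u powr (\<alpha> / 4)\<close> over its absolute moment; the gain comes from the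
  reflection at scale \<open>\<rho> = u powr (1 / 4)\<close>, outside of which the kernel is negligible.  This removes the
  logarithm that would otherwise appear in the spatial Hoelder estimate.\<close>
lemma gaussian_first_moment_small:
  assumes "T > 0"
  shows "\<exists>K\<ge>0. \<forall>x\<in>F. \<forall>a. \<forall>u\<in>{0<..T}.
    \<bar>\<integral>y. exp (- (1/4) * (norm (x - y))\<^sup>2 / u) * ((x - y) \<bullet> a) \<partial>\<sigma>\<bar> \<le> K * norm a * u powr (m + \<alpha> / 4)"
proof -
  define s where "s = real DIM('a) - 1"
  have s: "s \<ge> 0" using dim by (simp add: s_def)
  define E1 where "E1 = exp (1\<^sup>2 / (2 * (1/4)) :: real)"
  define E2 where "E2 = exp (2\<^sup>2 / (2 * (1/4)) :: real)"
  define E3 where "E3 = exp (1\<^sup>2 / (2 * (1/16)) :: real)"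
  define E4 where "E4 = exp (3\<^sup>2 / (2 * (1/16)) :: real)"
  have Epos: "E1 \<ge> 0" "E2 \<ge> 0" "E3 \<ge> 0" "E4 \<ge> 0" by (auto simp: E1_def E2_def E3_def E4_def)
  define G1 where "G1 = gauss_const (1/8)"
  define G2 where "G2 = gauss_const (1/32)"
  have Gpos: "G1 \<ge> 0" "G2 \<ge> 0" by (auto simp: G1_def G2_def intro!: gauss_const)
  \<comment> \<open>Up to this radius reflections exist and their defect stays below 1/2, as
    \<open>gaussian_reflection_sum_le\<close> demands.\<close>
  obtain \<rho>1 where \<rho>1: "\<rho>1 > 0" "\<rho>1 \<le> \<rho>0" "C * \<rho>1 powr \<alpha> \<le> 1/2"
  proof
    define t where "t = (1 / (2 * (C + 1))) powr (1 / \<alpha>)"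
    have t: "t > 0" using C by (simp add: t_def)
    show "min t \<rho>0 > 0" "min t \<rho>0 \<le> \<rho>0" using t \<rho>0 by auto
    have "(min t \<rho>0) powr \<alpha> \<le> t powr \<alpha>" using t \<rho>0 \<alpha> by (intro powr_mono2) auto
    also have "\<dots> = 1 / (2 * (C + 1))" using C \<alpha> by (simp add: t_def powr_powr)
    finally have "C * (min t \<rho>0) powr \<alpha> \<le> C * (1 / (2 * (C + 1)))" using C by (intro mult_left_mono) auto
    also have "\<dots> \<le> 1/2" using C by (simp add: field_simps)
    finally show "C * (min t \<rho>0) powr \<alpha> \<le> 1/2" .
  qed
  define u0 where "u0 = \<rho>1 ^ 4"
  have u0: "u0 > 0" using \<rho>1 by (simp add: u0_def)
  define K1 where "K1 = E1 * G1 * u0 powr (- \<alpha> / 4)"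
  define K2 where "K2 = E2 * G1 * T powr ((1 - \<alpha>) / 4) + exp (s / 2) * s * C * (E1 * G1) + C * (E3 + E4) * G2"
  have Kpos: "K1 \<ge> 0" "K2 \<ge> 0" using Epos Gpos C s by (auto simp: K1_def K2_def)
  show ?thesis
  proof (intro exI[of _ "K1 + K2"] conjI ballI allI)
    show "K1 + K2 \<ge> 0" using Kpos by simp
    fix x a and u :: real assume x: "x \<in> F" and "u \<in> {0<..T}"
    then have u: "u > 0" "u \<le> T" by auto
    define f where "f y = exp (- (1/4) * (norm (x - y))\<^sup>2 / u) * ((x - y) \<bullet> a)" for y
    define na where "na = norm a"
    have na: "na \<ge> 0" by (simp add: na_def)
    have f_cont: "continuous_on F f"
      unfolding f_def using u by (auto intro!: continuous_intros)
    note f_meas = measurable_\<sigma>_continuous[OF f_cont]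
    have f_le: "\<bar>f y\<bar> \<le> na * (norm (x - y) * exp (- (1/4) * (norm (x - y))\<^sup>2 / u))" for y
      using Cauchy_Schwarz_ineq2[of "x - y" a] by (simp add: f_def abs_mult na_def mult_ac mult_left_mono)
    have f1: "\<bar>f y\<bar> \<le> na * E1 * u powr (1/2) * exp (- (1/8) * (norm (x - y))\<^sup>2 / u)" for y
    proof -
      have "norm (x - y) powr 1 * exp (- (1/4) * (norm (x - y))\<^sup>2 / u)
          \<le> E1 * u powr (1/2) * exp (- (1/4/2) * (norm (x - y))\<^sup>2 / u)"
        unfolding E1_def using u by (intro powr_mult_exp_le) auto
      then have "na * (norm (x - y) * exp (- (1/4) * (norm (x - y))\<^sup>2 / u))
          \<le> na * (E1 * u powr (1/2) * exp (- (1/8) * (norm (x - y))\<^sup>2 / u))"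
        using na by (intro mult_left_mono) auto
      then show ?thesis using f_le[of y] by (simp add: mult_ac)
    qed
    have Q1: "0 \<le> na * E1 * u powr (1/2)" using na Epos by simp
    note fd = gauss_dominated[OF _ x u(1) Q1 f_meas f1, simplified, folded G1_def]
    have mm: "u powr (1/2) * u powr (m - 1/2) = u powr m" by (simp add: powr_add[symmetric])
    have triv: "(\<integral>y. \<bar>f y\<bar> \<partial>\<sigma>) \<le> na * (E1 * G1) * u powr m"
      using fd(2) by (simp add: mm[symmetric] mult_ac)
    show "\<bar>\<integral>y. exp (- (1/4) * (norm (x - y))\<^sup>2 / u) * ((x - y) \<bullet> a) \<partial>\<sigma>\<bar> \<le> (K1 + K2) * norm a * u powr (m + \<alpha> / 4)"
    proof (cases "u \<ge> u0")
      case True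
      \<comment> \<open>For times bounded away from 0 the absolute moment is enough, since
        \<open>u powr (\<alpha> / 4)\<close> is bounded below.\<close>
      have "1 \<le> u0 powr (- \<alpha> / 4) * u powr (\<alpha> / 4)"
        using powr_mono2[of "\<alpha> / 4" u0 u] True u0 \<alpha> by (simp add: powr_minus field_simps)
      then have "na * (E1 * G1) * u powr m * 1 \<le> na * (E1 * G1) * u powr m * (u0 powr (- \<alpha> / 4) * u powr (\<alpha> / 4))"
        using na Epos Gpos by (intro mult_left_mono) auto
      also have "\<dots> = K1 * na * u powr (m + \<alpha> / 4)" by (simp add: K1_def powr_add mult_ac)
      also have "\<dots> \<le> (K1 + K2) * na * u powr (m + \<alpha> / 4)"
        using Kpos na by (intro mult_right_mono) auto
      finally have "\<bar>\<integral>y. f y \<partial>\<sigma>\<bar> \<le> (K1 + K2) * na * u powr (m + \<alpha> / 4)"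
        using integral_abs_bound[of \<sigma> f] triv by linarith
      then show ?thesis by (simp add: f_def na_def)
    next
      case False
      \<comment> \<open>Inside the ball the reflection gains \<open>\<rho> powr \<alpha>\<close>;
        outside it the Gaussian gains \<open>sqrt u / \<rho>\<close>. A radius between
        \<open>sqrt u\<close> and 1 makes both gains positive powers of \<open>u\<close>, here
        \<open>\<alpha> / 4\<close> and 1/4.\<close>
      define \<rho> where "\<rho> = u powr (1/4)"
      have \<rho>: "\<rho> > 0" using u by (simp add: \<rho>_def)
      have "\<rho> \<le> u0 powr (1/4)" unfolding \<rho>_def using False u by (intro powr_mono2) auto
      also have "\<dots> = \<rho>1"
      proof -
        have "u0 = \<rho>1 powr 4" using \<rho>1 by (simp add: u0_def powr_numeral)
        then have "u0 powr (1/4) = (\<rho>1 powr 4) powr (1/4)" by (simp only:)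
        also have "\<dots> = \<rho>1" using \<rho>1 unfolding powr_powr by simp
        finally show ?thesis .
      qed
      finally have \<rho>le: "\<rho> \<le> \<rho>1" .
      define \<epsilon> where "\<epsilon> = C * \<rho> powr \<alpha>"
      have "C * \<rho> powr \<alpha> \<le> C * \<rho>1 powr \<alpha>" using \<rho> \<rho>le \<alpha> C by (intro mult_left_mono powr_mono2) auto
      then have \<epsilon>: "\<epsilon> \<ge> 0" "\<epsilon> \<le> 1/2" using C \<rho>1 by (auto simp: \<epsilon>_def)
      have \<epsilon>u: "\<epsilon> = C * u powr (\<alpha> / 4)" using u by (simp add: \<epsilon>_def \<rho>_def powr_powr)
      obtain U R where UR: "near_reflection F x \<rho> \<epsilon> U R"
        using reflection[OF x \<rho>] \<rho>le \<rho>1(2) unfolding \<epsilon>_def by force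
      have U: "U \<in> sets \<sigma>" "U \<subseteq> F" "x \<in> U" "R x = x" "F \<inter> ball x \<rho> \<subseteq> U"
        using UR by (auto simp: near_reflection_def sets_\<sigma>)
      define E where "E y = na * (\<epsilon> * (norm (x - y) + (norm (x - y)) ^ 3 / u)) * exp (- (1/16) * (norm (x - y))\<^sup>2 / u)" for y
      have E_nn: "E y \<ge> 0" for y using na \<epsilon> u by (simp add: E_def)
      have E_meas: "E \<in> borel_measurable \<sigma>"
        unfolding E_def by (rule measurable_\<sigma>_continuous) (use u in \<open>auto intro!: continuous_intros\<close>)
      have E_le: "\<bar>E y\<bar> \<le> (na * \<epsilon> * ((E3 + E4) * u powr (1/2))) * exp (- (1/32) * (norm (x - y))\<^sup>2 / u)" for y
      proof -
        define d where "d = norm (x - y)"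
        have d: "d \<ge> 0" by (simp add: d_def)
        have 1: "d powr 1 * exp (- (1/16) * d\<^sup>2 / u) \<le> E3 * u powr (1/2) * exp (- (1/16/2) * d\<^sup>2 / u)"
          unfolding E3_def using u d by (intro powr_mult_exp_le) auto
        have "d powr 3 * exp (- (1/16) * d\<^sup>2 / u) \<le> E4 * u powr (3/2) * exp (- (1/16/2) * d\<^sup>2 / u)"
          unfolding E4_def using u d by (intro powr_mult_exp_le) auto
        then have "d powr 3 * exp (- (1/16) * d\<^sup>2 / u) / u \<le> E4 * u powr (3/2) * exp (- (1/16/2) * d\<^sup>2 / u) / u"
          using u by (intro divide_right_mono) auto
        also have "u powr (3/2) = u powr (1/2) * u" using u powr_add[of u "1/2" 1] by simp
        finally have 3: "d powr 3 * exp (- (1/16) * d\<^sup>2 / u) / u \<le> E4 * u powr (1/2) * exp (- (1/32) * d\<^sup>2 / u)"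
          using u by simp
        have d3: "d powr 3 = d ^ 3" using d by (cases "d = 0") (auto simp: powr_numeral)
        have "\<bar>E y\<bar> = na * \<epsilon> * (d powr 1 * exp (- (1/16) * d\<^sup>2 / u) + d powr 3 * exp (- (1/16) * d\<^sup>2 / u) / u)"
          using E_nn[of y] d by (simp add: E_def d_def[symmetric] d3 algebra_simps)
        also have "\<dots> \<le> na * \<epsilon> * (E3 * u powr (1/2) * exp (- (1/16/2) * d\<^sup>2 / u) + E4 * u powr (1/2) * exp (- (1/32) * d\<^sup>2 / u))"
          using na \<epsilon> 1 3 by (intro mult_left_mono add_mono) auto
        finally show ?thesis by (simp add: d_def algebra_simps)
      qed
      have Q2: "0 \<le> na * \<epsilon> * ((E3 + E4) * u powr (1/2))" using na \<epsilon> Epos by simp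
      note Ed = gauss_dominated[OF _ x u(1) Q2 E_meas E_le, simplified, folded G2_def]
      have f_odd: "\<bar>f y + f (R y)\<bar> \<le> E y" if y: "y \<in> U" for y
      proof -
        have "norm ((R y - R x) + (y - x)) \<le> \<epsilon> * norm (y - x)"
          using UR y U(3) unfolding near_reflection_def by blast
        then show ?thesis
          using gaussian_reflection_sum_le[OF u(1) \<epsilon>, of "R y" x y a] U(4)
          by (simp add: f_def E_def na_def)
      qed
      have I1: "\<bar>\<integral>y. f y * indicator U y \<partial>\<sigma>\<bar> \<le> ((1 + \<epsilon>) powr s - 1) * (\<integral>y. \<bar>f y\<bar> * indicator U y \<partial>\<sigma>)
            + (\<integral>y. E y * indicator U y \<partial>\<sigma>)"
        by (rule near_reflection_integral[OF UR \<epsilon>(1) sets_\<sigma> _ fd(1) Ed(1) f_odd s])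
           (use quasi_invariant in \<open>auto simp: s_def\<close>)
      have ind: "(\<integral>y. g y * indicator V y \<partial>\<sigma>) \<le> (\<integral>y. g y \<partial>\<sigma>)"
        if "integrable \<sigma> g" "\<And>y. g y \<ge> 0" "V \<in> sets \<sigma>" for g :: "'a \<Rightarrow> real" and V
      proof (rule integral_mono)
        show "integrable \<sigma> (\<lambda>y. g y * indicator V y)"
          using integrable_mult_indicator[OF that(3,1)] by (simp add: mult.commute)
        show "g y * indicator V y \<le> g y" for y using that(2)[of y] by (simp add: indicator_def)
      qed (use that in auto)
      \<comment> \<open>The loss from the Lipschitz constant is of first order in \<epsilon>;
        \<open>\<epsilon> \<le> 1/2\<close> bounds the remaining exponential by
        \<open>exp (s / 2)\<close>.\<close>
      have k1: "(1 + \<epsilon>) powr s - 1 \<le> exp (s / 2) * s * \<epsilon>" "(1 + \<epsilon>) powr s - 1 \<ge> 0"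
      proof -
        have "ln (1 + \<epsilon>) \<le> \<epsilon>" using \<epsilon> by (intro ln_add_one_self_le_self) auto
        then have "(1 + \<epsilon>) powr s \<le> exp (s * \<epsilon>)"
          using \<epsilon> s by (simp add: powr_def mult_left_mono)
        moreover have "exp (s * \<epsilon>) - 1 \<le> exp (s * \<epsilon>) * (s * \<epsilon>)"
        proof -
          have "1 + (- (s * \<epsilon>)) \<le> exp (- (s * \<epsilon>))" by (rule exp_ge_add_one_self)
          then have "exp (s * \<epsilon>) * (1 + (- (s * \<epsilon>))) \<le> exp (s * \<epsilon>) * exp (- (s * \<epsilon>))" by (intro mult_left_mono) auto
          then show ?thesis by (simp add: algebra_simps flip: exp_add)
        qed
        moreover have "exp (s * \<epsilon>) * (s * \<epsilon>) \<le> exp (s / 2) * (s * \<epsilon>)"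
        proof (rule mult_right_mono)
          have "s * \<epsilon> \<le> s * (1/2)" using s \<epsilon> by (intro mult_left_mono) auto
          then show "exp (s * \<epsilon>) \<le> exp (s / 2)" by simp
        qed (use s \<epsilon> in auto)
        ultimately show "(1 + \<epsilon>) powr s - 1 \<le> exp (s / 2) * s * \<epsilon>" by simp
        show "(1 + \<epsilon>) powr s - 1 \<ge> 0" using \<epsilon> s by (simp add: ge_one_powr_ge_zero)
      qed
      have I2: "((1 + \<epsilon>) powr s - 1) * (\<integral>y. \<bar>f y\<bar> * indicator U y \<partial>\<sigma>) \<le> exp (s / 2) * s * \<epsilon> * (na * (E1 * G1) * u powr m)"
      proof (rule mult_mono)
        show "(\<integral>y. \<bar>f y\<bar> * indicator U y \<partial>\<sigma>) \<le> na * (E1 * G1) * u powr m"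
          using ind[of "\<lambda>y. \<bar>f y\<bar>" U] fd(1) U triv by fastforce
      qed (use k1 s \<epsilon> in auto)
      have I3: "(\<integral>y. E y * indicator U y \<partial>\<sigma>) \<le> na * \<epsilon> * ((E3 + E4) * G2) * u powr m"
      proof -
        have "(\<integral>y. E y * indicator U y \<partial>\<sigma>) \<le> (\<integral>y. E y \<partial>\<sigma>)" using E_nn Ed(1) U by (intro ind) auto
        also have "\<dots> \<le> na * \<epsilon> * ((E3 + E4) * u powr (1/2)) * G2 * u powr (m - 1/2)" using Ed(3) by linarith
        also have "\<dots> = na * \<epsilon> * ((E3 + E4) * G2) * (u powr (1/2) * u powr (m - 1/2))" by (simp add: mult_ac)
        finally show ?thesis unfolding mm .
      qed
      have I4: "\<bar>\<integral>y. f y * indicator (F - U) y \<partial>\<sigma>\<bar> \<le> na * E2 * G1 * (u powr (m + 1/4))"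
      proof -
        have FU: "F - U \<in> sets \<sigma>" using U(1) borel_F by (auto simp: sets_\<sigma>)
        have meas: "(\<lambda>y. f y * indicator (F - U) y) \<in> borel_measurable \<sigma>"
          using f_meas FU by (intro borel_measurable_times borel_measurable_indicator)
        have "\<bar>f y * indicator (F - U) y\<bar> \<le> (na * E2 * u powr (3/4)) * exp (- (1/8) * (norm (x - y))\<^sup>2 / u)" if y: "y \<in> F" for y
        proof (cases "y \<in> U")
          case True
          then show ?thesis using na Epos by simp
        next
          case False
          define d where "d = norm (x - y)"
          have "d \<ge> \<rho>" using False U(5) y by (force simp: d_def dist_norm)
          \<comment> \<open>Inserting the factor \<open>d / \<rho> \<ge> 1\<close> raises the moment
            from first to second order, which is worth another \<open>sqrt u\<close>.\<close>
          then have "d \<le> d * d / \<rho>" using \<rho> by (simp add: field_simps mult_left_mono)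
          also have "d * d = d powr 2" using \<rho> \<open>d \<ge> \<rho>\<close> by (simp add: powr_numeral power2_eq_square)
          finally have "d * exp (- (1/4) * d\<^sup>2 / u) \<le> d powr 2 / \<rho> * exp (- (1/4) * d\<^sup>2 / u)"
            by (rule mult_right_mono) simp
          also have "\<dots> = (d powr 2 * exp (- (1/4) * d\<^sup>2 / u)) / \<rho>" by simp
          also have "\<dots> \<le> (E2 * u powr (2/2) * exp (- (1/4/2) * d\<^sup>2 / u)) / \<rho>"
            unfolding E2_def using u \<rho> by (intro divide_right_mono powr_mult_exp_le) (auto simp: d_def)
          also have "\<dots> = E2 * (u powr 1 / u powr (1/4)) * exp (- (1/8) * d\<^sup>2 / u)" by (simp add: \<rho>_def)
          also have "u powr 1 / u powr (1/4) = u powr (3/4)" using u by (simp only: powr_diff[symmetric]) simp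
          finally have "na * (d * exp (- (1/4) * d\<^sup>2 / u)) \<le> na * (E2 * u powr (3/4) * exp (- (1/8) * d\<^sup>2 / u))"
            using na by (rule mult_left_mono)
          then show ?thesis using f_le[of y] False y by (simp add: d_def mult_ac)
        qed
        then have "\<bar>\<integral>y. f y * indicator (F - U) y \<partial>\<sigma>\<bar> \<le> na * E2 * u powr (3/4) * G1 * u powr (m - 1/2)"
          unfolding G1_def using na Epos by (intro gauss_dominated(3)[OF _ x u(1) _ meas]) auto
        also have "\<dots> = na * E2 * G1 * (u powr (3/4) * u powr (m - 1/2))" by (simp add: mult_ac)
        also have "u powr (3/4) * u powr (m - 1/2) = u powr (m + 1/4)" by (simp add: powr_add[symmetric] add.commute)
        finally show ?thesis .
      qed
      have u14: "u powr (m + 1/4) \<le> T powr ((1 - \<alpha>) / 4) * u powr (m + \<alpha> / 4)"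
      proof -
        have "u powr (m + 1/4) = u powr ((1 - \<alpha>) / 4) * u powr (m + \<alpha> / 4)"
        proof -
          have "m + 1/4 = (1 - \<alpha>) / 4 + (m + \<alpha> / 4)" by (simp add: field_simps)
          then show ?thesis by (simp only: powr_add)
        qed
        also have "\<dots> \<le> T powr ((1 - \<alpha>) / 4) * u powr (m + \<alpha> / 4)"
          using u \<alpha> by (intro mult_right_mono powr_mono2) auto
        finally show ?thesis .
      qed
      have "(\<integral>y. f y \<partial>\<sigma>) = (\<integral>y. f y * indicator U y + f y * indicator (F - U) y \<partial>\<sigma>)"
        by (rule Bochner_Integration.integral_cong) (auto simp: indicator_def)
      also have "\<dots> = (\<integral>y. f y * indicator U y \<partial>\<sigma>) + (\<integral>y. f y * indicator (F - U) y \<partial>\<sigma>)"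
      proof (rule Bochner_Integration.integral_add)
        have FU: "F - U \<in> sets \<sigma>" using U(1) borel_F by (auto simp: sets_\<sigma>)
        show "integrable \<sigma> (\<lambda>y. f y * indicator U y)" "integrable \<sigma> (\<lambda>y. f y * indicator (F - U) y)"
          using integrable_mult_indicator[OF U(1) fd(1)] integrable_mult_indicator[OF FU fd(1)]
          by (simp_all add: mult.commute)
      qed
      also have "\<bar>\<dots>\<bar> \<le> exp (s / 2) * s * \<epsilon> * (na * (E1 * G1) * u powr m) + na * \<epsilon> * ((E3 + E4) * G2) * u powr m
          + na * E2 * G1 * (T powr ((1 - \<alpha>) / 4) * u powr (m + \<alpha> / 4))"
      proof -
        have "na * E2 * G1 * (u powr (m + 1/4)) \<le> na * E2 * G1 * (T powr ((1 - \<alpha>) / 4) * u powr (m + \<alpha> / 4))"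
          using u14 na Epos Gpos by (intro mult_left_mono) auto
        then show ?thesis using I1 I2 I3 I4 by linarith
      qed
      also have "\<dots> = K2 * na * u powr (m + \<alpha> / 4)"
        by (simp add: K2_def \<epsilon>u powr_add algebra_simps)
      also have "\<dots> \<le> (K1 + K2) * na * u powr (m + \<alpha> / 4)"
        using Kpos na by (intro mult_right_mono) auto
      finally show ?thesis by (simp add: f_def na_def)
    qed
  qed
qed

end

section \<open>Mapping properties of the potential\<close>

locale heat_density = heat_surface F \<sigma> \<nu> \<alpha> C A \<rho>0
  for F :: "'a::euclidean_space set" and \<sigma> \<nu> \<alpha> C A \<rho>0 +
  fixes \<mu> :: "real \<Rightarrow> 'a \<Rightarrow> real" and T M :: real
  assumes T: "T > 0" and \<mu>_cont: "continuous_on ({0..T} \<times> F) (\<lambda>(t, x). \<mu> t x)"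
    and M: "M \<ge> 0" and \<mu>_le: "\<And>t x. t \<in> {0..T} \<Longrightarrow> x \<in> F \<Longrightarrow> \<bar>\<mu> t x\<bar> \<le> M"
begin

text \<open>The age \<open>v\<close> of the kernel and the time \<tau> of the density are separate
  arguments, because increments of the potential are estimated with the density frozen.\<close>

definition J :: "real \<Rightarrow> real \<Rightarrow> 'a \<Rightarrow> real" where
  "J v \<tau> x = (\<integral>y. flux v x y * \<mu> \<tau> y \<partial>\<sigma>)"

definition W :: "real \<Rightarrow> 'a \<Rightarrow> real" where
  "W t x = (\<integral>\<tau>. indicator {0..t} \<tau> * J (t - \<tau>) \<tau> x \<partial>lborel)"

lemma \<mu>_measurable:
  assumes "\<tau> \<in> {0..T}"
  shows "\<mu> \<tau> \<in> borel_measurable \<sigma>"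
proof (rule measurable_\<sigma>_continuous)
  have c: "continuous_on F (\<lambda>y. (\<tau>, y))" by (intro continuous_intros)
  have s: "(\<lambda>y. (\<tau>, y)) ` F \<subseteq> {0..T} \<times> F" using assms by auto
  show "continuous_on F (\<mu> \<tau>)"
    using continuous_on_compose2[OF \<mu>_cont c s] by simp
qed

text \<open>Measurability of an integral with a parameter requires an integrand that is jointly
  measurable in \<tau> and \<open>y\<close>. The density is continuous on
  \<open>{0..T} \<times> F\<close> only and becomes a Borel function after cutting off with the
  indicator of that closed set.\<close>

lemma J_measurable:
  assumes t: "t \<in> {0..T}" and x: "x \<in> F"
  shows "(\<lambda>\<tau>. indicator {0..t} \<tau> * J (t - \<tau>) \<tau> x) \<in> borel_measurable lborel"
proof -
  have id: "(\<lambda>y. y) \<in> measurable \<sigma> borel" by (intro measurable_\<sigma>_continuous continuous_on_id)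
  have pair: "(\<lambda>p. (fst p, snd p)) \<in> measurable (lborel \<Otimes>\<^sub>M \<sigma>) (borel \<Otimes>\<^sub>M borel)"
    using measurable_compose[OF measurable_snd id] by (intro measurable_Pair) auto
  have 1: "(\<lambda>p. flux (t - fst p) x (snd p)) \<in> borel_measurable (borel \<Otimes>\<^sub>M borel)"
    unfolding flux_def heat_kernel_def by measurable
  have cl: "{0..T} \<times> F \<in> sets borel"
    using compact_imp_closed[OF compact_F] by (intro borel_closed closed_Times) auto
  have 2: "(\<lambda>p. indicator ({0..T} \<times> F) p * \<mu> (fst p) (snd p)) \<in> borel_measurable (borel \<Otimes>\<^sub>M borel)"
    using borel_measurable_continuous_on_indicator[OF cl \<mu>_cont]
    by (simp add: borel_prod case_prod_beta')
  define g where "g p = indicator {0..t} (fst p) * (flux (t - fst p) x (snd p) * (indicator ({0..T} \<times> F) p * \<mu> (fst p) (snd p)))" for p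
  have "g \<in> borel_measurable (borel \<Otimes>\<^sub>M borel)"
    unfolding g_def using 1 2 by measurable
  then have "(\<lambda>p. g (fst p, snd p)) \<in> borel_measurable (lborel \<Otimes>\<^sub>M \<sigma>)"
    by (rule measurable_compose[OF pair])
  then have gm: "(\<lambda>(\<tau>, y). g (\<tau>, y)) \<in> borel_measurable (lborel \<Otimes>\<^sub>M \<sigma>)"
    by (simp add: case_prod_beta')
  have "(\<lambda>\<tau>. \<integral>y. g (\<tau>, y) \<partial>\<sigma>) \<in> borel_measurable lborel"
    by (rule borel_measurable_lebesgue_integral[OF gm])
  moreover have "(\<integral>y. g (\<tau>, y) \<partial>\<sigma>) = indicator {0..t} \<tau> * J (t - \<tau>) \<tau> x" for \<tau>
  proof (cases "\<tau> \<in> {0..t}")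
    case True
    then have "(\<integral>y. g (\<tau>, y) \<partial>\<sigma>) = (\<integral>y. flux (t - \<tau>) x y * \<mu> \<tau> y \<partial>\<sigma>)"
      using t by (intro Bochner_Integration.integral_cong) (auto simp: g_def)
    then show ?thesis using True by (simp add: J_def)
  qed (simp add: g_def)
  ultimately show ?thesis by simp
qed

lemma J_nonpos: "v \<le> 0 \<Longrightarrow> J v \<tau> x = 0"
  by (simp add: J_def flux_def heat_kernel_def)

lemma J_bound: "\<exists>K\<ge>0. \<forall>x\<in>F. \<forall>v>0. \<forall>\<tau>\<in>{0..T}.
    integrable \<sigma> (\<lambda>y. flux v x y * \<mu> \<tau> y) \<and> \<bar>J v \<tau> x\<bar> \<le> K * v powr (\<alpha> / 2 - 1)"
proof -
  obtain K where K: "K \<ge> 0" "\<And>x y u. x \<in> F \<Longrightarrow> y \<in> F \<Longrightarrow> u > 0 \<Longrightarrow>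
      \<bar>flux u x y\<bar> \<le> K * u powr (\<alpha> / 2 - 1/2 - m) * exp (- (1/8) * (norm (x - y))\<^sup>2 / u)"
    using flux_bound by blast
  show ?thesis
  proof (intro exI[of _ "K * M * gauss_const (1/8)"] conjI ballI allI impI)
    show "0 \<le> K * M * gauss_const (1/8)" using K M by (simp add: gauss_const)
    fix x \<tau> and v :: real assume x: "x \<in> F" and v: "v > 0" and \<tau>: "\<tau> \<in> {0..T}"
    have meas: "(\<lambda>y. flux v x y * \<mu> \<tau> y) \<in> borel_measurable \<sigma>"
      using measurable_flux \<mu>_measurable[OF \<tau>] by (intro borel_measurable_times)
    have Q: "0 \<le> K * M * v powr (\<alpha> / 2 - 1/2 - m)" using K M by simp
    have le: "\<bar>flux v x y * \<mu> \<tau> y\<bar> \<le> K * M * v powr (\<alpha> / 2 - 1/2 - m) * exp (- (1/8) * (norm (x - y))\<^sup>2 / v)" if y: "y \<in> F" for y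
    proof -
      have "\<bar>flux v x y\<bar> * \<bar>\<mu> \<tau> y\<bar> \<le> (K * v powr (\<alpha> / 2 - 1/2 - m) * exp (- (1/8) * (norm (x - y))\<^sup>2 / v)) * M"
        using K x y v \<mu>_le[OF \<tau> y] by (intro mult_mono) auto
      then show ?thesis by (simp add: abs_mult mult_ac)
    qed
    note d = gauss_dominated[OF _ x v Q meas le]
    show "integrable \<sigma> (\<lambda>y. flux v x y * \<mu> \<tau> y)" using d(1) by simp
    have "v powr (\<alpha> / 2 - 1/2 - m) * v powr (m - 1/2) = v powr (\<alpha> / 2 - 1)" by (simp add: powr_add[symmetric])
    then show "\<bar>J v \<tau> x\<bar> \<le> K * M * gauss_const (1/8) * v powr (\<alpha> / 2 - 1)"
      using d(3) by (simp add: J_def mult_ac)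
  qed
qed

lemma J_time_increment: "\<exists>K\<ge>0. \<forall>x\<in>F. \<forall>v>0. \<forall>h\<in>{0..v}. \<forall>\<tau>\<in>{0..T}.
    \<bar>J (v + h) \<tau> x - J v \<tau> x\<bar> \<le> K * (h * v powr (\<alpha> / 2 - 2))"
proof -
  obtain K where K: "K \<ge> 0" "\<And>x y u h. x \<in> F \<Longrightarrow> y \<in> F \<Longrightarrow> u > 0 \<Longrightarrow> h \<in> {0..u} \<Longrightarrow>
      \<bar>flux (u + h) x y - flux u x y\<bar> \<le> K * (h / u * u powr (\<alpha> / 2 - 1/2 - m)) * exp (- (1/16) * (norm (x - y))\<^sup>2 / u)"
    using flux_time_increment by blast
  show ?thesis
  proof (intro exI[of _ "K * M * gauss_const (1/16)"] conjI ballI allI impI)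
    show "0 \<le> K * M * gauss_const (1/16)" using K M by (simp add: gauss_const)
    fix x \<tau> h and v :: real assume x: "x \<in> F" and v: "v > 0" and h: "h \<in> {0..v}" and \<tau>: "\<tau> \<in> {0..T}"
    define f where "f y = (flux (v + h) x y - flux v x y) * \<mu> \<tau> y" for y
    have meas: "f \<in> borel_measurable \<sigma>"
      unfolding f_def using measurable_flux \<mu>_measurable[OF \<tau>] by (intro borel_measurable_times borel_measurable_diff)
    have Q: "0 \<le> K * M * (h / v * v powr (\<alpha> / 2 - 1/2 - m))" using K M h v by simp
    have le: "\<bar>f y\<bar> \<le> K * M * (h / v * v powr (\<alpha> / 2 - 1/2 - m)) * exp (- (1/16) * (norm (x - y))\<^sup>2 / v)" if y: "y \<in> F" for y
    proof -
      have "\<bar>flux (v + h) x y - flux v x y\<bar> * \<bar>\<mu> \<tau> y\<bar>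
          \<le> (K * (h / v * v powr (\<alpha> / 2 - 1/2 - m)) * exp (- (1/16) * (norm (x - y))\<^sup>2 / v)) * M"
        using K(1) K(2)[OF x y v h] \<mu>_le[OF \<tau> y] h v by (intro mult_mono) auto
      then show ?thesis by (simp add: f_def abs_mult mult_ac)
    qed
    note d = gauss_dominated[OF _ x v Q meas le]
    have "J (v + h) \<tau> x - J v \<tau> x = (\<integral>y. f y \<partial>\<sigma>)"
      using J_bound x v h \<tau> unfolding J_def f_def left_diff_distrib
      by (subst Bochner_Integration.integral_diff) (auto simp: add_pos_nonneg)
    moreover have eq: "v powr (\<alpha> / 2 - 1/2 - m) * v powr (m - 1/2) / v = v powr (\<alpha> / 2 - 2)"
      unfolding powr_mult_divide[OF v] by simp
    have "K * M * (h / v * v powr (\<alpha> / 2 - 1/2 - m)) * gauss_const (1/16) * v powr (m - 1/2)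
        = K * M * gauss_const (1/16) * (h * (v powr (\<alpha> / 2 - 1/2 - m) * v powr (m - 1/2) / v))"
      by simp
    then have "K * M * (h / v * v powr (\<alpha> / 2 - 1/2 - m)) * gauss_const (1/16) * v powr (m - 1/2)
        = K * M * gauss_const (1/16) * (h * v powr (\<alpha> / 2 - 2))"
      unfolding eq .
    ultimately show "\<bar>J (v + h) \<tau> x - J v \<tau> x\<bar> \<le> K * M * gauss_const (1/16) * (h * v powr (\<alpha> / 2 - 2))"
      using d(3) by simp
  qed
qed

text \<open>The increment has three parts: \<open>f1\<close>, the kernel increment freed from the
  change of the normal; \<open>f2\<close>, the normal term \<open>D\<close> against
  \<open>\<mu> \<tau> y - \<mu> \<tau> x\<close>, where the Hoelder bound supplies decay; and
  \<open>D\<close> against the constant \<open>\<mu> \<tau> x\<close>, a first moment that is small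
  by symmetry.\<close>

lemma J_space_increment:
  assumes \<beta>: "0 \<le> \<beta>" "\<beta> \<le> \<alpha> / 2" and H: "H \<ge> 0"
    and \<mu>H: "\<And>\<tau> y z. \<tau> \<in> {0..T} \<Longrightarrow> y \<in> F \<Longrightarrow> z \<in> F \<Longrightarrow> \<bar>\<mu> \<tau> y - \<mu> \<tau> z\<bar> \<le> H * norm (y - z) powr \<beta>"
  shows "\<exists>K\<ge>0. \<forall>x\<in>F. \<forall>x'\<in>F. \<forall>v\<in>{0<..T}. \<forall>\<tau>\<in>{0..T}. (norm (x - x'))\<^sup>2 \<le> v \<longrightarrow>
    \<bar>J v \<tau> x - J v \<tau> x'\<bar> \<le> K * (norm (x - x') * v powr (\<alpha> / 2 - 3/2) + norm (x - x') powr (\<beta> + \<alpha> / 2) * v powr (\<alpha> / 4 - 1))"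
proof -
  obtain K1 where K1: "K1 \<ge> 0" "\<And>x x' y u. x \<in> F \<Longrightarrow> x' \<in> F \<Longrightarrow> y \<in> F \<Longrightarrow> u > 0 \<Longrightarrow> (norm (x - x'))\<^sup>2 \<le> u \<Longrightarrow>
     \<bar>flux u x y - flux u x' y + heat_kernel u (x - y) * ((x - y) \<bullet> (\<nu> x - \<nu> x')) / (2 * u)\<bar>
      \<le> K1 * (norm (x - x') * u powr (\<alpha> / 2 - 1 - m)) *
          (exp (- (1/16) * (norm (x - y))\<^sup>2 / u) + exp (- (1/16) * (norm (x' - y))\<^sup>2 / u))"
    using flux_space_increment by blast
  obtain K2 where K2: "K2 \<ge> 0" "\<And>x a u. x \<in> F \<Longrightarrow> u \<in> {0<..T} \<Longrightarrow>
    \<bar>\<integral>y. exp (- (1/4) * (norm (x - y))\<^sup>2 / u) * ((x - y) \<bullet> a) \<partial>\<sigma>\<bar> \<le> K2 * norm a * u powr (m + \<alpha> / 4)"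
    using gaussian_first_moment_small[OF T] by blast
  define E where "E = exp ((1 + \<beta>)\<^sup>2 / (2 * (1/4)))"
  define G where "G = gauss_const (1/16)"
  define G' where "G' = gauss_const (1/8)"
  have pos: "E \<ge> 0" "G \<ge> 0" "G' \<ge> 0" by (auto simp: E_def G_def G'_def gauss_const)
  define L where "L = T powr (\<alpha> / 4 - \<beta> / 2)"
  define K where "K = 2 * K1 * M * G + C * (H / 2 * E * G' + M * K2 / 2 * L)"
  show ?thesis
  proof (intro exI[of _ K] conjI ballI impI)
    show "K \<ge> 0" using K1 K2 pos M H C by (simp add: K_def L_def)
    fix x x' v \<tau>
    assume x: "x \<in> F" and x': "x' \<in> F" and vT: "v \<in> {0<..T}" and \<tau>: "\<tau> \<in> {0..T}" and rv: "(norm (x - x'))\<^sup>2 \<le> v"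
    have v: "v > 0" "v \<le> T" using vT by auto
    define r where "r = norm (x - x')"
    define a where "a = \<nu> x - \<nu> x'"
    define D where "D y = heat_kernel v (x - y) * ((x - y) \<bullet> a) / (2 * v)" for y
    have r: "r \<ge> 0" by (simp add: r_def)
    have an: "norm a \<le> C * r powr \<alpha>" using \<nu>_hoelder[OF x x'] by (simp add: a_def r_def)
    have D_cont: "continuous_on F D" unfolding D_def using v by (auto intro!: continuous_intros)
    note D_meas = measurable_\<sigma>_continuous[OF D_cont]
    note fl_meas = measurable_flux
    note \<mu>_meas = \<mu>_measurable[OF \<tau>]
    have D_eq: "D y = ((4 * pi) powr (- m) * v powr (- m) / (2 * v)) * (exp (- (1/4) * (norm (x - y))\<^sup>2 / v) * ((x - y) \<bullet> a))" for y
      using v by (simp add: D_def heat_kernel_eq)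
    have D_le: "\<bar>D y\<bar> \<le> (norm a * v powr (- m) / (2 * v)) * (norm (x - y) * exp (- (1/4) * (norm (x - y))\<^sup>2 / v))" for y
    proof -
      have "\<bar>D y\<bar> = heat_kernel v (x - y) * \<bar>(x - y) \<bullet> a\<bar> / (2 * v)"
        using v by (simp add: D_def abs_mult heat_kernel_nonneg)
      also have "\<dots> \<le> (v powr (- m) * exp (- (1/4) * (norm (x - y))\<^sup>2 / v)) * (norm (x - y) * norm a) / (2 * v)"
        using v heat_kernel_le[of v "x - y"] Cauchy_Schwarz_ineq2[of "x - y" a]
        by (intro divide_right_mono mult_mono) auto
      finally show ?thesis by (simp add: mult_ac)
    qed
    define f1 where "f1 y = (flux v x y - flux v x' y + D y) * \<mu> \<tau> y" for y
    define f2 where "f2 y = D y * (\<mu> \<tau> y - \<mu> \<tau> x)" for y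
    define q where "q = K1 * M * (r * v powr (\<alpha> / 2 - 1 - m))"
    have q: "q \<ge> 0" using K1 M r by (simp add: q_def)
    define e where "e z y = exp (- (1/16) * (norm (z - y))\<^sup>2 / v)" for z y :: 'a
    have e: "integrable \<sigma> (e z)" "(\<integral>y. e z y \<partial>\<sigma>) \<le> G * v powr (m - 1/2)" if z: "z \<in> F" for z
    proof -
      have em: "e z \<in> borel_measurable \<sigma>"
        unfolding e_def by (rule measurable_\<sigma>_continuous) (use v in \<open>auto intro!: continuous_intros\<close>)
      have le: "\<bar>e z y\<bar> \<le> 1 * exp (- (1/16) * (norm (z - y))\<^sup>2 / v)" for y by (simp add: e_def)
      show "integrable \<sigma> (e z)"
        by (rule gauss_dominated(1)[OF _ z v(1) zero_le_one em le]) simp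
      have "\<bar>\<integral>y. e z y \<partial>\<sigma>\<bar> \<le> 1 * gauss_const (1/16) * v powr (m - 1/2)"
        by (rule gauss_dominated(3)[OF _ z v(1) zero_le_one em le]) simp
      then show "(\<integral>y. e z y \<partial>\<sigma>) \<le> G * v powr (m - 1/2)" by (simp add: G_def)
    qed
    have f1_le: "\<bar>f1 y\<bar> \<le> q * e x y + q * e x' y" if y: "y \<in> F" for y
    proof -
      have "\<bar>flux v x y - flux v x' y + D y\<bar> * \<bar>\<mu> \<tau> y\<bar> \<le> (K1 * (r * v powr (\<alpha> / 2 - 1 - m)) * (e x y + e x' y)) * M"
        using K1(1) K1(2)[OF x x' y v(1) rv] \<mu>_le[OF \<tau> y] r unfolding D_def a_def e_def r_def
        by (intro mult_mono) auto
      also have "\<dots> = q * e x y + q * e x' y" by (simp add: q_def algebra_simps)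
      finally show ?thesis by (simp only: f1_def abs_mult)
    qed
    have f1_meas: "f1 \<in> borel_measurable \<sigma>"
      unfolding f1_def using fl_meas \<mu>_meas D_meas by (intro borel_measurable_times borel_measurable_add borel_measurable_diff)
    have ee: "integrable \<sigma> (\<lambda>y. q * e x y + q * e x' y)" using e x x' by auto
    have f1_int: "integrable \<sigma> f1"
    proof (rule Bochner_Integration.integrable_bound[OF ee f1_meas], intro AE_I2)
      fix y assume "y \<in> space \<sigma>"
      then have "\<bar>f1 y\<bar> \<le> q * e x y + q * e x' y" by (intro f1_le) simp
      then show "norm (f1 y) \<le> norm (q * e x y + q * e x' y)"
        unfolding real_norm_def using abs_ge_self order_trans by blast
    qed
    have I1: "\<bar>\<integral>y. f1 y \<partial>\<sigma>\<bar> \<le> 2 * K1 * M * G * (r * v powr (\<alpha> / 2 - 3/2))"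
    proof -
      have "\<bar>\<integral>y. f1 y \<partial>\<sigma>\<bar> \<le> (\<integral>y. \<bar>f1 y\<bar> \<partial>\<sigma>)" by (rule integral_abs_bound)
      also have "\<dots> \<le> (\<integral>y. q * e x y + q * e x' y \<partial>\<sigma>)"
        using f1_int ee f1_le by (intro integral_mono) auto
      also have "\<dots> = q * (\<integral>y. e x y \<partial>\<sigma>) + q * (\<integral>y. e x' y \<partial>\<sigma>)"
        using e x x' by simp
      also have "\<dots> \<le> q * (G * v powr (m - 1/2)) + q * (G * v powr (m - 1/2))"
        using e x x' q by (intro add_mono mult_left_mono) auto
      also have "\<dots> = 2 * K1 * M * G * (r * (v powr (\<alpha> / 2 - 1 - m) * v powr (m - 1/2)))"
        by (simp add: q_def)
      also have "v powr (\<alpha> / 2 - 1 - m) * v powr (m - 1/2) = v powr (\<alpha> / 2 - 3/2)"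
        by (simp add: powr_add[symmetric])
      finally show ?thesis .
    qed
    have f2_meas: "f2 \<in> borel_measurable \<sigma>"
      unfolding f2_def using \<mu>_meas D_meas by (intro borel_measurable_times borel_measurable_diff) auto
    have f2_le: "\<bar>f2 y\<bar> \<le> (norm a * H / 2 * E * (v powr (- m) * v powr ((1 + \<beta>) / 2) / v)) * exp (- (1/8) * (norm (x - y))\<^sup>2 / v)" if y: "y \<in> F" for y
    proof -
      define d where "d = norm (x - y)"
      have d: "d \<ge> 0" by (simp add: d_def)
      have "\<bar>f2 y\<bar> = \<bar>D y\<bar> * \<bar>\<mu> \<tau> y - \<mu> \<tau> x\<bar>" by (simp add: f2_def abs_mult)
      also have "\<dots> \<le> ((norm a * v powr (- m) / (2 * v)) * (d * exp (- (1/4) * d\<^sup>2 / v))) * (H * d powr \<beta>)"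
        using D_le[of y] \<mu>H[OF \<tau> y x] v unfolding d_def norm_minus_commute[of y x]
        by (intro mult_mono) auto
      also have "\<dots> = (norm a * v powr (- m) / (2 * v) * H) * (d powr (1 + \<beta>) * exp (- (1/4) * d\<^sup>2 / v))"
        using d by (cases "d = 0") (simp_all add: powr_add)
      also have "\<dots> \<le> (norm a * v powr (- m) / (2 * v) * H) * (E * v powr ((1 + \<beta>) / 2) * exp (- (1/4/2) * d\<^sup>2 / v))"
        unfolding E_def using v d H \<beta> by (intro mult_left_mono powr_mult_exp_le) auto
      finally show ?thesis by (simp add: d_def mult_ac)
    qed
    have Q2: "0 \<le> norm a * H / 2 * E * (v powr (- m) * v powr ((1 + \<beta>) / 2) / v)" using H pos v by simp
    note f2d = gauss_dominated[OF _ x v(1) Q2 f2_meas f2_le, simplified, folded G'_def]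
    have I2: "\<bar>\<integral>y. f2 y \<partial>\<sigma>\<bar> \<le> norm a * (H / 2 * E * G') * v powr (\<beta> / 2 - 1)"
    proof -
      have "v powr (- m) * v powr ((1 + \<beta>) / 2) / v * v powr (m - 1/2) = v powr (\<beta> / 2 - 1)"
      proof -
        have "- m + (1 + \<beta>) / 2 - 1 + (m - 1/2) = \<beta> / 2 - 1" by (simp add: field_simps)
        then show ?thesis unfolding powr_mult_divide[OF v(1)] by (simp only: powr_add[symmetric])
      qed
      then have "norm a * H / 2 * E * (v powr (- m) * v powr ((1 + \<beta>) / 2) / v) * G' * v powr (m - 1/2)
          = norm a * (H / 2 * E * G') * v powr (\<beta> / 2 - 1)"
        by (metis (no_types, lifting) mult.assoc mult.commute times_divide_eq_left times_divide_eq_right)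
      moreover have "\<bar>\<integral>y. f2 y \<partial>\<sigma>\<bar> \<le> norm a * H / 2 * E * (v powr (- m) * v powr ((1 + \<beta>) / 2) / v) * G' * v powr (m - 1/2)"
        unfolding G'_def by (rule gauss_dominated(3)[OF _ x v(1) Q2 f2_meas f2_le]) auto
      ultimately show ?thesis by (simp only:)
    qed
    have D_int: "integrable \<sigma> D"
    proof (rule gauss_dominated(1)[OF _ x v(1) _ D_meas])
      fix y
      have "norm (x - y) powr 1 * exp (- (1/4) * (norm (x - y))\<^sup>2 / v) \<le> exp (1\<^sup>2 / (2 * (1/4))) * v powr (1/2) * exp (- (1/4/2) * (norm (x - y))\<^sup>2 / v)"
        using v by (intro powr_mult_exp_le) auto
      then have "(norm a * v powr (- m) / (2 * v)) * (norm (x - y) * exp (- (1/4) * (norm (x - y))\<^sup>2 / v))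
          \<le> (norm a * v powr (- m) / (2 * v)) * (exp (1\<^sup>2 / (2 * (1/4))) * v powr (1/2) * exp (- (1/4/2) * (norm (x - y))\<^sup>2 / v))"
        using v by (intro mult_left_mono) auto
      then show "\<bar>D y\<bar> \<le> ((norm a * v powr (- m) / (2 * v)) * (exp (1\<^sup>2 / (2 * (1/4))) * v powr (1/2))) * exp (- (1/8) * (norm (x - y))\<^sup>2 / v)"
        using D_le[of y] by simp
    qed (use v in auto)
    have I3: "\<bar>\<integral>y. D y \<partial>\<sigma>\<bar> \<le> norm a * (K2 / 2) * v powr (\<alpha> / 4 - 1)"
    proof -
      have "(\<integral>y. D y \<partial>\<sigma>) = ((4 * pi) powr (- m) * v powr (- m) / (2 * v)) * (\<integral>y. exp (- (1/4) * (norm (x - y))\<^sup>2 / v) * ((x - y) \<bullet> a) \<partial>\<sigma>)"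
        unfolding D_eq by simp
      then have "\<bar>\<integral>y. D y \<partial>\<sigma>\<bar> = ((4 * pi) powr (- m) * v powr (- m) / (2 * v)) * \<bar>\<integral>y. exp (- (1/4) * (norm (x - y))\<^sup>2 / v) * ((x - y) \<bullet> a) \<partial>\<sigma>\<bar>"
        using v by (simp add: abs_mult)
      also have "\<dots> \<le> (1 * v powr (- m) / (2 * v)) * (K2 * norm a * v powr (m + \<alpha> / 4))"
        using v four_pi_powr K2 x vT by (intro mult_mono divide_right_mono mult_right_mono) auto
      also have "\<dots> = norm a * (K2 / 2) * (v powr (- m) * v powr (m + \<alpha> / 4) / v)" by simp
      also have "v powr (- m) * v powr (m + \<alpha> / 4) / v = v powr (\<alpha> / 4 - 1)"
        unfolding powr_mult_divide[OF v(1)] by simp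
      finally show ?thesis .
    qed
    have J_eq: "J v \<tau> x - J v \<tau> x' = (\<integral>y. f1 y \<partial>\<sigma>) - (\<integral>y. f2 y \<partial>\<sigma>) - \<mu> \<tau> x * (\<integral>y. D y \<partial>\<sigma>)"
    proof -
      have fi: "integrable \<sigma> (\<lambda>y. flux v x y * \<mu> \<tau> y)" "integrable \<sigma> (\<lambda>y. flux v x' y * \<mu> \<tau> y)"
        using J_bound x x' v \<tau> by auto
      have "J v \<tau> x - J v \<tau> x' = (\<integral>y. flux v x y * \<mu> \<tau> y - flux v x' y * \<mu> \<tau> y \<partial>\<sigma>)"
        unfolding J_def using fi by simp
      also have "\<dots> = (\<integral>y. f1 y - f2 y - \<mu> \<tau> x * D y \<partial>\<sigma>)"
        by (rule Bochner_Integration.integral_cong) (auto simp: f1_def f2_def algebra_simps)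
      also have "\<dots> = (\<integral>y. f1 y \<partial>\<sigma>) - (\<integral>y. f2 y \<partial>\<sigma>) - \<mu> \<tau> x * (\<integral>y. D y \<partial>\<sigma>)"
        using f1_int f2d(1) D_int by simp
      finally show ?thesis .
    qed
    \<comment> \<open>Of the factor \<open>r powr \<alpha>\<close> from the normals,
      \<open>r powr \<gamma>\<close> is kept and the rest is converted, through
      \<open>r \<le> sqrt v\<close>, into \<open>v powr (\<alpha> / 4 - \<beta> / 2)\<close>. This
      lifts \<open>v powr (\<beta> / 2 - 1)\<close> in \<open>f2\<close> to the integrable
      \<open>v powr (\<alpha> / 4 - 1)\<close>. The first moment already has that weight, so there
      the converted factor is just bounded by \<open>L\<close>.\<close>
    define \<gamma> where "\<gamma> = \<beta> + \<alpha> / 2"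
    have r\<alpha>: "r powr \<alpha> = r powr \<gamma> * r powr (\<alpha> / 2 - \<beta>)"
      by (simp add: \<gamma>_def powr_add[symmetric])
    have rv': "r powr (\<alpha> / 2 - \<beta>) \<le> v powr (\<alpha> / 4 - \<beta> / 2)"
    proof -
      have "r \<le> sqrt v" using rv v by (simp add: r_def real_le_rsqrt)
      then have "r powr (\<alpha> / 2 - \<beta>) \<le> sqrt v powr (\<alpha> / 2 - \<beta>)" using r \<beta> by (intro powr_mono2) auto
      also have "\<dots> = v powr (\<alpha> / 4 - \<beta> / 2)" using v by (simp add: powr_half_sqrt[symmetric] powr_powr diff_divide_distrib)
      finally show ?thesis .
    qed
    have vL: "v powr (\<alpha> / 4 - \<beta> / 2) \<le> L" unfolding L_def using v \<beta> by (intro powr_mono2) auto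
    have A1: "norm a * v powr (\<beta> / 2 - 1) \<le> C * (r powr \<gamma> * v powr (\<alpha> / 4 - 1))"
    proof -
      have "norm a * v powr (\<beta> / 2 - 1) \<le> (C * (r powr \<gamma> * v powr (\<alpha> / 4 - \<beta> / 2))) * v powr (\<beta> / 2 - 1)"
        using an rv' C unfolding r\<alpha> by (intro mult_right_mono order_trans[OF an[unfolded r\<alpha>]] mult_left_mono) auto
      also have "\<dots> = C * (r powr \<gamma> * (v powr (\<alpha> / 4 - \<beta> / 2) * v powr (\<beta> / 2 - 1)))" by simp
      finally show ?thesis by (simp add: powr_add[symmetric])
    qed
    have A2: "norm a * v powr (\<alpha> / 4 - 1) \<le> C * L * (r powr \<gamma> * v powr (\<alpha> / 4 - 1))"
    proof -
      have "norm a * v powr (\<alpha> / 4 - 1) \<le> (C * (r powr \<gamma> * L)) * v powr (\<alpha> / 4 - 1)"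
        using rv' vL C by (intro mult_right_mono order_trans[OF an[unfolded r\<alpha>]] mult_left_mono) auto
      then show ?thesis by (simp add: mult_ac)
    qed
    have nn: "0 \<le> r powr \<gamma> * v powr (\<alpha> / 4 - 1)" "0 \<le> r * v powr (\<alpha> / 2 - 3/2)" using r by auto
    have I2': "\<bar>\<integral>y. f2 y \<partial>\<sigma>\<bar> \<le> C * (H / 2 * E * G') * (r powr \<gamma> * v powr (\<alpha> / 4 - 1))"
    proof -
      have "(H / 2 * E * G') * (norm a * v powr (\<beta> / 2 - 1)) \<le> (H / 2 * E * G') * (C * (r powr \<gamma> * v powr (\<alpha> / 4 - 1)))"
        using A1 H pos by (intro mult_left_mono) auto
      then show ?thesis using I2 by (simp add: mult_ac)
    qed
    have I3': "\<bar>\<mu> \<tau> x * (\<integral>y. D y \<partial>\<sigma>)\<bar> \<le> C * (M * K2 / 2 * L) * (r powr \<gamma> * v powr (\<alpha> / 4 - 1))"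
    proof -
      have "\<bar>\<mu> \<tau> x * (\<integral>y. D y \<partial>\<sigma>)\<bar> \<le> M * (norm a * (K2 / 2) * v powr (\<alpha> / 4 - 1))"
        unfolding abs_mult using \<mu>_le[OF \<tau> x] I3 M by (intro mult_mono) auto
      also have "\<dots> = (M * K2 / 2) * (norm a * v powr (\<alpha> / 4 - 1))" by simp
      also have "\<dots> \<le> (M * K2 / 2) * (C * L * (r powr \<gamma> * v powr (\<alpha> / 4 - 1)))"
        using A2 M K2 by (intro mult_left_mono) auto
      finally show ?thesis by (simp add: mult_ac)
    qed
    have "\<bar>J v \<tau> x - J v \<tau> x'\<bar> \<le> 2 * K1 * M * G * (r * v powr (\<alpha> / 2 - 3/2))
        + C * (H / 2 * E * G' + M * K2 / 2 * L) * (r powr \<gamma> * v powr (\<alpha> / 4 - 1))"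
      using I1 I2' I3' unfolding J_eq distrib_left distrib_right by linarith
    also have "\<dots> \<le> K * (r * v powr (\<alpha> / 2 - 3/2)) + K * (r powr \<gamma> * v powr (\<alpha> / 4 - 1))"
      using nn K1 K2 M C H pos by (intro add_mono mult_right_mono) (auto simp: K_def L_def)
    finally show "\<bar>J v \<tau> x - J v \<tau> x'\<bar> \<le> K * (norm (x - x') * v powr (\<alpha> / 2 - 3/2) + norm (x - x') powr (\<beta> + \<alpha> / 2) * v powr (\<alpha> / 4 - 1))"
      by (simp add: r_def \<gamma>_def distrib_left)
  qed
qed

section \<open>Integration in time\<close>

lemma J_integrable:
  assumes t: "t \<in> {0..T}" and x: "x \<in> F"
  shows "integrable lborel (\<lambda>\<tau>. indicator {0..t} \<tau> * J (t - \<tau>) \<tau> x)"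
proof -
  obtain K where K: "K \<ge> 0" "\<And>x v \<tau>. x \<in> F \<Longrightarrow> v > 0 \<Longrightarrow> \<tau> \<in> {0..T} \<Longrightarrow> \<bar>J v \<tau> x\<bar> \<le> K * v powr (\<alpha> / 2 - 1)"
    using J_bound by blast
  \<comment> \<open>For \<tau> between 0 and \<open>t\<close> the age stays below \<open>T\<close>,
    so only the first branch of \<open>power_tail\<close> matters and the decay exponent 1 is
    arbitrary.\<close>
  have "integrable lborel (\<lambda>\<tau>. K * power_tail T (\<alpha> / 2) 1 (t - \<tau>))"
    using integrable_power_tail(1)[OF T, of "\<alpha> / 2" 1 t] \<alpha> by simp
  then show ?thesis
  proof (rule Bochner_Integration.integrable_bound[OF _ J_measurable[OF t x]], intro AE_I2)
    fix \<tau>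
    show "norm (indicator {0..t} \<tau> * J (t - \<tau>) \<tau> x) \<le> norm (K * power_tail T (\<alpha> / 2) 1 (t - \<tau>))"
    proof (cases "\<tau> \<in> {0..<t}")
      case True
      then show ?thesis using K x t by (simp add: power_tail_def)
    next
      case False
      then have "indicator {0..t} \<tau> * J (t - \<tau>) \<tau> x = 0" by (auto simp: indicator_def J_nonpos)
      then show ?thesis by (metis norm_ge_zero norm_zero)
    qed
  qed
qed

text \<open>The increment in \<open>t\<close> falls on the kernel alone, so the bound on \<mu>
  controls it. Ages up to \<open>h\<close> have weight \<open>v powr (\<alpha> / 2 - 1)\<close>,
  later ones \<open>h * v powr (\<alpha> / 2 - 2)\<close>: power tails with
  \<open>a = \<alpha> / 2\<close> and \<open>b = 1 - a\<close>, whose integrals have order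
  \<open>h powr (\<alpha> / 2)\<close>.\<close>

lemma W_time_hoelder: "\<exists>K. \<forall>x\<in>F. \<forall>t\<in>{0..T}. \<forall>s\<in>{0..T}. \<bar>W t x - W s x\<bar> \<le> K * \<bar>t - s\<bar> powr (\<alpha> / 2)"
proof -
  define a where "a = \<alpha> / 2"
  define b where "b = 1 - a"
  have ab: "a > 0" "b > 0" "a < 1" using \<alpha> by (auto simp: a_def b_def)
  obtain K1 where K1: "K1 \<ge> 0" "\<And>x v \<tau>. x \<in> F \<Longrightarrow> v > 0 \<Longrightarrow> \<tau> \<in> {0..T} \<Longrightarrow> \<bar>J v \<tau> x\<bar> \<le> K1 * v powr (a - 1)"
    using J_bound unfolding a_def by blast
  obtain K2 where K2: "K2 \<ge> 0" "\<And>x v h \<tau>. x \<in> F \<Longrightarrow> v > 0 \<Longrightarrow> h \<in> {0..v} \<Longrightarrow> \<tau> \<in> {0..T} \<Longrightarrow>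
      \<bar>J (v + h) \<tau> x - J v \<tau> x\<bar> \<le> K2 * (h * v powr (a - 2))"
    using J_time_increment unfolding a_def by blast
  define K where "K = (K1 + (2 * K1 + K2)) * (1 / a + 1 / b)"
  have main: "\<bar>W t x - W s x\<bar> \<le> K * \<bar>t - s\<bar> powr a"
    if x: "x \<in> F" and t: "t \<in> {0..T}" and s: "s \<in> {0..T}" and st: "s < t" for t s x
  proof -
    define h where "h = t - s"
    have h: "h > 0" using st by (simp add: h_def)
    define f where "f \<tau> = indicator {0..t} \<tau> * J (t - \<tau>) \<tau> x - indicator {0..s} \<tau> * J (s - \<tau>) \<tau> x" for \<tau>
    \<comment> \<open>The first summand dominates between \<open>s\<close> and \<open>t\<close>,
      where only the later potential is active and the age is at most \<open>h\<close>; the second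
      one dominates before \<open>s\<close>, with ages counted from \<open>s\<close>.\<close>
    define g where "g \<tau> = K1 * power_tail h a b (t - \<tau>) + (2 * K1 + K2) * power_tail h a b (s - \<tau>)" for \<tau>
    have f: "integrable lborel f" unfolding f_def using J_integrable t s x by simp
    have fW: "integral\<^sup>L lborel f = W t x - W s x"
      unfolding f_def W_def using J_integrable t s x by simp
    have g: "integrable lborel g" unfolding g_def using integrable_power_tail(1)[OF h ab(1,2)] by simp
    have gI: "integral\<^sup>L lborel g = K * h powr a"
      unfolding g_def using integrable_power_tail[OF h ab(1,2)] by (simp add: K_def algebra_simps)
    have "\<bar>f \<tau>\<bar> \<le> g \<tau>" if \<tau>s: "\<tau> \<noteq> s" for \<tau>
    proof -
      have g0: "0 \<le> K1 * power_tail h a b (t - \<tau>)" "0 \<le> (2 * K1 + K2) * power_tail h a b (s - \<tau>)"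
        using K1(1) K2(1) by (auto intro!: mult_nonneg_nonneg power_tail_nonneg)
      consider "\<tau> < 0 \<or> \<tau> \<ge> t" | "s < \<tau>" "\<tau> < t" "0 \<le> \<tau>" | "0 \<le> \<tau>" "\<tau> < s" using \<tau>s by linarith
      then show ?thesis
      proof cases
        case 1
        then have "f \<tau> = 0" using st by (auto simp: f_def indicator_def J_nonpos)
        then show ?thesis using g0 by (simp add: g_def)
      next
        case 2
        then have "f \<tau> = J (t - \<tau>) \<tau> x" by (simp add: f_def)
        moreover have "\<bar>J (t - \<tau>) \<tau> x\<bar> \<le> K1 * power_tail h a b (t - \<tau>)"
          using K1(2)[OF x, of "t - \<tau>" \<tau>] 2 t by (simp add: power_tail_def h_def)
        ultimately show ?thesis using g0 by (simp add: g_def)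
      next
        case 3
        define v where "v = s - \<tau>"
        have v: "v > 0" "t - \<tau> = v + h" using 3 by (auto simp: v_def h_def)
        have \<tau>: "\<tau> \<in> {0..T}" using 3 s by auto
        have f\<tau>: "f \<tau> = J (v + h) \<tau> x - J v \<tau> x" using 3 st by (simp add: f_def v(2) flip: v_def)
        have "\<bar>f \<tau>\<bar> \<le> (2 * K1 + K2) * power_tail h a b v"
        proof (cases "v \<le> h")
          case True
          have "(v + h) powr (a - 1) \<le> v powr (a - 1)"
            using v h ab by (intro powr_mono2') auto
          then have "K1 * (v + h) powr (a - 1) \<le> K1 * v powr (a - 1)" using K1(1) by (rule mult_left_mono)
          moreover have "0 \<le> K2 * v powr (a - 1)" using K2 by simp
          ultimately have "\<bar>f \<tau>\<bar> \<le> (2 * K1 + K2) * v powr (a - 1)"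
            using K1(2)[OF x v(1) \<tau>] K1(2)[OF x _ \<tau>, of "v + h"] v h unfolding f\<tau> distrib_right by linarith
          then show ?thesis using True v by (simp add: power_tail_def)
        next
          case False
          have "\<bar>f \<tau>\<bar> \<le> K2 * (h * v powr (a - 2))" unfolding f\<tau> using K2(2)[OF x v(1) _ \<tau>, of h] h False by simp
          also have "h * v powr (a - 2) = power_tail h a b v" using False v h by (simp add: power_tail_def b_def)
          also have "K2 * power_tail h a b v \<le> (2 * K1 + K2) * power_tail h a b v"
            using K1 K2 by (intro mult_right_mono power_tail_nonneg) auto
          finally show ?thesis .
        qed
        then show ?thesis using g0 by (simp add: g_def v_def)
      qed
    qed
    then have "\<bar>W t x - W s x\<bar> \<le> K * h powr a"
      using lborel_integral_dominated[OF f g, of s] fW gI by simp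
    then show ?thesis using st by (simp add: h_def)
  qed
  show ?thesis
  proof (intro exI[of _ K] ballI)
    fix x t s assume *: "x \<in> F" "t \<in> {0..T}" "s \<in> {0..T}"
    consider "s < t" | "t < s" | "s = t" by linarith
    then show "\<bar>W t x - W s x\<bar> \<le> K * \<bar>t - s\<bar> powr (\<alpha> / 2)"
    proof cases
      case 1
      then show ?thesis using main[OF *(1,2,3)] by (simp add: a_def)
    next
      case 2
      then show ?thesis using main[OF *(1,3,2)] by (simp add: a_def abs_minus_commute)
    qed simp
  qed
qed

text \<open>Below age \<open>r\<^sup>2\<close> the two values are bounded separately and integrate
  to order \<open>r powr \<alpha>\<close>. Above it, \<open>r * v powr (\<alpha> / 2 - 3/2)\<close>
  has a tail of the same order; its convergence at large ages is \<open>b > 0\<close>, that is,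
  \<open>\<alpha> < 1\<close>. Only the normal term limits the exponent to \<gamma>.\<close>

lemma W_space_hoelder:
  assumes \<beta>: "0 \<le> \<beta>" "\<beta> \<le> \<alpha> / 2" and H: "H \<ge> 0"
    and \<mu>H: "\<And>\<tau> y z. \<tau> \<in> {0..T} \<Longrightarrow> y \<in> F \<Longrightarrow> z \<in> F \<Longrightarrow> \<bar>\<mu> \<tau> y - \<mu> \<tau> z\<bar> \<le> H * norm (y - z) powr \<beta>"
  shows "\<exists>K\<ge>0. \<forall>t\<in>{0..T}. \<forall>x\<in>F. \<forall>x'\<in>F. \<bar>W t x - W t x'\<bar> \<le> K * norm (x - x') powr (\<beta> + \<alpha> / 2)"
proof -
  define a where "a = \<alpha> / 2"
  define b where "b = 1/2 - a"
  define \<gamma> where "\<gamma> = \<beta> + \<alpha> / 2"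
  have ab: "a > 0" "b > 0" "a < 1" using \<alpha> by (auto simp: a_def b_def)
  obtain K1 where K1: "K1 \<ge> 0" "\<And>x v \<tau>. x \<in> F \<Longrightarrow> v > 0 \<Longrightarrow> \<tau> \<in> {0..T} \<Longrightarrow> \<bar>J v \<tau> x\<bar> \<le> K1 * v powr (a - 1)"
    using J_bound unfolding a_def by blast
  obtain K2 where K2: "K2 \<ge> 0" "\<And>x x' v \<tau>. x \<in> F \<Longrightarrow> x' \<in> F \<Longrightarrow> v \<in> {0<..T} \<Longrightarrow> \<tau> \<in> {0..T} \<Longrightarrow> (norm (x - x'))\<^sup>2 \<le> v \<Longrightarrow>
    \<bar>J v \<tau> x - J v \<tau> x'\<bar> \<le> K2 * (norm (x - x') * v powr (a - 3/2) + norm (x - x') powr \<gamma> * v powr (\<alpha> / 4 - 1))"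
    using J_space_increment[OF \<beta> H \<mu>H] unfolding a_def \<gamma>_def by blast
  obtain R where R: "\<And>x y. x \<in> F \<Longrightarrow> y \<in> F \<Longrightarrow> norm (x - y) \<le> R"
    using diameter_bounded_bound[OF compact_imp_bounded[OF compact_F]] by (metis dist_norm)
  \<comment> \<open>The power of the bound \<open>R\<close> on distances lowers the exponent
    \<alpha> of the regular part to \<gamma>.\<close>
  define K where "K = (2 * K1 + K2) * (1 / a + 1 / b) * R powr (\<alpha> - \<gamma>) + K2 * (T powr (\<alpha> / 4) * (4 / \<alpha> + 1))"
  show ?thesis
  proof (intro exI[of _ K] conjI ballI; (fold \<gamma>_def)?)
    show "K \<ge> 0" using K1 K2 ab \<alpha> by (simp add: K_def)
    fix t x x' assume t: "t \<in> {0..T}" and x: "x \<in> F" and x': "x' \<in> F"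
    show "\<bar>W t x - W t x'\<bar> \<le> K * norm (x - x') powr \<gamma>"
    proof (cases "x = x'")
      case False
      define r where "r = norm (x - x')"
      have r: "r > 0" "r \<le> R" using False R[OF x x'] by (auto simp: r_def)
      define h where "h = r\<^sup>2"
      have h: "h > 0" using r by (simp add: h_def)
      have hr: "h powr p = r powr (2 * p)" for p
      proof -
        have "h = r powr 2" using r by (simp add: h_def powr_numeral)
        then show ?thesis by (simp add: powr_powr)
      qed
      define f where "f \<tau> = indicator {0..t} \<tau> * J (t - \<tau>) \<tau> x - indicator {0..t} \<tau> * J (t - \<tau>) \<tau> x'" for \<tau>
      define g where "g \<tau> = (2 * K1 + K2) * power_tail h a b (t - \<tau>) + (K2 * r powr \<gamma>) * power_tail T (\<alpha> / 4) 1 (t - \<tau>)" for \<tau>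
      have \<alpha>4: "\<alpha> / 4 > 0" using \<alpha> by simp
      note pt1 = integrable_power_tail[OF h ab(1,2), of t]
      note pt2 = integrable_power_tail[OF T \<alpha>4 zero_less_one, of t]
      have f: "integrable lborel f" unfolding f_def using J_integrable[OF t] x x' by simp
      have fW: "integral\<^sup>L lborel f = W t x - W t x'"
        unfolding f_def W_def using J_integrable[OF t] x x' by simp
      have g: "integrable lborel g" unfolding g_def using pt1 pt2 by simp
      have gI: "integral\<^sup>L lborel g = (2 * K1 + K2) * (h powr a * (1 / a + 1 / b)) + (K2 * r powr \<gamma>) * (T powr (\<alpha> / 4) * (4 / \<alpha> + 1))"
        unfolding g_def using pt1 pt2 by simp
      have "\<bar>f \<tau>\<bar> \<le> g \<tau>" for \<tau>
      proof (cases "\<tau> \<in> {0..<t}")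
        case False
        then have "f \<tau> = 0" by (auto simp: f_def indicator_def J_nonpos)
        then show ?thesis using K1(1) K2(1) by (simp add: g_def power_tail_nonneg)
      next
        case True
        define v where "v = t - \<tau>"
        have v: "v > 0" "v \<le> T" and \<tau>: "\<tau> \<in> {0..T}" using True t by (auto simp: v_def)
        have f\<tau>: "f \<tau> = J v \<tau> x - J v \<tau> x'" using True by (simp add: f_def v_def)
        have pT: "power_tail T (\<alpha> / 4) 1 v = v powr (\<alpha> / 4 - 1)" using v by (simp add: power_tail_def)
        have n0: "0 \<le> K2 * r powr \<gamma> * power_tail T (\<alpha> / 4) 1 v" "0 \<le> K2 * power_tail h a b v" "0 \<le> K1 * power_tail h a b v"
          using K1(1) K2(1) by (auto intro!: mult_nonneg_nonneg power_tail_nonneg)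
        have "\<bar>f \<tau>\<bar> \<le> (2 * K1 + K2) * power_tail h a b v + K2 * r powr \<gamma> * power_tail T (\<alpha> / 4) 1 v"
        proof (cases "v \<le> h")
          case True
          then have "power_tail h a b v = v powr (a - 1)" using v by (simp add: power_tail_def)
          then show ?thesis
            using K1(2)[OF x v(1) \<tau>] K1(2)[OF x' v(1) \<tau>] n0 unfolding f\<tau> distrib_right by simp
        next
          case False
          have "power_tail h a b v = h powr (1/2) * v powr (a - 3/2)"
            using False v by (simp add: power_tail_def b_def)
          then have ph: "power_tail h a b v = r * v powr (a - 3/2)" using r by (simp add: hr)
          have "\<bar>f \<tau>\<bar> \<le> K2 * (r * v powr (a - 3/2) + r powr \<gamma> * v powr (\<alpha> / 4 - 1))"
            unfolding f\<tau> r_def using K2(2)[OF x x' _ \<tau>, of v] v False by (simp add: h_def r_def)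
          then show ?thesis using n0 unfolding ph[symmetric] pT[symmetric] distrib_right distrib_left by simp
        qed
        then show ?thesis by (simp add: g_def v_def)
      qed
      then have le: "\<bar>W t x - W t x'\<bar> \<le> (2 * K1 + K2) * (h powr a * (1 / a + 1 / b)) + (K2 * r powr \<gamma>) * (T powr (\<alpha> / 4) * (4 / \<alpha> + 1))"
        using lborel_integral_dominated[OF f g, of 0] fW gI by simp
      have "h powr a = r powr \<gamma> * r powr (\<alpha> - \<gamma>)"
        by (simp add: hr a_def powr_add[symmetric])
      also have "\<dots> \<le> r powr \<gamma> * R powr (\<alpha> - \<gamma>)"
        using r \<beta> by (intro mult_left_mono powr_mono2) (auto simp: \<gamma>_def)
      finally have "(2 * K1 + K2) * (h powr a * (1 / a + 1 / b)) \<le> (2 * K1 + K2) * ((r powr \<gamma> * R powr (\<alpha> - \<gamma>)) * (1 / a + 1 / b))"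
        using K1 K2 ab by (intro mult_left_mono mult_right_mono) auto
      then have "\<bar>W t x - W t x'\<bar> \<le> (2 * K1 + K2) * ((r powr \<gamma> * R powr (\<alpha> - \<gamma>)) * (1 / a + 1 / b)) + (K2 * r powr \<gamma>) * (T powr (\<alpha> / 4) * (4 / \<alpha> + 1))"
        using le by linarith
      also have "\<dots> = K * r powr \<gamma>" by (simp add: K_def algebra_simps add_divide_distrib)
      finally show ?thesis by (simp add: r_def)
    qed simp
  qed
qed

end

section \<open>Identification of the potential and bootstrap\<close>

lemma heat_kernel_has_derivative:
  fixes x y :: "'a::euclidean_space"
  shows "((\<lambda>z. heat_kernel u (z - y)) has_derivative (\<lambda>h. - heat_kernel u (x - y) * ((x - y) \<bullet> h) / (2 * u))) (at x)"
proof (cases "u > 0")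
  case True
  have eq: "heat_kernel u (z - y) = (4 * pi * u) powr (- real DIM('a) / 2) * exp (- ((z - y) \<bullet> (z - y)) / (4 * u))" for z
    using True by (simp add: heat_kernel_def power2_norm_eq_inner)
  show ?thesis
    unfolding eq
    by (rule has_derivative_eq_rhs, (rule derivative_intros refl)+)
       (use True in \<open>auto simp: fun_eq_iff inner_commute field_simps\<close>)
qed (simp add: heat_kernel_def)

theorem theorem2p9:
  fixes \<Omega> :: "'a::euclidean_space set" and \<alpha> T s :: real and \<mu> :: "real \<Rightarrow> 'a \<Rightarrow> real"
  assumes "DIM('a) \<ge> 2"
    and "0 < \<alpha>" "\<alpha> < 1" "T > 0"
    and "bounded \<Omega>" "open \<Omega>" "C1alpha_domain \<alpha> \<Omega>"
    and "C00 T \<Omega> \<mu>"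
    and "s = 1 \<or> s = -1"
    and "C0_holder \<alpha> T \<Omega> (\<lambda>t x. s / 2 * \<mu> t x + W_star \<Omega> \<mu> t x)"
  shows "C0_holder \<alpha> T \<Omega> \<mu>"
proof -
  let ?\<nu> = "outward_normal \<Omega>" and ?\<sigma> = "surface_measure \<Omega>"
  obtain \<rho>0 C where \<rho>0: "\<rho>0 > 0" and C: "C \<ge> 0"
    and n1: "\<And>x. x \<in> frontier \<Omega> \<Longrightarrow> norm (?\<nu> x) = 1"
    and nh: "\<And>x y. x \<in> frontier \<Omega> \<Longrightarrow> y \<in> frontier \<Omega> \<Longrightarrow> norm (?\<nu> x - ?\<nu> y) \<le> C * norm (x - y) powr \<alpha>"
    and nt: "\<And>x y. x \<in> frontier \<Omega> \<Longrightarrow> y \<in> frontier \<Omega> \<Longrightarrow> \<bar>?\<nu> x \<bullet> (x - y)\<bar> \<le> C * norm (x - y) powr (1 + \<alpha>)"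
    and rf: "\<And>x \<rho>. x \<in> frontier \<Omega> \<Longrightarrow> 0 < \<rho> \<Longrightarrow> \<rho> \<le> \<rho>0 \<Longrightarrow> \<exists>U R. near_reflection (frontier \<Omega>) x \<rho> (C * \<rho> powr \<alpha>) U R"
    by (rule C1alpha_global[OF assms(2,5,6,7)], rule that)
  obtain A where A: "A \<ge> 0" "\<And>x \<rho>. x \<in> frontier \<Omega> \<Longrightarrow> \<rho> > 0 \<Longrightarrow>
     emeasure ?\<sigma> (frontier \<Omega> \<inter> cball x \<rho>) \<le> ennreal (A * \<rho> powr (real DIM('a) - 1))"
    by (rule surface_measure_ball_le[where \<Omega> = \<Omega> and \<nu> = "?\<nu>" and C = C and \<alpha> = \<alpha>])
       (use assms(1,2,5) C n1 nh nt in \<open>blast+\<close>)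
  have comp: "compact (frontier \<Omega>)" using assms(5) by (rule compact_frontier_bounded)
  have cont: "continuous_on ({0..T} \<times> frontier \<Omega>) (\<lambda>(t, x). \<mu> t x)" and \<mu>0: "\<forall>x\<in>frontier \<Omega>. \<mu> 0 x = 0"
    using assms(8) by (auto simp: C00_def)
  have comp_im: "compact ((\<lambda>(t, x). \<mu> t x) ` ({0..T} \<times> frontier \<Omega>))"
    by (intro compact_continuous_image cont compact_Times comp) auto
  obtain M where M0: "\<And>z. z \<in> (\<lambda>(t, x). \<mu> t x) ` ({0..T} \<times> frontier \<Omega>) \<Longrightarrow> \<bar>z\<bar> \<le> M"
    using compact_imp_bounded[OF comp_im] unfolding bounded_iff real_norm_def by blast
  have \<mu>_bd: "\<bar>\<mu> t x\<bar> \<le> M" if "t \<in> {0..T}" "x \<in> frontier \<Omega>" for t x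
    by (rule M0) (use that in \<open>auto intro!: image_eqI[of _ _ "(t, x)"]\<close>)
  \<comment> \<open>The maximum secures a nonnegative bound even over an empty boundary, where
    \<open>M\<close> carries no sign.\<close>
  interpret heat_density "frontier \<Omega>" ?\<sigma> ?\<nu> \<alpha> C A \<rho>0 \<mu> T "max M 0"
  proof unfold_locales
    show "emeasure ?\<sigma> (R ` B) \<le> ennreal (L powr (real DIM('a) - 1)) * emeasure ?\<sigma> B"
      if "B \<in> sets ?\<sigma>" "R ` B \<in> sets ?\<sigma>" "L > 0"
        "\<And>y z. y \<in> B \<Longrightarrow> z \<in> B \<Longrightarrow> norm (R y - R z) \<le> L * norm (y - z)" for B R L
      using that by (intro emeasure_surface_measure_Lipschitz_image) (auto simp: in_sets_surface_measure)
    show "\<bar>\<mu> t x\<bar> \<le> max M 0" if "t \<in> {0..T}" "x \<in> frontier \<Omega>" for t x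
      using \<mu>_bd[OF that] by simp
  qed (use assms comp C A \<rho>0 n1 nh nt rf cont in \<open>auto simp: in_sets_surface_measure\<close>)
  \<comment> \<open>The derivative formula holds for every \<open>u\<close>, including
    \<open>u \<le> 0\<close>, so the two integrands agree everywhere and not just almost
    everywhere.\<close>
  have W_eq: "W_star \<Omega> \<mu> t x = W t x" for t x
  proof -
    have "frechet_derivative (\<lambda>z. heat_kernel u (z - y)) (at x) (?\<nu> x) = flux u x y" for u y
      using frechet_derivative_at[OF heat_kernel_has_derivative[of u y x]] by (simp add: flux_def fun_eq_iff)
    then show ?thesis by (simp add: W_star_def W_def J_def set_lebesgue_integral_def)
  qed
  define f where "f t x = s / 2 * \<mu> t x + W t x" for t x
  obtain Kf where Kf: "\<And>t s x. t \<in> {0..T} \<Longrightarrow> s \<in> {0..T} \<Longrightarrow> x \<in> frontier \<Omega> \<Longrightarrow> \<bar>f t x - f s x\<bar> \<le> Kf * \<bar>t - s\<bar> powr (\<alpha> / 2)"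
    "\<And>t x y. t \<in> {0..T} \<Longrightarrow> x \<in> frontier \<Omega> \<Longrightarrow> y \<in> frontier \<Omega> \<Longrightarrow> \<bar>f t x - f t y\<bar> \<le> Kf * norm (x - y) powr \<alpha>"
    using assms(10) unfolding C0_holder_def W_eq f_def by blast
  \<comment> \<open>Solving for \<mu> gives 2 or -2 times \<open>f - W\<close>; absolute values
    treat both choices of sign at once.\<close>
  have \<mu>_le: "\<bar>\<mu> t x - \<mu> t' x'\<bar> \<le> 2 * (\<bar>f t x - f t' x'\<bar> + \<bar>W t x - W t' x'\<bar>)" for t t' x x'
    using assms(9) unfolding f_def by (elim disjE) (simp_all add: abs_if)
  obtain Kt where Kt: "\<And>t s x. x \<in> frontier \<Omega> \<Longrightarrow> t \<in> {0..T} \<Longrightarrow> s \<in> {0..T} \<Longrightarrow> \<bar>W t x - W s x\<bar> \<le> Kt * \<bar>t - s\<bar> powr (\<alpha> / 2)"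
    using W_time_hoelder by blast
  \<comment> \<open>One round: \<open>W\<close> gains \<open>\<alpha> / 2\<close> over \<mu>, while
    the exponent \<alpha> of \<open>f\<close> is lowered to \<open>\<beta> + \<alpha> / 2\<close> by
    boundedness of the surface. The equation then hands the new exponent to \<mu>.\<close>
  have bootstrap: "\<exists>H\<ge>0. \<forall>\<tau>\<in>{0..T}. \<forall>y\<in>frontier \<Omega>. \<forall>z\<in>frontier \<Omega>. \<bar>\<mu> \<tau> y - \<mu> \<tau> z\<bar> \<le> H * norm (y - z) powr (\<beta> + \<alpha> / 2)"
    if \<beta>: "0 \<le> \<beta>" "\<beta> \<le> \<alpha> / 2" and H: "H \<ge> 0"
      and \<mu>H: "\<And>\<tau> y z. \<tau> \<in> {0..T} \<Longrightarrow> y \<in> frontier \<Omega> \<Longrightarrow> z \<in> frontier \<Omega> \<Longrightarrow> \<bar>\<mu> \<tau> y - \<mu> \<tau> z\<bar> \<le> H * norm (y - z) powr \<beta>" for \<beta> H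
  proof -
    define \<gamma> where "\<gamma> = \<beta> + \<alpha> / 2"
    obtain K where K: "K \<ge> 0" "\<And>t x x'. t \<in> {0..T} \<Longrightarrow> x \<in> frontier \<Omega> \<Longrightarrow> x' \<in> frontier \<Omega> \<Longrightarrow> \<bar>W t x - W t x'\<bar> \<le> K * norm (x - x') powr \<gamma>"
      using W_space_hoelder[OF \<beta> H \<mu>H] unfolding \<gamma>_def by blast
    obtain R where R: "\<And>x y. x \<in> frontier \<Omega> \<Longrightarrow> y \<in> frontier \<Omega> \<Longrightarrow> norm (x - y) \<le> R"
      using diameter_bounded_bound[OF compact_imp_bounded[OF comp]] by (metis dist_norm)
    show ?thesis
    proof (intro exI[of _ "2 * (\<bar>Kf\<bar> * R powr (\<alpha> - \<gamma>) + K)"] conjI ballI; (fold \<gamma>_def)?)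
      show "0 \<le> 2 * (\<bar>Kf\<bar> * R powr (\<alpha> - \<gamma>) + K)" using K by simp
      fix \<tau> y z assume \<tau>: "\<tau> \<in> {0..T}" and y: "y \<in> frontier \<Omega>" and z: "z \<in> frontier \<Omega>"
      define r where "r = norm (y - z)"
      have r: "0 \<le> r" "r \<le> R" using R[OF y z] by (auto simp: r_def)
      have "r powr \<alpha> = r powr (\<alpha> - \<gamma>) * r powr \<gamma>" by (simp add: powr_add[symmetric])
      also have "\<dots> \<le> R powr (\<alpha> - \<gamma>) * r powr \<gamma>"
        using r \<beta> by (intro mult_right_mono powr_mono2) (auto simp: \<gamma>_def)
      finally have "\<bar>Kf\<bar> * r powr \<alpha> \<le> \<bar>Kf\<bar> * (R powr (\<alpha> - \<gamma>) * r powr \<gamma>)" by (rule mult_left_mono) simp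
      moreover have "Kf * r powr \<alpha> \<le> \<bar>Kf\<bar> * r powr \<alpha>" by (intro mult_right_mono) auto
      ultimately have fle: "\<bar>f \<tau> y - f \<tau> z\<bar> \<le> \<bar>Kf\<bar> * (R powr (\<alpha> - \<gamma>) * r powr \<gamma>)"
        using Kf(2)[OF \<tau> y z] by (simp add: r_def)
      have Wle: "\<bar>W \<tau> y - W \<tau> z\<bar> \<le> K * r powr \<gamma>" using K(2)[OF \<tau> y z] by (simp add: r_def)
      have "\<bar>\<mu> \<tau> y - \<mu> \<tau> z\<bar> \<le> 2 * (\<bar>f \<tau> y - f \<tau> z\<bar> + \<bar>W \<tau> y - W \<tau> z\<bar>)" by (rule \<mu>_le)
      also have "\<dots> \<le> 2 * (\<bar>Kf\<bar> * (R powr (\<alpha> - \<gamma>) * r powr \<gamma>) + K * r powr \<gamma>)"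
        by (intro mult_left_mono add_mono fle Wle) simp
      finally show "\<bar>\<mu> \<tau> y - \<mu> \<tau> z\<bar> \<le> 2 * (\<bar>Kf\<bar> * R powr (\<alpha> - \<gamma>) + K) * norm (y - z) powr \<gamma>"
        by (simp add: r_def algebra_simps)
    qed
  qed
  \<comment> \<open>Boundedness is the Hoelder condition of exponent 0. Coinciding points are
    treated separately, because \<open>0 powr 0\<close> is 0.\<close>
  have "\<exists>H\<ge>0. \<forall>\<tau>\<in>{0..T}. \<forall>y\<in>frontier \<Omega>. \<forall>z\<in>frontier \<Omega>. \<bar>\<mu> \<tau> y - \<mu> \<tau> z\<bar> \<le> H * norm (y - z) powr (0 + \<alpha> / 2)"
  proof (rule bootstrap)
    show "0 \<le> 2 * max M 0" by simp
    fix \<tau> y z assume *: "\<tau> \<in> {0..T}" "y \<in> frontier \<Omega>" "z \<in> frontier \<Omega>"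
    show "\<bar>\<mu> \<tau> y - \<mu> \<tau> z\<bar> \<le> 2 * max M 0 * norm (y - z) powr 0"
      using \<mu>_bd[OF *(1,2)] \<mu>_bd[OF *(1,3)] by (cases "y = z") auto
  qed (use assms(2) in auto)
  then obtain H where H: "H \<ge> 0" "\<And>\<tau> y z. \<tau> \<in> {0..T} \<Longrightarrow> y \<in> frontier \<Omega> \<Longrightarrow> z \<in> frontier \<Omega> \<Longrightarrow> \<bar>\<mu> \<tau> y - \<mu> \<tau> z\<bar> \<le> H * norm (y - z) powr (\<alpha> / 2)"
    unfolding add_0 by blast
  have "\<exists>H'\<ge>0. \<forall>\<tau>\<in>{0..T}. \<forall>y\<in>frontier \<Omega>. \<forall>z\<in>frontier \<Omega>. \<bar>\<mu> \<tau> y - \<mu> \<tau> z\<bar> \<le> H' * norm (y - z) powr (\<alpha> / 2 + \<alpha> / 2)"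
    by (rule bootstrap[OF _ _ H]) (use assms(2) in auto)
  then obtain H' where H': "\<And>\<tau> y z. \<tau> \<in> {0..T} \<Longrightarrow> y \<in> frontier \<Omega> \<Longrightarrow> z \<in> frontier \<Omega> \<Longrightarrow> \<bar>\<mu> \<tau> y - \<mu> \<tau> z\<bar> \<le> H' * norm (y - z) powr \<alpha>"
    unfolding field_sum_of_halves by blast
  \<comment> \<open>\<open>C0_holder\<close> asks for one constant for both variables.\<close>
  define Q where "Q = max (2 * (Kf + Kt)) H'"
  show ?thesis
    unfolding C0_holder_def
  proof (intro conjI assms(8) exI[of _ Q] ballI)
    fix t s x assume *: "t \<in> {0..T}" "s \<in> {0..T}" "x \<in> frontier \<Omega>"
    have "\<bar>\<mu> t x - \<mu> s x\<bar> \<le> 2 * (Kf + Kt) * \<bar>t - s\<bar> powr (\<alpha> / 2)"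
      using \<mu>_le[of t x s x] Kf(1)[OF *] Kt[OF *(3,1,2)] by (simp add: algebra_simps)
    also have "\<dots> \<le> Q * \<bar>t - s\<bar> powr (\<alpha> / 2)" by (intro mult_right_mono) (auto simp: Q_def)
    finally show "\<bar>\<mu> t x - \<mu> s x\<bar> \<le> Q * \<bar>t - s\<bar> powr (\<alpha> / 2)" .
  next
    fix t x y assume *: "t \<in> {0..T}" "x \<in> frontier \<Omega>" "y \<in> frontier \<Omega>"
    have "\<bar>\<mu> t x - \<mu> t y\<bar> \<le> H' * norm (x - y) powr \<alpha>" using H'[OF *] .
    also have "\<dots> \<le> Q * norm (x - y) powr \<alpha>" by (intro mult_right_mono) (auto simp: Q_def)
    finally show "\<bar>\<mu> t x - \<mu> t y\<bar> \<le> Q * norm (x - y) powr \<alpha>" .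
  qed
qed

end
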